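(* Let $\varepsilon,\delta,\tau\in(0,1)$. Let $A\in\mathbb{R}^{n\times d_1}$ have rank at most $k$ and $B\in\mathbb{R}^{n\times d_2}$. Let $S\in\mathbb{R}^{m\times n}$ be a random matrix such that (i) with probability at least $1-\delta$, $S$ is a $(1\pm\frac13)$ $\ell_2$ subspace embedding for the column span of $A$; (ii) $S$ has the $(\sqrt{\varepsilon/k},\delta)$-approximate matrix product property; (iii) $\mathbb{E}[S_i^TS_j]$ equals $1$ if $i=j$ and $0$ otherwise, where $S_i$ is the $i$-th column of $S$. Let $X^*=\arg\min_X\|AX-B\|_F$. Then with probability $1-O(\delta)$, every $\widehat X\in\mathbb{R}^{d_1\times d_2}$ with $\|SA\widehat X-SB\|_F\le(1+\tau)\min_X\|SAX-SB\|_F$ satisfies $\|A\widehat X-B\|_F\le(1+O(\varepsilon)+O(\tau/\delta))\|AX^*-B\|_F$. In particular, this holds when $S$ has entries drawn independently and uniformly from $\{-\frac1{\sqrt m},\frac1{\sqrt m}\}$ with $m=O(k\log(1/\delta)/\varepsilon)$.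
   Context: $S$ is a $(1\pm\gamma)$ $\ell_2$ subspace embedding for the column span of $A$ if $\|SAx\|_2=(1\pm\gamma)\|Ax\|_2$ for all $x$. A distribution over $S\in\mathbb{R}^{m\times n}$ has the $(\eta,\delta)$-approximate matrix product property if for all matrices $C\in\mathbb{R}^{n\times a}$, $D\in\mathbb{R}^{n\times b}$, $\Pr[\|C^TS^TSD-C^TD\|_F\ge\eta\|C\|_F\|D\|_F]\le\delta$. *)

theory Defs
  imports
    "HOL-Probability.Probability"
    "HOL-Probability.Product_PMF"
    "Jordan_Normal_Form.DL_Rank"
begin

text \<open>Matrices are those of Jordan_Normal_Form, whose dimensions are natural numbers. The
  dimensions can therefore be quantified inside a formula, below the absolute constants hidden
  in the O-notation.\<close>

definition l2_norm :: "real Matrix.vec \<Rightarrow> real" where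
  "l2_norm v = sqrt (\<Sum>i<dim_vec v. (vec_index v i)\<^sup>2)"

definition frob_norm :: "real Matrix.mat \<Rightarrow> real" where
  "frob_norm A = sqrt (\<Sum>i<dim_row A. \<Sum>j<dim_col A. (A $$ (i, j))\<^sup>2)"

definition subspace_embedding :: "real \<Rightarrow> real Matrix.mat \<Rightarrow> real Matrix.mat \<Rightarrow> bool" where
  "subspace_embedding \<gamma> S A \<longleftrightarrow>
     (\<forall>x\<in>carrier_vec (dim_col A).
        (1 - \<gamma>) * l2_norm (A *\<^sub>v x) \<le> l2_norm (S *\<^sub>v (A *\<^sub>v x)) \<and>
        l2_norm (S *\<^sub>v (A *\<^sub>v x)) \<le> (1 + \<gamma>) * l2_norm (A *\<^sub>v x))"

text \<open>The Borel space of real \<open>m \<times> n\<close> matrices, identified with functions on the index pairs. A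
  random matrix is represented by its distribution on this space.\<close>

definition mat_borel :: "nat \<Rightarrow> nat \<Rightarrow> real Matrix.mat measure" where
  "mat_borel m n =
     vimage_algebra (carrier_mat m n)
       (\<lambda>S. restrict (\<lambda>ij. S $$ ij) ({..<m} \<times> {..<n}))
       (\<Pi>\<^sub>M ij\<in>{..<m} \<times> {..<n}. borel)"

definition matrix_distribution :: "nat \<Rightarrow> nat \<Rightarrow> real Matrix.mat measure \<Rightarrow> bool" where
  "matrix_distribution m n P \<longleftrightarrow> prob_space P \<and> sets P = sets (mat_borel m n)"

text \<open>Zero matrices \<open>C\<close>, \<open>D\<close> have to be excluded: for them the event with the non-strict inequality
  reads \<open>0 \<ge> 0\<close> and has probability 1, so that no distribution would have the property for
  \<open>\<delta> < 1\<close>.\<close>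

definition approx_matrix_product ::
    "nat \<Rightarrow> real \<Rightarrow> real \<Rightarrow> real Matrix.mat measure \<Rightarrow> bool" where
  "approx_matrix_product n \<eta> \<delta> P \<longleftrightarrow>
     (\<forall>a b C D. C \<in> carrier_mat n a \<longrightarrow> D \<in> carrier_mat n b \<longrightarrow> C \<noteq> 0\<^sub>m n a \<longrightarrow> D \<noteq> 0\<^sub>m n b \<longrightarrow>
        measure P {S \<in> space P.
          frob_norm (transpose_mat C * transpose_mat S * S * D - transpose_mat C * D)
            \<ge> \<eta> * frob_norm C * frob_norm D} \<le> \<delta>)"

definition isotropic_columns :: "nat \<Rightarrow> real Matrix.mat measure \<Rightarrow> bool" where
  "isotropic_columns n P \<longleftrightarrow>
     (\<forall>i<n. \<forall>j<n. (\<integral>S. scalar_prod (Matrix.col S i) (Matrix.col S j) \<partial>P) = (if i = j then 1 else 0))"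

definition regression_cost ::
    "real Matrix.mat \<Rightarrow> real Matrix.mat \<Rightarrow> real Matrix.mat \<Rightarrow> real" where
  "regression_cost A B X = frob_norm (A * X - B)"

text \<open>The infimum is a minimum: this is a least squares problem over a finite-dimensional space.\<close>

definition min_regression_cost :: "real Matrix.mat \<Rightarrow> real Matrix.mat \<Rightarrow> real" where
  "min_regression_cost A B =
     (INF X\<in>carrier_mat (dim_col A) (dim_col B). regression_cost A B X)"

definition regression_minimizer ::
    "real Matrix.mat \<Rightarrow> real Matrix.mat \<Rightarrow> real Matrix.mat \<Rightarrow> bool" where
  "regression_minimizer A B X \<longleftrightarrow>
     is_arg_min (regression_cost A B) (\<lambda>Y. Y \<in> carrier_mat (dim_col A) (dim_col B)) X"

definition sketched_regression_event ::
    "real \<Rightarrow> real \<Rightarrow> real Matrix.mat \<Rightarrow> real Matrix.mat \<Rightarrow> real Matrix.mat \<Rightarrow>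
     real Matrix.mat measure \<Rightarrow> real Matrix.mat set" where
  "sketched_regression_event \<tau> r A B Xopt P =
     {S \<in> space P. \<forall>X\<in>carrier_mat (dim_col A) (dim_col B).
        regression_cost (S * A) (S * B) X \<le> (1 + \<tau>) * min_regression_cost (S * A) (S * B) \<longrightarrow>
        regression_cost A B X \<le> r * regression_cost A B Xopt}"

definition random_sign_matrix :: "nat \<Rightarrow> nat \<Rightarrow> real Matrix.mat measure" where
  "random_sign_matrix m n =
     distr (Pi_pmf ({..<m} \<times> {..<n}) 0 (\<lambda>_. pmf_of_set {- 1 / sqrt (real m), 1 / sqrt (real m)}))
       (mat_borel m n) (Matrix.mat m n)"

lemma matrix_distribution_random_sign_matrix:
  "matrix_distribution m n (random_sign_matrix m n)"
proof -
  have "Matrix.mat m n \<in> measurable (measure_pmf (Pi_pmf ({..<m} \<times> {..<n}) 0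
      (\<lambda>_. pmf_of_set {- 1 / sqrt (real m), 1 / sqrt (real m)}))) (mat_borel m n)"
    by (auto simp: measurable_def mat_borel_def)
  then show ?thesis
    unfolding matrix_distribution_def random_sign_matrix_def
    by (auto intro!: measure_pmf.prob_space_distr)
qed

end

theory Submission
  imports Defs
begin

text \<open>Let \<open>R = AX\<^sup>* - B\<close>, which is orthogonal to the column space of \<open>A\<close>, let \<open>D = A(X - X\<^sup>*)\<close>, and let the
  columns of \<open>U\<close> be an orthonormal basis of the column space. Comparing the sketched costs of an
  approximate minimizer \<open>X\<close> and of \<open>X\<^sup>*\<close> gives \<open>\<parallel>SD\<parallel>\<^sup>2 \<le> 2|\<langle>SD, SR\<rangle>| + 3\<tau>\<parallel>SR\<parallel>\<^sup>2\<close>. The matrix product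
  property for \<open>U\<close> and \<open>R\<close> bounds the cross term by \<open>\<surd>\<epsilon> \<parallel>D\<parallel> \<parallel>R\<parallel>\<close>, Markov's inequality and isotropy bound
  \<open>\<parallel>SR\<parallel>\<^sup>2\<close> by \<open>\<parallel>R\<parallel>\<^sup>2 / \<delta>\<close>, and the embedding gives \<open>\<parallel>D\<parallel> \<le> 3/2 \<parallel>SD\<parallel>\<close>; so \<open>\<parallel>D\<parallel>\<^sup>2 = O(\<epsilon> + \<tau>/\<delta>) \<parallel>R\<parallel>\<^sup>2\<close>.

  For random signs, the moment generating function of \<open>\<langle>Su, Sv\<rangle> - \<langle>u, v\<rangle>\<close> yields
  \<open>E(\<langle>Su, Sv\<rangle> - \<langle>u, v\<rangle>)\<^sup>2\<^sup>q \<le> 2(Lq/m)\<^sup>q |u|\<^sup>2\<^sup>q |v|\<^sup>2\<^sup>q\<close> for \<open>q \<le> m\<close>. With \<open>q \<approx> ln (1/\<delta>)\<close> this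
  gives the matrix product property, and with \<open>q \<approx> k ln (1/\<delta>)\<close> it survives a union bound over a net of
  size \<open>2\<^sup>O\<^sup>(\<^sup>k\<^sup>)\<close> and gives the embedding.\<close>

subsection \<open>Measurability of the regression event\<close>

text \<open>The hypotheses on \<open>S\<close> concern fixed matrices, whereas the conclusion ranges
  over all \<open>X\<close>. They are applied to \<open>A\<close>, \<open>U\<close> and
  \<open>R\<close>, none of which depends on \<open>X\<close>, so three events of failure
  probability at most \<delta> suffice. The orthonormal basis matters for its size:
  \<open>frob_norm U\<close> is at most \<open>sqrt k\<close>, which cancels the \<open>k\<close> in
  the accuracy \<open>sqrt (\<epsilon> / k)\<close>. Isotropy gives the mean of the squared norm of
  \<open>S * R\<close> and nothing about its tail, hence the loss \<open>1 / \<delta>\<close> in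
  front of \<tau>.

  For random signs, \<open><Su, Sv>\<close> is a sum of products of two sub-Gaussian forms. The
  moment generating function of such a product is controlled on a bounded range only, and this is
  the origin of the condition \<open>q \<le> m\<close>. A number of rows linear in \<open>k\<close>
  leaves no room for a factor \<open>ln k\<close> in the exponent of the net, so the lattice points
  are counted by their 1-norm: the surrounding box alone has \<open>(34 r + 1)^r\<close>
  points.\<close>

lemma measurable_entry_mat_borel:
  assumes "i < m" "j < n"
  shows "(\<lambda>S. S $$ (i, j)) \<in> borel_measurable (mat_borel m n)"
proof -
  let ?I = "{..<m} \<times> {..<n}"
  have r: "(\<lambda>S. restrict (\<lambda>ij. S $$ ij) ?I) \<in> measurable (mat_borel m n) (\<Pi>\<^sub>M ij\<in>?I. borel :: real measure)"
    unfolding mat_borel_def by (rule measurable_vimage_algebra1) (auto simp: space_PiM)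
  have "(\<lambda>S. restrict (\<lambda>ij. S $$ ij) ?I (i, j)) \<in> borel_measurable (mat_borel m n)"
    using assms by (intro measurable_compose[OF r measurable_component_singleton]) auto
  then show ?thesis using assms by simp
qed

lemma space_mat_borel [simp]: "space (mat_borel m n) = carrier_mat m n"
  by (simp add: mat_borel_def)

text \<open>Padding the entries with zeros sends a matrix to a function on all of
  \<open>nat \<times> nat\<close>, where the product topology over a countable index type makes
  coordinatewise measurable maps Borel. Closedness can therefore be checked on functions, through
  \<open>Matrix.mat m n\<close>.\<close>

lemma closed_imp_sets_mat_borel:
  assumes "closed {f :: nat \<times> nat \<Rightarrow> real. Q (Matrix.mat m n f)}"
  shows "{S \<in> carrier_mat m n. Q S} \<in> sets (mat_borel m n)"
proof -
  let ?I = "{..<m} \<times> {..<n}"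
  define g :: "real Matrix.mat \<Rightarrow> nat \<times> nat \<Rightarrow> real" where "g S ij = (if ij \<in> ?I then S $$ ij else 0)" for S ij
  have "(\<lambda>S. g S ij) \<in> borel_measurable (mat_borel m n)" for ij
    unfolding g_def by (cases "ij \<in> ?I") (auto intro: measurable_entry_mat_borel)
  then have g: "g \<in> borel_measurable (mat_borel m n)"
    by (rule measurable_coordinatewise_then_product)
  have gS: "Matrix.mat m n (g S) = S" if "S \<in> carrier_mat m n" for S
    using that by (intro eq_matI) (auto simp: g_def)
  have "g -` {f. Q (Matrix.mat m n f)} \<inter> space (mat_borel m n) \<in> sets (mat_borel m n)"
    by (rule measurable_sets[OF g]) (use assms in auto)
  also have "g -` {f. Q (Matrix.mat m n f)} \<inter> space (mat_borel m n) = {S \<in> carrier_mat m n. Q S}"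
    by (auto simp: gS)
  finally show ?thesis .
qed

text \<open>Tychonoff's theorem. Every coordinate is bounded, also those that
  \<open>Matrix.mat\<close> later ignores, since a free coordinate would destroy
  compactness.\<close>

lemma compact_function_box: "compact {g :: 'a \<Rightarrow> real. \<forall>i. \<bar>g i\<bar> \<le> N}"
proof -
  have "compactin (product_topology (\<lambda>_::'a. euclidean) UNIV) (PiE UNIV (\<lambda>_. {-N..N}))"
    by (subst compactin_PiE) auto
  also have "PiE UNIV (\<lambda>_. {-N..N}) = {g :: 'a \<Rightarrow> real. \<forall>i. \<bar>g i\<bar> \<le> N}"
    by (auto simp: PiE_UNIV_domain Pi_iff abs_le_iff) (metis neg_le_iff_le minus_minus)+
  finally show ?thesis by (simp add: euclidean_product_topology)
qed

text \<open>The complement is open by the tube lemma: if no point of \<open>{x} \<times> K\<close>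
  lies in \<open>T\<close>, then neither does any point over a whole neighbourhood of
  \<open>x\<close>.\<close>

lemma closed_projection_along_compact:
  assumes K: "compact K" and T: "closed T"
  shows "closed {x. \<exists>y\<in>K. (x, y) \<in> T}"
proof -
  have "open {x. \<forall>y\<in>K. (x, y) \<notin> T}"
  proof (subst open_subopen, safe)
    fix x assume x: "\<forall>y\<in>K. (x, y) \<notin> T"
    then have "{x} \<times> K \<subseteq> - T" by auto
    from Elementary_Topology.tube_lemma[OF K open_Compl[OF T] this]
    show "\<exists>X0. open X0 \<and> x \<in> X0 \<and> X0 \<subseteq> {x. \<forall>y\<in>K. (x, y) \<notin> T}" by blast
  qed
  moreover have "{x. \<forall>y\<in>K. (x, y) \<notin> T} = - {x. \<exists>y\<in>K. (x, y) \<in> T}" by auto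
  ultimately show ?thesis by (simp add: closed_def)
qed

text \<open>Continuity entry by entry at fixed dimensions. The parameter space stays abstract, so
  that the same closure rules serve functions that code \<open>S\<close> and pairs that code
  \<open>(S, X)\<close>.\<close>

definition continuous_mat :: "nat \<Rightarrow> nat \<Rightarrow> ('a::topological_space \<Rightarrow> real Matrix.mat) \<Rightarrow> bool" where
  "continuous_mat m n F \<longleftrightarrow> (\<forall>p. F p \<in> carrier_mat m n) \<and>
     (\<forall>i<m. \<forall>j<n. continuous_on UNIV (\<lambda>p. F p $$ (i, j)))"

lemma continuous_mat_const: "C \<in> carrier_mat m n \<Longrightarrow> continuous_mat m n (\<lambda>_. C)"
  by (simp add: continuous_mat_def)

lemma continuous_mat_mat:
  assumes "\<And>ij. continuous_on UNIV (\<lambda>p. h p ij)"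
  shows "continuous_mat m n (\<lambda>p. Matrix.mat m n (h p))"
  using assms by (auto simp: continuous_mat_def)

lemma continuous_mat_mult:
  assumes "continuous_mat m l F" "continuous_mat l n G"
  shows "continuous_mat m n (\<lambda>p. F p * G p)"
  unfolding continuous_mat_def
proof (intro conjI allI impI)
  show "F p * G p \<in> carrier_mat m n" for p
    using assms by (auto simp: continuous_mat_def intro: mult_carrier_mat)
  fix i j assume ij: "i < m" "j < n"
  have "(\<lambda>p. (F p * G p) $$ (i, j)) = (\<lambda>p. \<Sum>a<l. F p $$ (i, a) * G p $$ (a, j))"
  proof
    fix p
    have "F p \<in> carrier_mat m l" "G p \<in> carrier_mat l n" using assms by (auto simp: continuous_mat_def)
    then show "(F p * G p) $$ (i, j) = (\<Sum>a<l. F p $$ (i, a) * G p $$ (a, j))"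
      using ij by (auto simp: scalar_prod_def lessThan_atLeast0)
  qed
  then show "continuous_on UNIV (\<lambda>p. (F p * G p) $$ (i, j))"
    using assms ij unfolding \<open>(\<lambda>p. (F p * G p) $$ (i, j)) = _\<close> by (auto simp: continuous_mat_def intro!: continuous_intros)
qed

lemma continuous_mat_minus:
  assumes "continuous_mat m n F" "continuous_mat m n G"
  shows "continuous_mat m n (\<lambda>p. F p - G p)"
  unfolding continuous_mat_def
proof (intro conjI allI impI)
  show "F p - G p \<in> carrier_mat m n" for p
    using assms by (auto simp: continuous_mat_def intro: minus_carrier_mat)
  fix i j assume ij: "i < m" "j < n"
  have "(\<lambda>p. (F p - G p) $$ (i, j)) = (\<lambda>p. F p $$ (i, j) - G p $$ (i, j))"
  proof
    fix p
    have "G p \<in> carrier_mat m n" using assms by (auto simp: continuous_mat_def)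
    then show "(F p - G p) $$ (i, j) = F p $$ (i, j) - G p $$ (i, j)"
      using ij by auto
  qed
  then show "continuous_on UNIV (\<lambda>p. (F p - G p) $$ (i, j))"
    using assms ij unfolding \<open>(\<lambda>p. (F p - G p) $$ (i, j)) = _\<close> by (auto simp: continuous_mat_def intro!: continuous_intros)
qed

lemma continuous_mat_transpose:
  assumes "continuous_mat m n F"
  shows "continuous_mat n m (\<lambda>p. transpose_mat (F p))"
proof -
  have "F p \<in> carrier_mat m n" for p using assms by (auto simp: continuous_mat_def)
  then have "(transpose_mat (F p)) $$ (i, j) = F p $$ (j, i)" if "i < n" "j < m" for p i j
    using that by (metis carrier_matD index_transpose_mat(1))
  then show ?thesis using assms by (auto simp: continuous_mat_def)
qed

lemma continuous_on_frob_norm: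
  assumes "continuous_mat m n F"
  shows "continuous_on UNIV (\<lambda>p. frob_norm (F p))"
proof -
  have "F p \<in> carrier_mat m n" for p using assms by (auto simp: continuous_mat_def)
  then have "frob_norm (F p) = sqrt (\<Sum>i<m. \<Sum>j<n. (F p $$ (i, j))\<^sup>2)" for p
    unfolding frob_norm_def by (metis carrier_matD)
  then show ?thesis using assms
    by (auto simp: continuous_mat_def intro!: continuous_intros)
qed

lemma continuous_on_coordinate_fst:
  "continuous_on UNIV (\<lambda>p :: ('a \<Rightarrow> real) \<times> 'b::topological_space. fst p i)"
  by (rule continuous_on_compose2[OF continuous_on_product_coordinates continuous_on_fst]) (auto intro: continuous_intros)

lemma continuous_on_coordinate_snd:
  "continuous_on UNIV (\<lambda>p :: 'b::topological_space \<times> ('a \<Rightarrow> real). snd p i)"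
  by (rule continuous_on_compose2[OF continuous_on_product_coordinates continuous_on_snd]) (auto intro: continuous_intros)

lemma bdd_below_regression_cost: "bdd_below (regression_cost A B ` X)"
  by (rule bdd_belowI[of _ 0]) (auto simp: regression_cost_def frob_norm_def sum_nonneg)

text \<open>The event is not a countable combination of measurable events on its face, since the
  approximate minimizer \<open>X\<close> ranges over a continuum. Its complement is the union over \<open>N\<close> of the
  projections of closed sets of pairs \<open>(S, X)\<close> with \<open>X\<close> in a compact box, hence an \<open>F\<^sub>\<sigma>\<close> set.\<close>

lemma sets_sketched_regression_event:
  assumes A: "A \<in> carrier_mat n d\<^sub>1" and B: "B \<in> carrier_mat n d\<^sub>2" and \<tau>: "\<tau> \<ge> 0"
    and P: "sets P = sets (mat_borel m n)"
  shows "sketched_regression_event \<tau> r A B Xopt P \<in> sets P"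
proof -
  let ?X = "carrier_mat d\<^sub>1 d\<^sub>2 :: real Matrix.mat set"
  let ?cost = "\<lambda>S. regression_cost (S * A) (S * B)"
  define q where "q = r * regression_cost A B Xopt"
  \<comment> \<open>The margin \<open>1 / real (Suc N)\<close> turns the strict violation of the
    bound into a closed condition, and the bound \<open>real N\<close> on \<open>g\<close> confines
    \<open>X\<close> to a compact box. Every violation satisfies both for large
    \<open>N\<close>.\<close>
  define bad :: "nat \<Rightarrow> real Matrix.mat \<Rightarrow> bool" where
    "bad N S \<longleftrightarrow> (\<exists>g. (\<forall>ij. \<bar>g ij\<bar> \<le> real N) \<and> (\<forall>Y\<in>?X. ?cost S (Matrix.mat d\<^sub>1 d\<^sub>2 g) \<le> (1 + \<tau>) * ?cost S Y) \<and>
       regression_cost A B (Matrix.mat d\<^sub>1 d\<^sub>2 g) \<ge> q + 1 / real (Suc N))" for N S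
  have space: "space P = carrier_mat m n"
    using sets_eq_imp_space_eq[OF P] by simp
  have bad_sets: "{S \<in> carrier_mat m n. bad N S} \<in> sets (mat_borel m n)" for N
  proof (rule closed_imp_sets_mat_borel)
    let ?K = "{g :: nat \<times> nat \<Rightarrow> real. \<forall>ij. \<bar>g ij\<bar> \<le> real N}"
    let ?S = "\<lambda>p :: (nat \<times> nat \<Rightarrow> real) \<times> (nat \<times> nat \<Rightarrow> real). Matrix.mat m n (fst p)"
    let ?G = "\<lambda>p :: (nat \<times> nat \<Rightarrow> real) \<times> (nat \<times> nat \<Rightarrow> real). Matrix.mat d\<^sub>1 d\<^sub>2 (snd p)"
    define T where "T = {p. (\<forall>Y\<in>?X. ?cost (?S p) (?G p) \<le> (1 + \<tau>) * ?cost (?S p) Y) \<and>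
       q + 1 / real (Suc N) \<le> regression_cost A B (?G p)}"
    have S: "continuous_mat m n ?S" and G: "continuous_mat d\<^sub>1 d\<^sub>2 ?G"
      by (auto intro!: continuous_mat_mat continuous_on_coordinate_fst continuous_on_coordinate_snd)
    have c: "continuous_on UNIV (\<lambda>p. ?cost (?S p) (H p))" if "continuous_mat d\<^sub>1 d\<^sub>2 H" for H
      unfolding regression_cost_def
      by (intro continuous_on_frob_norm continuous_mat_minus continuous_mat_mult)
         (rule S that continuous_mat_const A B)+
    have c': "continuous_on UNIV (\<lambda>p. regression_cost A B (?G p))"
      unfolding regression_cost_def
      by (intro continuous_on_frob_norm continuous_mat_minus continuous_mat_mult)
         (rule G continuous_mat_const A B)+
    have "closed {p. ?cost (?S p) (?G p) \<le> (1 + \<tau>) * ?cost (?S p) Y}" if "Y \<in> ?X" for Y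
      by (intro closed_Collect_le c G continuous_on_mult continuous_on_const continuous_mat_const that)
    moreover have "closed {p. q + 1 / real (Suc N) \<le> regression_cost A B (?G p)}"
      by (intro closed_Collect_le c' continuous_on_const)
    moreover have "T = (\<Inter>Y\<in>?X. {p. ?cost (?S p) (?G p) \<le> (1 + \<tau>) * ?cost (?S p) Y}) \<inter>
        {p. q + 1 / real (Suc N) \<le> regression_cost A B (?G p)}"
      unfolding T_def by blast
    ultimately have "closed T" by (simp add: closed_Int closed_INT)
    then have "closed {f. \<exists>g\<in>?K. (f, g) \<in> T}"
      by (rule closed_projection_along_compact[OF compact_function_box])
    also have "{f. \<exists>g\<in>?K. (f, g) \<in> T} = {f. bad N (Matrix.mat m n f)}"
      by (auto simp: T_def bad_def)
    finally show "closed {f. bad N (Matrix.mat m n f)}" .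
  qed
  \<comment> \<open>The infimum depends on \<open>S\<close>. Comparing with each fixed
    \<open>Y\<close> instead gives conditions that are closed in \<open>(S, X)\<close>, and
    closedness survives their uncountable intersection.\<close>
  have approx_min_iff: "?cost S X \<le> (1 + \<tau>) * min_regression_cost (S * A) (S * B) \<longleftrightarrow>
      (\<forall>Y\<in>?X. ?cost S X \<le> (1 + \<tau>) * ?cost S Y)" for S X
  proof -
    have dims: "dim_col (S * A) = d\<^sub>1" "dim_col (S * B) = d\<^sub>2" using A B by auto
    have "?X \<noteq> {}" by (metis empty_iff zero_carrier_mat)
    then have "?cost S X / (1 + \<tau>) \<le> (INF Y\<in>?X. ?cost S Y) \<longleftrightarrow> (\<forall>Y\<in>?X. ?cost S X / (1 + \<tau>) \<le> ?cost S Y)"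
      by (rule le_cINF_iff) (rule bdd_below_regression_cost)
    then show ?thesis using \<tau>
      unfolding min_regression_cost_def dims by (simp add: divide_le_eq mult.commute)
  qed
  have "sketched_regression_event \<tau> r A B Xopt P = carrier_mat m n - (\<Union>N. {S \<in> carrier_mat m n. bad N S})"
  proof (intro equalityI subsetI)
    fix S assume S: "S \<in> sketched_regression_event \<tau> r A B Xopt P"
    have "\<not> bad N S" for N
    proof
      assume "bad N S"
      then obtain g where g: "\<forall>Y\<in>?X. ?cost S (Matrix.mat d\<^sub>1 d\<^sub>2 g) \<le> (1 + \<tau>) * ?cost S Y"
        "q + 1 / real (Suc N) \<le> regression_cost A B (Matrix.mat d\<^sub>1 d\<^sub>2 g)" unfolding bad_def by blast
      have "regression_cost A B (Matrix.mat d\<^sub>1 d\<^sub>2 g) \<le> q"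
        using S g(1) A B unfolding sketched_regression_event_def approx_min_iff q_def by auto
      moreover have "1 / real (Suc N) > 0" by simp
      ultimately show False using g(2) by linarith
    qed
    then show "S \<in> carrier_mat m n - (\<Union>N. {S \<in> carrier_mat m n. bad N S})"
      using S space by (auto simp: sketched_regression_event_def)
  next
    fix S assume S: "S \<in> carrier_mat m n - (\<Union>N. {S \<in> carrier_mat m n. bad N S})"
    have "regression_cost A B X \<le> q" if X: "X \<in> ?X" and
      min: "\<forall>Y\<in>?X. ?cost S X \<le> (1 + \<tau>) * ?cost S Y" for X
    proof (rule ccontr)
      assume *: "\<not> ?thesis"
      define g where "g ij = (if ij \<in> {..<d\<^sub>1} \<times> {..<d\<^sub>2} then X $$ ij else 0)" for ij
      have gX: "Matrix.mat d\<^sub>1 d\<^sub>2 g = X" using X by (intro eq_matI) (auto simp: g_def)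
      have "finite ((\<lambda>ij. \<bar>X $$ ij\<bar>) ` ({..<d\<^sub>1} \<times> {..<d\<^sub>2}))" by simp
      then obtain M where M: "\<And>ij. ij \<in> {..<d\<^sub>1} \<times> {..<d\<^sub>2} \<Longrightarrow> \<bar>X $$ ij\<bar> \<le> M"
        using bdd_above_finite unfolding bdd_above_def by (metis imageI)
      obtain N1 where N1: "M \<le> real N1" using real_arch_simple by blast
      obtain N2 where N2: "1 / real (Suc N2) < regression_cost A B X - q"
        using * nat_approx_posE[of "regression_cost A B X - q"] by auto
      define N where "N = max N1 N2"
      have "1 / real (Suc N) \<le> 1 / real (Suc N2)" by (auto simp: N_def frac_le)
      then have "q + 1 / real (Suc N) \<le> regression_cost A B X" using N2 by linarith
      moreover have "\<bar>g ij\<bar> \<le> real N" for ij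
        using M[of ij] N1 by (auto simp: g_def N_def)
      ultimately have "bad N S" unfolding bad_def using gX min by (intro exI[of _ g]) auto
      then show False using S by auto
    qed
    then show "S \<in> sketched_regression_event \<tau> r A B Xopt P"
      using S A B unfolding sketched_regression_event_def approx_min_iff space q_def by auto
  qed
  also have "\<dots> \<in> sets (mat_borel m n)"
  proof (rule sets.Diff)
    show "carrier_mat m n \<in> sets (mat_borel m n)"
      using sets.top[of "mat_borel m n"] by simp
  qed (use bad_sets in blast)
  finally show ?thesis by (simp add: P)
qed

subsection \<open>Orthonormal bases of column spaces\<close>

lemma (in vec_space) rank_mono:
  assumes U: "U \<in> carrier_mat n r" and A: "A \<in> carrier_mat n d" and sub: "set (cols U) \<subseteq> span (set (cols A))"
  shows "rank U \<le> rank A"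
proof -
  have cA: "set (cols A) \<subseteq> carrier_vec n" and cU: "set (cols U) \<subseteq> carrier_vec n"
    using A U cols_dim by blast+
  have subA: "subspace class_ring (span (set (cols A))) V" and subU: "subspace class_ring (span (set (cols U))) V"
    using span_is_subspace cA cU by auto
  have "span (set (cols U)) \<subseteq> span (set (cols A))"
    using span_is_subset[OF sub] subA by (simp add: subspace_def)
  then have "subspace class_ring (span (set (cols U))) (span_vs (set (cols A)))"
    by (rule nested_subspaces[OF subA subU])
  from vectorspace.subspace_dim[OF subspace_is_vs[OF subA] this]
  show ?thesis
    using fin_dim_span_cols[OF A] fin_dim_span_cols[OF U] unfolding rank_def by auto
qed

text \<open>Orthonormal columns are independent, because \<open>v = U^T U v\<close> vanishes
  whenever \<open>U v\<close> does, and columns of the form \<open>A W\<close> lie in the column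
  space. This caps the size of the orthonormal systems among which the next proof chooses.\<close>

lemma orthonormal_cols_le_rank:
  fixes A :: "real Matrix.mat"
  assumes A: "A \<in> carrier_mat n d" and W: "W \<in> carrier_mat d r"
    and orth: "transpose_mat (A * W) * (A * W) = 1\<^sub>m r"
  shows "r \<le> vec_space.rank n A"
proof -
  interpret vec_space "TYPE(real)" n .
  let ?U = "A * W"
  have U: "?U \<in> carrier_mat n r" using A W by auto
  have dot: "scalar_prod (col ?U i) (col ?U j) = (if i = j then 1 else 0)" if "i < r" "j < r" for i j
  proof -
    have "(transpose_mat ?U * ?U) $$ (i, j) = scalar_prod (col ?U i) (col ?U j)"
      using U that A W by (subst index_mult_mat) auto
    then show ?thesis using orth that by simp
  qed
  have dist: "distinct (cols ?U)"
  proof (subst distinct_conv_nth, safe)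
    fix i j assume ij: "i < length (cols ?U)" "j < length (cols ?U)" "i \<noteq> j" "cols ?U ! i = cols ?U ! j"
    then have "i < r" "j < r" using U W by auto
    then show False using ij dot[of i j] dot[of i i] U W by (auto simp: cols_nth)
  qed
  have "lin_indpt (set (cols ?U))"
  proof
    assume "lin_dep (set (cols ?U))"
    from lin_depE[OF U this dist] obtain v where
      v: "v \<in> carrier_vec r" "v \<noteq> 0\<^sub>v r" "?U *\<^sub>v v = 0\<^sub>v n" by blast
    have "v = (transpose_mat ?U * ?U) *\<^sub>v v" using orth v by simp
    also have "\<dots> = transpose_mat ?U *\<^sub>v (?U *\<^sub>v v)"
      using U v by (intro assoc_mult_mat_vec) auto
    also have "\<dots> = 0\<^sub>v r"
      unfolding v(3) using carrier_matD[OF U]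
      by (intro eq_vecI) (auto simp del: index_mult_mat intro!: scalar_prod_right_zero[of _ n] carrier_vecI)
    finally show False using v by simp
  qed
  then have "rank ?U = r" using lin_indpt_full_rank[OF U dist] by simp
  moreover have "set (cols ?U) \<subseteq> span (set (cols A))"
  proof
    fix u assume "u \<in> set (cols ?U)"
    then obtain i where i: "i < r" "u = col ?U i"
      using U W by (auto simp: in_set_conv_nth)
    then have "u = A *\<^sub>v col W i" using col_mult2[OF A W] by simp
    then show "u \<in> span (set (cols A))"
      using col_space_eq[OF A] A W i unfolding col_space_def by auto
  qed
  ultimately show ?thesis using rank_mono[OF U A] by simp
qed

text \<open>Gram-Schmidt by maximality: take an orthonormal system of the form \<open>A W\<close>
  with as many columns as possible. A column of \<open>A\<close> that differs from its projection
  leaves a nonzero residual in the column space, orthogonal to the system, whose normalization would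
  enlarge the system.\<close>

lemma orthonormal_column_space_basis:
  fixes A :: "real Matrix.mat"
  assumes A: "A \<in> carrier_mat n d"
  obtains r U where "r \<le> vec_space.rank n A" "U \<in> carrier_mat n r" "transpose_mat U * U = 1\<^sub>m r"
    "A = U * (transpose_mat U * A)"
proof -
  define Q where "Q r \<longleftrightarrow> (\<exists>W\<in>carrier_mat d r. transpose_mat (A * W) * (A * W) = 1\<^sub>m r)" for r
  have "Q 0" unfolding Q_def
    by (intro bexI[of _ "0\<^sub>m d 0"] eq_matI) (use A in auto)
  moreover have "\<forall>r. Q r \<longrightarrow> r \<le> vec_space.rank n A"
    unfolding Q_def using orthonormal_cols_le_rank[OF A] by blast
  ultimately obtain r where "Q r" and max: "\<And>s. Q s \<Longrightarrow> s \<le> r" and rank: "r \<le> vec_space.rank n A"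
    using Nat.ex_has_greatest_nat[of Q 0] by metis
  then obtain W where W: "W \<in> carrier_mat d r" and orth: "transpose_mat (A * W) * (A * W) = 1\<^sub>m r"
    unfolding Q_def by blast
  define U where "U = A * W"
  have U: "U \<in> carrier_mat n r" using A W by (auto simp: U_def)
  have UT: "transpose_mat U \<in> carrier_mat r n" using U by auto
  have UU: "transpose_mat U * U = 1\<^sub>m r" using orth by (simp add: U_def)
  have dotU: "scalar_prod (col U i) (col U j) = (if i = j then 1 else 0)" if "i < r" "j < r" for i j
  proof -
    have "(transpose_mat U * U) $$ (i, j) = scalar_prod (col U i) (col U j)"
      using U that by (subst index_mult_mat) auto
    then show ?thesis using UU that by simp
  qed
  have "A = U * (transpose_mat U * A)"
  proof (rule mat_col_eqI)
    fix j assume "j < dim_col (U * (transpose_mat U * A))"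
    then have j: "j < d" using A by simp
    define a where "a = col A j"
    have a: "a \<in> carrier_vec n" using A j by (auto simp: a_def)
    \<comment> \<open>Chosen so that \<open>A x = a - U (U^T a)\<close>: writing the residual as an
      image under \<open>A\<close> keeps the enlarged system of the form
      \<open>A W'\<close>.\<close>
    define x where "x = unit_vec d j - W *\<^sub>v (transpose_mat U *\<^sub>v a)"
    have x: "x \<in> carrier_vec d" using W UT a by (auto simp: x_def)
    define w where "w = A *\<^sub>v x"
    have w: "w \<in> carrier_vec n" using A x by (auto simp: w_def)
    have aj: "A *\<^sub>v unit_vec d j = a"
      using A j by (intro eq_vecI) (auto simp: a_def)
    have y: "transpose_mat U *\<^sub>v a \<in> carrier_vec r" using UT a by auto
    have w_eq: "w = a - U *\<^sub>v (transpose_mat U *\<^sub>v a)"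
    proof -
      have "w = a - A *\<^sub>v (W *\<^sub>v (transpose_mat U *\<^sub>v a))"
        unfolding w_def x_def
        using mult_minus_distrib_mat_vec[OF A unit_vec_carrier mult_mat_vec_carrier[OF W y]] by (simp add: aj)
      also have "A *\<^sub>v (W *\<^sub>v (transpose_mat U *\<^sub>v a)) = U *\<^sub>v (transpose_mat U *\<^sub>v a)"
        unfolding U_def by (rule assoc_mult_mat_vec[symmetric, OF A W]) (use y in \<open>simp add: U_def\<close>)
      finally show ?thesis .
    qed
    have Uw: "transpose_mat U *\<^sub>v w = 0\<^sub>v r"
    proof -
      have "transpose_mat U *\<^sub>v w = transpose_mat U *\<^sub>v a - transpose_mat U *\<^sub>v (U *\<^sub>v (transpose_mat U *\<^sub>v a))"
        unfolding w_eq by (rule mult_minus_distrib_mat_vec[OF UT a]) (use U UT a in auto)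
      also have "transpose_mat U *\<^sub>v (U *\<^sub>v (transpose_mat U *\<^sub>v a)) = (transpose_mat U * U) *\<^sub>v (transpose_mat U *\<^sub>v a)"
        using U UT a by (intro assoc_mult_mat_vec[symmetric]) auto
      also have "\<dots> = transpose_mat U *\<^sub>v a" unfolding UU using UT a by simp
      finally show ?thesis using UT a by simp
    qed
    have dotw: "scalar_prod (col U i) w = 0" if "i < r" for i
    proof -
      have "(transpose_mat U *\<^sub>v w) $ i = scalar_prod (col U i) w"
        using U that by (subst index_mult_mat_vec) auto
      then show ?thesis using Uw that by simp
    qed
    have "w = 0\<^sub>v n"
    proof (rule ccontr)
      assume nz: "w \<noteq> 0\<^sub>v n"
      have pos: "scalar_prod w w > 0"
      proof -
        obtain i where i: "i < n" "w $ i \<noteq> 0"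
          using nz w by (metis eq_vecI carrier_vecD index_zero_vec)
        have "0 < (\<Sum>i\<in>{0..<dim_vec w}. w $ i * w $ i)"
          by (rule sum_pos2[of _ i]) (use i w in \<open>auto simp: zero_less_mult_iff linorder_neq_iff\<close>)
        then show ?thesis by (simp add: scalar_prod_def)
      qed
      define s where "s = 1 / sqrt (scalar_prod w w)"
      have ss: "s * s * scalar_prod w w = 1" using pos by (simp add: s_def)
      define W' where "W' = Matrix.mat d (Suc r) (\<lambda>(i, j). if j < r then W $$ (i, j) else s * x $ i)"
      have W': "W' \<in> carrier_mat d (Suc r)" by (simp add: W'_def)
      have colW': "col W' i = (if i < r then col W i else s \<cdot>\<^sub>v x)" if "i < Suc r" for i
        using that W x by (intro eq_vecI) (auto simp: W'_def)
      have colU': "col (A * W') i = (if i < r then col U i else s \<cdot>\<^sub>v w)" if "i < Suc r" for i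
        using that col_mult2[OF A W'] col_mult2[OF A W] colW'[OF that] A x
        by (auto simp: U_def w_def mult_mat_vec)
      have "transpose_mat (A * W') * (A * W') = 1\<^sub>m (Suc r)"
      proof (rule eq_matI)
        fix i j assume "i < dim_row (1\<^sub>m (Suc r) :: real Matrix.mat)" "j < dim_col (1\<^sub>m (Suc r) :: real Matrix.mat)"
        then have ij: "i < Suc r" "j < Suc r" by auto
        have "(transpose_mat (A * W') * (A * W')) $$ (i, j) = scalar_prod (col (A * W') i) (col (A * W') j)"
          using A W' ij by (subst index_mult_mat) auto
        also have "\<dots> = (if i = j then 1 else 0)"
        proof -
          have uc: "\<And>i. i < r \<Longrightarrow> col U i \<in> carrier_vec n" using U by auto
          have "scalar_prod w (col U i) = 0" if "i < r" for i
            using dotw[OF that] comm_scalar_prod[OF w uc[OF that]] by simp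
          then show ?thesis using ij ss w uc dotw dotU
            by (auto simp: colU' less_Suc_eq)
        qed
        finally show "(transpose_mat (A * W') * (A * W')) $$ (i, j) = 1\<^sub>m (Suc r) $$ (i, j)" using ij by simp
      qed (use A W' in auto)
      then have "Q (Suc r)" unfolding Q_def using W' by blast
      from max[OF this] show False by simp
    qed
    have "a = U *\<^sub>v (transpose_mat U *\<^sub>v a)"
    proof (rule eq_vecI)
      fix i assume "i < dim_vec (U *\<^sub>v (transpose_mat U *\<^sub>v a))"
      then have i: "i < n" using U by simp
      have "w $ i = 0" using \<open>w = 0\<^sub>v n\<close> i by simp
      then show "a $ i = (U *\<^sub>v (transpose_mat U *\<^sub>v a)) $ i" unfolding w_eq using i U a by simp
    qed (use U a in auto)
    also have "\<dots> = col (U * (transpose_mat U * A)) j"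
      using col_mult2[OF U, of "transpose_mat U * A" d j] col_mult2[OF UT A j] UT A j by (simp add: a_def)
    finally show "col A j = col (U * (transpose_mat U * A)) j" by (simp add: a_def)
  qed (use A U in auto)
  then show thesis using that rank U UU by blast
qed

subsection \<open>The deterministic bound\<close>

definition frob_inner :: "real Matrix.mat \<Rightarrow> real Matrix.mat \<Rightarrow> real" where
  "frob_inner A B = (\<Sum>i<dim_row A. \<Sum>j<dim_col A. A $$ (i, j) * B $$ (i, j))"

lemma frob_norm_nonneg [simp]: "frob_norm A \<ge> 0"
  by (simp add: frob_norm_def sum_nonneg)

lemma frob_norm_sq: "(frob_norm A)\<^sup>2 = (\<Sum>i<dim_row A. \<Sum>j<dim_col A. (A $$ (i, j))\<^sup>2)"
  by (simp add: frob_norm_def sum_nonneg)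

lemma frob_inner_self: "frob_inner A A = (frob_norm A)\<^sup>2"
  unfolding frob_norm_sq frob_inner_def by (simp add: power2_eq_square)

lemma frob_inner_minus_right:
  assumes "X \<in> carrier_mat n d" "Y \<in> carrier_mat n d" "Z \<in> carrier_mat n d"
  shows "frob_inner X (Y - Z) = frob_inner X Y - frob_inner X Z"
  using assms by (simp add: frob_inner_def algebra_simps sum_subtractf)

lemma frob_norm_sq_add:
  assumes "X \<in> carrier_mat n d" "Y \<in> carrier_mat n d"
  shows "(frob_norm (X + Y))\<^sup>2 = (frob_norm X)\<^sup>2 + 2 * frob_inner X Y + (frob_norm Y)\<^sup>2"
  using assms by (simp add: frob_norm_sq frob_inner_def power2_sum sum.distrib sum_distrib_left algebra_simps)

lemma frob_norm_smult: "(frob_norm (t \<cdot>\<^sub>m X))\<^sup>2 = t\<^sup>2 * (frob_norm X)\<^sup>2"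
  by (simp add: frob_norm_sq power_mult_distrib sum_distrib_left)

lemma frob_inner_smult_left: "frob_inner (t \<cdot>\<^sub>m X) Y = t * frob_inner X Y"
  by (simp add: frob_inner_def sum_distrib_left mult.assoc)

lemma frob_norm_zero [simp]: "frob_norm (0\<^sub>m n d) = 0"
  by (simp add: frob_norm_def)

lemma frob_norm_pos: 
  assumes "X \<in> carrier_mat n d" "X \<noteq> 0\<^sub>m n d"
  shows "frob_norm X > 0"
proof (rule ccontr)
  assume "\<not> ?thesis"
  then have "(frob_norm X)\<^sup>2 = 0" using frob_norm_nonneg[of X] by simp
  then have "\<And>i j. i < n \<Longrightarrow> j < d \<Longrightarrow> X $$ (i, j) = 0"
    using assms unfolding frob_norm_sq by (simp add: sum_nonneg_eq_0_iff sum_nonneg)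
  then have "X = 0\<^sub>m n d" using assms by (intro eq_matI) auto
  then show False using assms by simp
qed

lemma frob_inner_adjoint:
  assumes M: "M \<in> carrier_mat m n" and X: "X \<in> carrier_mat n d" and Y: "Y \<in> carrier_mat m d"
  shows "frob_inner (M * X) Y = frob_inner X (transpose_mat M * Y)"
proof -
  have "frob_inner (M * X) Y = (\<Sum>i<m. \<Sum>j<d. \<Sum>a<n. M $$ (i, a) * X $$ (a, j) * Y $$ (i, j))"
    using M X by (simp add: frob_inner_def scalar_prod_def sum_distrib_right lessThan_atLeast0)
  also have "\<dots> = (\<Sum>i<m. \<Sum>a<n. \<Sum>j<d. M $$ (i, a) * X $$ (a, j) * Y $$ (i, j))"
    by (intro sum.cong refl sum.swap)
  also have "\<dots> = (\<Sum>a<n. \<Sum>i<m. \<Sum>j<d. M $$ (i, a) * X $$ (a, j) * Y $$ (i, j))"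
    by (rule sum.swap)
  also have "\<dots> = (\<Sum>a<n. \<Sum>j<d. \<Sum>i<m. M $$ (i, a) * X $$ (a, j) * Y $$ (i, j))"
    by (intro sum.cong refl sum.swap)
  also have "\<dots> = frob_inner X (transpose_mat M * Y)"
    using M X Y by (simp add: frob_inner_def scalar_prod_def sum_distrib_left lessThan_atLeast0 mult_ac)
  finally show ?thesis .
qed

lemma frob_inner_Cauchy_Schwarz:
  assumes "X \<in> carrier_mat n d" "Y \<in> carrier_mat n d"
  shows "\<bar>frob_inner X Y\<bar> \<le> frob_norm X * frob_norm Y"
proof -
  let ?I = "{..<n} \<times> {..<d}"
  have "(\<Sum>ij\<in>?I. X $$ ij * Y $$ ij)\<^sup>2 \<le> (\<Sum>ij\<in>?I. (X $$ ij)\<^sup>2) * (\<Sum>ij\<in>?I. (Y $$ ij)\<^sup>2)"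
    by (rule Cauchy_Schwarz_ineq_sum)
  then have "(frob_inner X Y)\<^sup>2 \<le> (frob_norm X)\<^sup>2 * (frob_norm Y)\<^sup>2"
    using assms by (simp add: frob_norm_sq frob_inner_def sum.cartesian_product split_def)
  then have "\<bar>frob_inner X Y\<bar>\<^sup>2 \<le> (frob_norm X * frob_norm Y)\<^sup>2" by (simp add: power_mult_distrib)
  then show ?thesis by (rule power2_le_imp_le) simp
qed

lemma l2_norm_sq: "(l2_norm v)\<^sup>2 = (\<Sum>i<dim_vec v. (v $ i)\<^sup>2)"
  by (simp add: l2_norm_def sum_nonneg)

lemma l2_norm_nonneg [simp]: "l2_norm v \<ge> 0"
  by (simp add: l2_norm_def sum_nonneg)

lemma frob_norm_sq_cols: "(frob_norm X)\<^sup>2 = (\<Sum>j<dim_col X. (l2_norm (col X j))\<^sup>2)"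
  unfolding frob_norm_sq l2_norm_sq by (subst sum.swap) simp

lemma frob_norm_orthonormal:
  assumes U: "U \<in> carrier_mat n r" and "transpose_mat U * U = 1\<^sub>m r"
  shows "(frob_norm U)\<^sup>2 = real r"
proof -
  have "(l2_norm (col U j))\<^sup>2 = 1" if "j < r" for j
  proof -
    have "1 = (transpose_mat U * U) $$ (j, j)" using assms that by simp
    also have "\<dots> = scalar_prod (col U j) (col U j)" using U that by (subst index_mult_mat) auto
    also have "\<dots> = (l2_norm (col U j))\<^sup>2"
      unfolding l2_norm_sq scalar_prod_def by (simp add: power2_eq_square lessThan_atLeast0)
    finally show ?thesis by simp
  qed
  then show ?thesis using U by (simp add: frob_norm_sq_cols)
qed

text \<open>Along \<open>X + t E\<close> the squared cost changes by \<open>2 t a + t^2 b\<close>,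
  with \<open>a\<close> the inner product in question. This is nonnegative for all \<open>t\<close>
  only if \<open>a = 0\<close>.\<close>

lemma regression_minimizer_orthogonal:
  assumes A: "A \<in> carrier_mat n d\<^sub>1" and B: "B \<in> carrier_mat n d\<^sub>2"
    and min: "regression_minimizer A B X" and E: "E \<in> carrier_mat d\<^sub>1 d\<^sub>2"
  shows "frob_inner (A * E) (A * X - B) = 0"
proof (rule ccontr)
  have X: "X \<in> carrier_mat d\<^sub>1 d\<^sub>2" using min A B by (auto simp: regression_minimizer_def is_arg_min_def)
  let ?R = "A * X - B"
  have R: "?R \<in> carrier_mat n d\<^sub>2" and AE: "A * E \<in> carrier_mat n d\<^sub>2" using A B X E by (auto intro: minus_carrier_mat)
  define a where "a = frob_inner (A * E) ?R"
  define b where "b = (frob_norm (A * E))\<^sup>2"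
  assume "frob_inner (A * E) (A * X - B) \<noteq> 0"
  then have a0: "a \<noteq> 0" by (simp add: a_def)
  have b0: "b \<ge> 0" by (simp add: b_def)
  have quad: "0 \<le> 2 * t * a + t\<^sup>2 * b" for t
  proof -
    have Y: "X + t \<cdot>\<^sub>m E \<in> carrier_mat d\<^sub>1 d\<^sub>2" using X E by auto
    have "A * (X + t \<cdot>\<^sub>m E) - B = t \<cdot>\<^sub>m (A * E) + ?R"
      using A B X E by (subst mult_add_distrib_mat[OF A]) (auto simp: mult_smult_distrib intro!: eq_matI)
    then have "(regression_cost A B (X + t \<cdot>\<^sub>m E))\<^sup>2 = t\<^sup>2 * b + 2 * t * a + (regression_cost A B X)\<^sup>2"
      using frob_norm_sq_add[OF smult_carrier_mat[OF AE] R]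
      by (simp add: regression_cost_def frob_norm_smult frob_inner_smult_left a_def b_def)
    moreover have "regression_cost A B X \<le> regression_cost A B (X + t \<cdot>\<^sub>m E)"
      using min Y A B by (force simp: regression_minimizer_def is_arg_min_def not_less)
    then have "(regression_cost A B X)\<^sup>2 \<le> (regression_cost A B (X + t \<cdot>\<^sub>m E))\<^sup>2"
      by (intro power_mono) (auto simp: regression_cost_def)
    ultimately show ?thesis by simp
  qed
  \<comment> \<open>A point close to the vertex \<open>- a / b\<close> of the parabola; the
    denominator \<open>b + 1\<close> avoids a separate case for \<open>A * E\<close> of norm
    0.\<close>
  have "2 * (- a / (b + 1)) * a + (- a / (b + 1))\<^sup>2 * b = a\<^sup>2 / (b + 1)\<^sup>2 * (- b - 2)"
  proof -
    have "b + 1 \<noteq> 0" using b0 by simp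
    then have "2 * (- a / (b + 1)) * a = - 2 * a\<^sup>2 * (b + 1) / (b + 1)\<^sup>2" by (simp add: power2_eq_square)
    then show ?thesis by (simp add: power_divide algebra_simps flip: add_divide_distrib diff_divide_distrib)
  qed
  also have "\<dots> < 0" using a0 b0 by (intro mult_pos_neg) auto
  finally show False using quad[of "- a / (b + 1)"] by simp
qed

text \<open>The columns of \<open>A * E\<close> lie in the column space of \<open>A\<close>, and the
  squared Frobenius norm adds up their squared lengths. The factor 9/4 is the square of
  \<open>1 / (1 - 1/3)\<close>.\<close>

lemma subspace_embedding_frob:
  assumes A: "A \<in> carrier_mat n d\<^sub>1" and S: "S \<in> carrier_mat m n" and E: "E \<in> carrier_mat d\<^sub>1 d\<^sub>2"
    and emb: "subspace_embedding (1 / 3) S A"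
  shows "(frob_norm (A * E))\<^sup>2 \<le> 9 / 4 * (frob_norm (S * (A * E)))\<^sup>2"
proof -
  have "(l2_norm (col (A * E) j))\<^sup>2 \<le> 9 / 4 * (l2_norm (col (S * (A * E)) j))\<^sup>2" if "j < d\<^sub>2" for j
  proof -
    have c1: "col (A * E) j = A *\<^sub>v col E j" using col_mult2[OF A E that] .
    have c2: "col (S * (A * E)) j = S *\<^sub>v (A *\<^sub>v col E j)"
      using col_mult2[OF S _ that, of "A * E"] A E c1 by auto
    have "(1 - 1/3) * l2_norm (A *\<^sub>v col E j) \<le> l2_norm (S *\<^sub>v (A *\<^sub>v col E j))"
      using emb A E that unfolding subspace_embedding_def by auto
    then have "l2_norm (A *\<^sub>v col E j) \<le> 3 / 2 * l2_norm (S *\<^sub>v (A *\<^sub>v col E j))" by simp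
    then have "(l2_norm (A *\<^sub>v col E j))\<^sup>2 \<le> (3 / 2 * l2_norm (S *\<^sub>v (A *\<^sub>v col E j)))\<^sup>2"
      by (rule power_mono) simp
    then show ?thesis unfolding c1 c2 by (simp add: power_mult_distrib power2_eq_square)
  qed
  then show ?thesis unfolding frob_norm_sq_cols sum_distrib_left
    using A S E by (auto intro!: sum_mono)
qed

text \<open>The sketched optimum never has to be identified: comparing the cost of \<open>X\<close> with that of the
  true minimizer bounds \<open>\<parallel>SD\<parallel>\<^sup>2\<close>, \<open>D = A(X - X\<^sup>*)\<close>, by the cross term \<open>2\<langle>SD, SR\<rangle>\<close> plus \<open>3\<tau>\<parallel>SR\<parallel>\<^sup>2\<close>,
  and \<open>D = U(U\<^sup>TD)\<close> turns the cross term into the quantity controlled by \<open>amp\<close>.\<close>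

lemma sketched_regression_bound:
  assumes A: "A \<in> carrier_mat n d\<^sub>1" and B: "B \<in> carrier_mat n d\<^sub>2" and S: "S \<in> carrier_mat m n"
    and \<epsilon>: "0 < \<epsilon>" and \<tau>: "0 < \<tau>" "\<tau> < 1" and \<delta>: "0 < \<delta>"
    and min: "regression_minimizer A B Xopt"
    and U: "U \<in> carrier_mat n r" and AU: "A = U * (transpose_mat U * A)"
    and emb: "subspace_embedding (1 / 3) S A"
    and R_def: "R = A * Xopt - B"
    and amp: "frob_norm (transpose_mat U * transpose_mat S * S * R - transpose_mat U * R) \<le> sqrt \<epsilon> * frob_norm R"
    and markov: "(frob_norm (S * R))\<^sup>2 \<le> (frob_norm R)\<^sup>2 / \<delta>"
    and X: "X \<in> carrier_mat d\<^sub>1 d\<^sub>2"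
    and approx: "regression_cost (S * A) (S * B) X \<le> (1 + \<tau>) * min_regression_cost (S * A) (S * B)"
  shows "regression_cost A B X \<le> (1 + 11 * \<epsilon> + 7 * (\<tau> / \<delta>)) * regression_cost A B Xopt"
proof -
  have Xo: "Xopt \<in> carrier_mat d\<^sub>1 d\<^sub>2" using min A B by (auto simp: regression_minimizer_def is_arg_min_def)
  define E where "E = X - Xopt"
  define D where "D = A * E"
  have E: "E \<in> carrier_mat d\<^sub>1 d\<^sub>2" using X Xo by (auto simp: E_def intro: minus_carrier_mat)
  have D: "D \<in> carrier_mat n d\<^sub>2" using A E by (auto simp: D_def)
  have R: "R \<in> carrier_mat n d\<^sub>2" using A B Xo by (auto simp: R_def intro: minus_carrier_mat)
  have SD: "S * D \<in> carrier_mat m d\<^sub>2" and SR: "S * R \<in> carrier_mat m d\<^sub>2" using S D R by auto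
  have UT: "transpose_mat U \<in> carrier_mat r n" and ST: "transpose_mat S \<in> carrier_mat n m" using U S by auto
  have UTD: "transpose_mat U * D \<in> carrier_mat r d\<^sub>2" using UT D by auto
  have AX: "A * X - B = D + R"
    using A B X Xo unfolding D_def R_def E_def
    by (subst mult_minus_distrib_mat[OF A]) (auto intro!: eq_matI)
  have orth: "frob_inner D R = 0"
    unfolding D_def R_def by (rule regression_minimizer_orthogonal[OF A B min E])
  have cost: "(regression_cost A B X)\<^sup>2 = (frob_norm D)\<^sup>2 + (frob_norm R)\<^sup>2"
    unfolding regression_cost_def AX using frob_norm_sq_add[OF D R] orth by simp
  have cost_opt: "regression_cost A B Xopt = frob_norm R" by (simp add: regression_cost_def R_def)
  have DU: "D = U * (transpose_mat U * D)"
  proof -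
    have "D = U * (transpose_mat U * A) * E" unfolding D_def using AU by simp
    also have "\<dots> = U * ((transpose_mat U * A) * E)" using U UT A E by (intro assoc_mult_mat) auto
    also have "(transpose_mat U * A) * E = transpose_mat U * D" unfolding D_def by (rule assoc_mult_mat[OF UT A E])
    finally show ?thesis .
  qed
  \<comment> \<open>By adjointness, \<open><D, D> = <U (U^T D), D> = <U^T D, U^T D>\<close>.\<close>
  have UTD_norm: "(frob_norm (transpose_mat U * D))\<^sup>2 = (frob_norm D)\<^sup>2"
    using frob_inner_adjoint[OF U UTD D] DU by (simp add: frob_inner_self)
  then have UTD_norm': "frob_norm (transpose_mat U * D) = frob_norm D"
    by (metis frob_norm_nonneg power2_eq_imp_eq)
  let ?M = "transpose_mat U * transpose_mat S * S * R"
  have "?M = transpose_mat U * (transpose_mat S * (S * R))"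
    using assoc_mult_mat[OF mult_carrier_mat[OF UT ST] S R] assoc_mult_mat[OF UT ST SR] by simp
  then have M: "?M \<in> carrier_mat r d\<^sub>2" and "frob_inner (transpose_mat U * D) ?M = frob_inner (S * D) (S * R)"
    using frob_inner_adjoint[OF S D SR] frob_inner_adjoint[OF U UTD, of "transpose_mat S * (S * R)"] DU ST SR UT
    by auto
  \<comment> \<open>The optimality of \<open>Xopt\<close> enters here: \<open>U^T R\<close> is
    orthogonal to \<open>U^T D\<close>, so subtracting it from \<open>?M\<close> is free and leaves
    the sketching error of the product \<open>U^T R\<close>.\<close>
  moreover have "frob_inner (transpose_mat U * D) (transpose_mat U * R) = 0"
    using frob_inner_adjoint[OF U UTD R] DU orth by simp
  moreover have UTR: "transpose_mat U * R \<in> carrier_mat r d\<^sub>2" using UT R by auto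
  ultimately have "frob_inner (S * D) (S * R) = frob_inner (transpose_mat U * D) (?M - transpose_mat U * R)"
    using frob_inner_minus_right[OF UTD M UTR] by simp
  then have "\<bar>frob_inner (S * D) (S * R)\<bar> \<le> frob_norm D * frob_norm (?M - transpose_mat U * R)"
    using frob_inner_Cauchy_Schwarz[OF UTD minus_carrier_mat[OF UTR]] UTD_norm' by metis
  also have "\<dots> \<le> frob_norm D * (sqrt \<epsilon> * frob_norm R)"
    using amp by (intro mult_left_mono) auto
  finally have cross: "\<bar>frob_inner (S * D) (S * R)\<bar> \<le> frob_norm D * (sqrt \<epsilon> * frob_norm R)" .
  have "min_regression_cost (S * A) (S * B) \<le> regression_cost (S * A) (S * B) Xopt"
    unfolding min_regression_cost_def
    by (rule cINF_lower[OF bdd_below_regression_cost]) (use A B Xo in auto)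
  then have "(1 + \<tau>) * min_regression_cost (S * A) (S * B) \<le> (1 + \<tau>) * regression_cost (S * A) (S * B) Xopt"
    using \<tau> by (intro mult_left_mono) auto
  with approx have "regression_cost (S * A) (S * B) X \<le> (1 + \<tau>) * regression_cost (S * A) (S * B) Xopt"
    by linarith
  moreover have "regression_cost (S * A) (S * B) Y = frob_norm (S * (A * Y - B))" if "Y \<in> carrier_mat d\<^sub>1 d\<^sub>2" for Y
    unfolding regression_cost_def
    using assoc_mult_mat[OF S A that] mult_minus_distrib_mat[OF S _ B, of "A * Y"] A that by simp
  ultimately have "frob_norm (S * (D + R)) \<le> (1 + \<tau>) * frob_norm (S * R)"
    using X Xo AX R_def by simp
  then have "frob_norm (S * D + S * R) \<le> (1 + \<tau>) * frob_norm (S * R)"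
    using mult_add_distrib_mat[OF S D R] by simp
  then have "(frob_norm (S * D + S * R))\<^sup>2 \<le> (1 + \<tau>)\<^sup>2 * (frob_norm (S * R))\<^sup>2"
    using power_mono[of _ _ 2] by (fastforce simp flip: power_mult_distrib)
  then have "(frob_norm (S * D))\<^sup>2 \<le> - 2 * frob_inner (S * D) (S * R) + ((1 + \<tau>)\<^sup>2 - 1) * (frob_norm (S * R))\<^sup>2"
    using frob_norm_sq_add[OF SD SR] by (simp add: algebra_simps)
  also have "((1 + \<tau>)\<^sup>2 - 1) * (frob_norm (S * R))\<^sup>2 \<le> (3 * \<tau>) * ((frob_norm R)\<^sup>2 / \<delta>)"
  proof (rule mult_mono[OF _ markov])
    have "\<tau>\<^sup>2 \<le> \<tau>" using \<tau> by (simp add: power2_eq_square mult_left_le)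
    then show "(1 + \<tau>)\<^sup>2 - 1 \<le> 3 * \<tau>" by (simp add: power2_sum)
  qed (use \<tau> in auto)
  finally have 1: "(frob_norm (S * D))\<^sup>2 \<le> 2 * (frob_norm D * (sqrt \<epsilon> * frob_norm R)) + 3 * \<tau> * ((frob_norm R)\<^sup>2 / \<delta>)"
    using cross by linarith
  have 2: "(frob_norm D)\<^sup>2 \<le> 9 / 4 * (frob_norm (S * D))\<^sup>2"
    unfolding D_def by (rule subspace_embedding_frob[OF A S E emb])
  define d \<rho> where "d = frob_norm D" and "\<rho> = frob_norm R"
  have d: "d \<ge> 0" and \<rho>: "\<rho> \<ge> 0" by (auto simp: d_def \<rho>_def)
  \<comment> \<open>Completing the square absorbs half of \<open>d^2\<close>. The mixed term has
    coefficient 9/2: the factor 9/4 of the embedding times the 2 of the cost expansion.\<close>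
  have "0 \<le> (d - 9 / 2 * (sqrt \<epsilon> * \<rho>))\<^sup>2" by simp
  also have "\<dots> = d\<^sup>2 - 9 * (d * (sqrt \<epsilon> * \<rho>)) + 81 / 4 * (sqrt \<epsilon> * \<rho>)\<^sup>2"
    by (simp add: power2_eq_square algebra_simps)
  also have "(sqrt \<epsilon> * \<rho>)\<^sup>2 = \<epsilon> * \<rho>\<^sup>2" using \<epsilon> by (simp add: power_mult_distrib)
  finally have "9 * (d * (sqrt \<epsilon> * \<rho>)) \<le> d\<^sup>2 + 81 / 4 * (\<epsilon> * \<rho>\<^sup>2)" by simp
  moreover have "d\<^sup>2 \<le> 9 / 2 * (d * (sqrt \<epsilon> * \<rho>)) + 27 / 4 * (\<tau> * (\<rho>\<^sup>2 / \<delta>))"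
    using 1 2 unfolding d_def \<rho>_def by (simp add: algebra_simps)
  ultimately have "d\<^sup>2 \<le> 81 / 4 * (\<epsilon> * \<rho>\<^sup>2) + 27 / 2 * (\<tau> * (\<rho>\<^sup>2 / \<delta>))" by linarith
  then have "(regression_cost A B X)\<^sup>2 \<le> (1 + 81 / 4 * \<epsilon> + 27 / 2 * (\<tau> / \<delta>)) * \<rho>\<^sup>2"
    unfolding cost d_def \<rho>_def by (simp add: algebra_simps)
  \<comment> \<open>The root is taken by \<open>1 + 2 * x \<le> (1 + x)^2\<close>, so 11 and 7 have
    to dominate 81/8 and 27/4, the halves of the coefficients.\<close>
  also have "\<dots> \<le> (1 + 11 * \<epsilon> + 7 * (\<tau> / \<delta>))\<^sup>2 * \<rho>\<^sup>2"
  proof (rule mult_right_mono)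
    define x where "x = 11 * \<epsilon> + 7 * (\<tau> / \<delta>)"
    have "0 \<le> \<tau> / \<delta>" using \<tau> \<delta> by simp
    then have "1 + 81 / 4 * \<epsilon> + 27 / 2 * (\<tau> / \<delta>) \<le> 1 + 2 * x" using \<epsilon> by (simp add: x_def)
    also have "\<dots> \<le> (1 + x)\<^sup>2" by (simp add: power2_eq_square algebra_simps)
    finally show "1 + 81 / 4 * \<epsilon> + 27 / 2 * (\<tau> / \<delta>) \<le> (1 + 11 * \<epsilon> + 7 * (\<tau> / \<delta>))\<^sup>2" by (simp add: x_def add.assoc)
  qed simp
  finally have "(regression_cost A B X)\<^sup>2 \<le> ((1 + 11 * \<epsilon> + 7 * (\<tau> / \<delta>)) * \<rho>)\<^sup>2" by (simp add: power_mult_distrib)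
  moreover have "0 \<le> (1 + 11 * \<epsilon> + 7 * (\<tau> / \<delta>)) * \<rho>" using \<epsilon> \<tau> \<delta> \<rho> by simp
  ultimately show ?thesis unfolding cost_opt \<rho>_def by (rule power2_le_imp_le)
qed

subsection \<open>Abstract sketching distributions\<close>

lemma matrix_distributionD:
  assumes "matrix_distribution m n P"
  shows "prob_space P" "sets P = sets (mat_borel m n)" "space P = carrier_mat m n"
  using assms sets_eq_imp_space_eq[of P "mat_borel m n"] by (auto simp: matrix_distribution_def)

lemma measurable_matrix_distribution_entry:
  assumes "matrix_distribution m n P" "i < m" "j < n"
  shows "(\<lambda>S. S $$ (i, j)) \<in> borel_measurable P"
  using measurable_entry_mat_borel[OF assms(2,3)] matrix_distributionD(2)[OF assms(1)]
  by (simp cong: measurable_cong_sets)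

text \<open>The Bochner integral of a non-integrable function is 0, so the value 1 on the diagonal
  already forces integrability there. The off-diagonal products are dominated through
  \<open>|x y| \<le> x^2 + y^2\<close>.\<close>

lemma integrable_scalar_prod_cols:
  assumes P: "matrix_distribution m n P" and iso: "isotropic_columns n P" and ij: "i < n" "j < n"
  shows "integrable P (\<lambda>S. scalar_prod (col S i) (col S j))"
proof -
  have cols: "scalar_prod (col S i) (col S j) = (\<Sum>r<m. S $$ (r, i) * S $$ (r, j))"
    if "S \<in> space P" "i < n" "j < n" for S i j
    using that matrix_distributionD(3)[OF P] by (auto simp: scalar_prod_def lessThan_atLeast0)
  have diag: "integrable P (\<lambda>S. scalar_prod (col S i) (col S i))" if "i < n" for i
  proof (rule ccontr)
    assume "\<not> ?thesis"
    then have "(\<integral>S. scalar_prod (col S i) (col S i) \<partial>P) = 0" by (rule not_integrable_integral_eq)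
    then show False using iso that by (simp add: isotropic_columns_def)
  qed
  show ?thesis
  proof (rule Bochner_Integration.integrable_bound)
    show "integrable P (\<lambda>S. scalar_prod (col S i) (col S i) + scalar_prod (col S j) (col S j))"
      using diag ij by (intro Bochner_Integration.integrable_add)
    have "(\<lambda>S. \<Sum>r<m. S $$ (r, i) * S $$ (r, j)) \<in> borel_measurable P"
      using measurable_matrix_distribution_entry[OF P] ij by (intro borel_measurable_sum borel_measurable_times) auto
    then show "(\<lambda>S. scalar_prod (col S i) (col S j)) \<in> borel_measurable P"
      by (subst measurable_cong[OF cols]) (use ij in auto)
    show "AE S in P. norm (scalar_prod (col S i) (col S j)) \<le> norm (scalar_prod (col S i) (col S i) + scalar_prod (col S j) (col S j))"
    proof (rule AE_I2)
      fix S assume S: "S \<in> space P"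
      have "\<bar>\<Sum>r<m. S $$ (r, i) * S $$ (r, j)\<bar> \<le> (\<Sum>r<m. \<bar>S $$ (r, i) * S $$ (r, j)\<bar>)"
        by (rule sum_abs)
      also have "\<dots> \<le> (\<Sum>r<m. S $$ (r, i) * S $$ (r, i) + S $$ (r, j) * S $$ (r, j))"
      proof (rule sum_mono)
        fix r
        have "\<bar>x * y\<bar> \<le> x * x + y * y" for x y :: real
        proof -
          have "0 \<le> (\<bar>x\<bar> - \<bar>y\<bar>)\<^sup>2" by simp
          then have "2 * \<bar>x * y\<bar> \<le> x * x + y * y" by (simp add: power2_diff abs_mult) (simp add: power2_eq_square)
          then show ?thesis using abs_ge_zero[of "x * y"] by linarith
        qed
        then show "\<bar>S $$ (r, i) * S $$ (r, j)\<bar> \<le> S $$ (r, i) * S $$ (r, i) + S $$ (r, j) * S $$ (r, j)" .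
      qed
      finally show "norm (scalar_prod (col S i) (col S j)) \<le> norm (scalar_prod (col S i) (col S i) + scalar_prod (col S j) (col S j))"
        using S ij by (simp add: cols sum.distrib)
    qed
  qed
qed

text \<open>Written as a combination of the Gram entries of \<open>S\<close> with fixed
  coefficients, the squared norm has an expectation that follows from isotropy by linearity.\<close>

lemma frob_norm_sq_sketch:
  assumes S: "S \<in> carrier_mat m n" and R: "R \<in> carrier_mat n d"
  shows "(frob_norm (S * R))\<^sup>2 =
    (\<Sum>i<n. \<Sum>c<d. R $$ (i, c) * (\<Sum>j<n. scalar_prod (col S i) (col S j) * R $$ (j, c)))"
proof -
  have ST: "transpose_mat S \<in> carrier_mat n m" using S by simp
  have "(frob_norm (S * R))\<^sup>2 = frob_inner R (transpose_mat S * (S * R))"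
    using frob_inner_adjoint[OF S R, of "S * R"] S R by (simp add: frob_inner_self)
  also have "transpose_mat S * (S * R) = transpose_mat S * S * R"
    using assoc_mult_mat[OF ST S R] by simp
  also have "frob_inner R \<dots> = (\<Sum>i<n. \<Sum>c<d. R $$ (i, c) * (\<Sum>j<n. scalar_prod (col S i) (col S j) * R $$ (j, c)))"
  proof -
    have "(transpose_mat S * S * R) $$ (i, c) = (\<Sum>j<n. scalar_prod (col S i) (col S j) * R $$ (j, c))"
      if "i < n" "c < d" for i c
    proof -
      have "(transpose_mat S * S * R) $$ (i, c) = scalar_prod (row (transpose_mat S * S) i) (col R c)"
        using S R that by (subst index_mult_mat) auto
      also have "\<dots> = (\<Sum>j<n. scalar_prod (col S i) (col S j) * R $$ (j, c))"
        unfolding scalar_prod_def[of _ "col R c"] using S R that by (intro sum.cong) auto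
      finally show ?thesis .
    qed
    then show ?thesis using R by (simp add: frob_inner_def)
  qed
  finally show ?thesis .
qed

text \<open>Strictness of the inequality in the event covers \<open>R = 0\<close>, where Markov's
  inequality has no positive threshold but the event is empty.\<close>

lemma sketch_norm_Markov:
  assumes P: "matrix_distribution m n P" and iso: "isotropic_columns n P"
    and R: "R \<in> carrier_mat n d" and \<delta>: "\<delta> > 0"
  shows "measure P {S \<in> space P. (frob_norm R)\<^sup>2 / \<delta> < (frob_norm (S * R))\<^sup>2} \<le> \<delta>" (is "measure P ?bad \<le> _")
    and "{S \<in> space P. (frob_norm R)\<^sup>2 / \<delta> < (frob_norm (S * R))\<^sup>2} \<in> sets P"
proof -
  interpret prob_space P using P matrix_distributionD by blast
  let ?f = "\<lambda>S. (frob_norm (S * R))\<^sup>2"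
  let ?g = "\<lambda>S. \<Sum>i<n. \<Sum>c<d. R $$ (i, c) * (\<Sum>j<n. scalar_prod (col S i) (col S j) * R $$ (j, c))"
  have eq: "?f S = ?g S" if "S \<in> space P" for S
    using that matrix_distributionD(3)[OF P] frob_norm_sq_sketch[OF _ R] by blast
  have "has_bochner_integral P (\<lambda>S. scalar_prod (col S i) (col S j)) (if i = j then 1 else 0)" if "i < n" "j < n" for i j
    using integrable_scalar_prod_cols[OF P iso that] iso that
    by (simp add: has_bochner_integral_iff isotropic_columns_def)
  then have g: "has_bochner_integral P ?g
      (\<Sum>i<n. \<Sum>c<d. R $$ (i, c) * (\<Sum>j<n. (if i = j then 1 else 0) * R $$ (j, c)))"
    by (intro has_bochner_integral_sum has_bochner_integral_mult_right has_bochner_integral_mult_left) auto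
  then have int: "integrable P ?f"
    by (subst Bochner_Integration.integrable_cong[OF refl eq]) (auto simp: has_bochner_integral_iff)
  have "integral\<^sup>L P ?f = integral\<^sup>L P ?g" by (rule Bochner_Integration.integral_cong[OF refl eq])
  also have "\<dots> = (\<Sum>i<n. \<Sum>c<d. R $$ (i, c) * (\<Sum>j<n. (if i = j then 1 else 0) * R $$ (j, c)))"
    using g by (simp add: has_bochner_integral_iff)
  also have "\<dots> = (frob_norm R)\<^sup>2"
    using R unfolding frob_norm_sq by (simp add: power2_eq_square if_distrib[of "\<lambda>x. x * _"] cong: if_cong)
  finally have expect: "integral\<^sup>L P ?f = (frob_norm R)\<^sup>2" .
  show sets: "?bad \<in> sets P" using borel_measurable_integrable[OF int] by measurable
  show "measure P ?bad \<le> \<delta>"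
  proof (cases "frob_norm R = 0")
    case True
    then have "R = 0\<^sub>m n d" using frob_norm_pos[OF R] by force
    have "frob_norm (S * R) = 0" if "S \<in> space P" for S
      using that matrix_distributionD(3)[OF P] \<open>R = _\<close> by (simp add: right_mult_zero_mat)
    then have "?bad = {}" using True by auto
    then show ?thesis using \<delta> by (simp only: measure_empty)
  next
    case False
    then have pos: "(frob_norm R)\<^sup>2 / \<delta> > 0" using \<delta> by simp
    have "{S \<in> space P. (frob_norm R)\<^sup>2 / \<delta> \<le> ?f S} \<in> sets P"
      using borel_measurable_integrable[OF int] by measurable
    then have "measure P ?bad \<le> measure P {S \<in> space P. (frob_norm R)\<^sup>2 / \<delta> \<le> ?f S}"
      by (intro finite_measure_mono) (auto intro: less_imp_le)
    also have "\<dots> \<le> integral\<^sup>L P ?f / ((frob_norm R)\<^sup>2 / \<delta>)"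
      by (rule integral_Markov_inequality_measure[OF int sets.empty_sets _ pos]) simp
    also have "\<dots> = \<delta>" using expect False by simp
    finally show ?thesis .
  qed
qed

lemma sets_approx_matrix_product_bad:
  assumes P: "matrix_distribution m n P" and C: "C \<in> carrier_mat n a" and D: "D \<in> carrier_mat n b"
  shows "{S \<in> space P. t < frob_norm (transpose_mat C * transpose_mat S * S * D - transpose_mat C * D)} \<in> sets P"
    and "{S \<in> space P. t \<le> frob_norm (transpose_mat C * transpose_mat S * S * D - transpose_mat C * D)} \<in> sets P"
proof -
  let ?f = "\<lambda>S. frob_norm (transpose_mat C * transpose_mat S * S * D - transpose_mat C * D)"
  have S: "continuous_mat m n (\<lambda>f. Matrix.mat m n f)"
    by (intro continuous_mat_mat continuous_on_product_coordinates)
  have CT: "transpose_mat C \<in> carrier_mat a n" using C by simp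
  have c: "continuous_on UNIV (\<lambda>f. ?f (Matrix.mat m n f))"
    by (intro continuous_on_frob_norm[of a b] continuous_mat_minus continuous_mat_mult[of _ n] continuous_mat_mult[of _ m]
        continuous_mat_const S continuous_mat_transpose CT D mult_carrier_mat[OF CT D])
  have le: "{S \<in> carrier_mat m n. ?f S \<le> t} \<in> sets (mat_borel m n)"
    by (intro closed_imp_sets_mat_borel closed_Collect_le c continuous_on_const)
  have ge: "{S \<in> carrier_mat m n. t \<le> ?f S} \<in> sets (mat_borel m n)"
    by (intro closed_imp_sets_mat_borel closed_Collect_le c continuous_on_const)
  have "{S \<in> space P. t < ?f S} = space (mat_borel m n) - {S \<in> carrier_mat m n. ?f S \<le> t}"
    using matrix_distributionD(3)[OF P] by auto
  then show "{S \<in> space P. t < ?f S} \<in> sets P"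
    using sets.compl_sets[OF le] matrix_distributionD(2)[OF P] by (simp only:)
  show "{S \<in> space P. t \<le> ?f S} \<in> sets P" using ge matrix_distributionD[OF P] by simp
qed

text \<open>The strict form brings back the zero matrices that the definition excludes, as their
  error is 0. They do occur: \<open>U\<close> for \<open>A\<close> of rank 0, and \<open>R\<close>
  when the columns of \<open>B\<close> lie in the column space of \<open>A\<close>.\<close>

lemma approx_matrix_product_strict:
  assumes P: "matrix_distribution m n P" and amp: "approx_matrix_product n \<eta> \<delta> P" and "\<delta> \<ge> 0" "\<eta> \<ge> 0"
    and C: "C \<in> carrier_mat n a" and D: "D \<in> carrier_mat n b"
  shows "measure P {S \<in> space P. \<eta> * frob_norm C * frob_norm D <
      frob_norm (transpose_mat C * transpose_mat S * S * D - transpose_mat C * D)} \<le> \<delta>" (is "measure P ?bad \<le> _")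
proof (cases "C = 0\<^sub>m n a \<or> D = 0\<^sub>m n b")
  case True
  have "transpose_mat C * transpose_mat S * S * D - transpose_mat C * D = 0\<^sub>m a b" if S: "S \<in> carrier_mat m n" for S
  proof -
    have ST: "transpose_mat S \<in> carrier_mat n m" using S by simp
    from True show ?thesis
    proof
      assume "C = 0\<^sub>m n a"
      then have "transpose_mat C = 0\<^sub>m a n" by (auto intro: eq_matI)
      then show ?thesis using S ST D by (simp add: left_mult_zero_mat)
    next
      assume D0: "D = 0\<^sub>m n b"
      have "transpose_mat C * transpose_mat S * S \<in> carrier_mat a n" "transpose_mat C \<in> carrier_mat a n" using S C by auto
      then show ?thesis unfolding D0 by (simp add: right_mult_zero_mat del: transpose_mult)
    qed
  qed
  then have "?bad = {}" using matrix_distributionD(3)[OF P] \<open>\<eta> \<ge> 0\<close> by (auto simp: not_less)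
  then show ?thesis using \<open>\<delta> \<ge> 0\<close> by (simp only: measure_empty)
next
  case False
  interpret prob_space P using P matrix_distributionD by blast
  have "measure P ?bad \<le> measure P {S \<in> space P. \<eta> * frob_norm C * frob_norm D \<le>
      frob_norm (transpose_mat C * transpose_mat S * S * D - transpose_mat C * D)}"
    using sets_approx_matrix_product_bad(2)[OF P C D] by (intro finite_measure_mono) auto
  also have "\<dots> \<le> \<delta>" using amp C D False unfolding approx_matrix_product_def by blast
  finally show ?thesis .
qed

lemma sketched_regression_probability:
  assumes \<epsilon>: "0 < \<epsilon>" and \<delta>: "0 < \<delta>" "\<delta> < 1" and \<tau>: "0 < \<tau>" "\<tau> < 1" and k: "1 \<le> k"
    and A: "A \<in> carrier_mat n d\<^sub>1" and rank: "vec_space.rank n A \<le> k" and B: "B \<in> carrier_mat n d\<^sub>2"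
    and P: "matrix_distribution m n P"
    and emb: "measure P {S \<in> space P. subspace_embedding (1 / 3) S A} \<ge> 1 - \<delta>"
    and amp: "approx_matrix_product n (sqrt (\<epsilon> / real k)) \<delta> P"
    and iso: "isotropic_columns n P"
    and min: "regression_minimizer A B Xopt"
  shows "measure P (sketched_regression_event \<tau> (1 + 11 * \<epsilon> + 7 * (\<tau> / \<delta>)) A B Xopt P) \<ge> 1 - 3 * \<delta>"
proof -
  interpret prob_space P using P matrix_distributionD by blast
  obtain r U where r: "r \<le> vec_space.rank n A" and U: "U \<in> carrier_mat n r" and UU: "transpose_mat U * U = 1\<^sub>m r"
    and AU: "A = U * (transpose_mat U * A)"
    using orthonormal_column_space_basis[OF A] by blast
  define R where "R = A * Xopt - B"
  have "Xopt \<in> carrier_mat d\<^sub>1 d\<^sub>2" using min A B by (auto simp: regression_minimizer_def is_arg_min_def)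
  then have R: "R \<in> carrier_mat n d\<^sub>2" using A B by (auto simp: R_def intro: minus_carrier_mat)
  have "frob_norm U = sqrt (real r)"
    using frob_norm_orthonormal[OF U UU] by (metis frob_norm_nonneg real_sqrt_unique)
  then have "sqrt (\<epsilon> / real k) * frob_norm U \<le> sqrt (\<epsilon> / real k) * sqrt (real k)"
    using r rank \<epsilon> by (intro mult_left_mono) auto
  also have "\<dots> = sqrt \<epsilon>" using k \<epsilon> by (simp flip: real_sqrt_mult)
  finally have \<eta>: "sqrt (\<epsilon> / real k) * frob_norm U * frob_norm R \<le> sqrt \<epsilon> * frob_norm R"
    by (intro mult_right_mono) auto
  let ?amp = "{S \<in> space P. sqrt (\<epsilon> / real k) * frob_norm U * frob_norm R <
      frob_norm (transpose_mat U * transpose_mat S * S * R - transpose_mat U * R)}"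
  let ?markov = "{S \<in> space P. (frob_norm R)\<^sup>2 / \<delta> < (frob_norm (S * R))\<^sup>2}"
  let ?emb = "{S \<in> space P. subspace_embedding (1 / 3) S A}"
  let ?good = "sketched_regression_event \<tau> (1 + 11 * \<epsilon> + 7 * (\<tau> / \<delta>)) A B Xopt P"
  have good_sets: "?good \<in> sets P"
    using sets_sketched_regression_event[OF A B _ matrix_distributionD(2)[OF P]] \<tau> by auto
  have amp_sets: "?amp \<in> sets P" by (rule sets_approx_matrix_product_bad(1)[OF P U R])
  have markov_sets: "?markov \<in> sets P" by (rule sketch_norm_Markov(2)[OF P iso R \<delta>(1)])
  have "?emb - ?amp - ?markov \<subseteq> ?good"
  proof
    fix S assume S: "S \<in> ?emb - ?amp - ?markov"
    then have Sc: "S \<in> carrier_mat m n" and e: "subspace_embedding (1 / 3) S A" using matrix_distributionD(3)[OF P] by auto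
    have m: "(frob_norm (S * R))\<^sup>2 \<le> (frob_norm R)\<^sup>2 / \<delta>" using S by auto
    have a: "frob_norm (transpose_mat U * transpose_mat S * S * R - transpose_mat U * R) \<le> sqrt \<epsilon> * frob_norm R"
      using S \<eta> by auto
    show "S \<in> ?good"
      unfolding sketched_regression_event_def
      using sketched_regression_bound[OF A B Sc \<epsilon> \<tau> \<delta>(1) min U AU e R_def a m] S A B by auto
  qed
  \<comment> \<open>Read as an upper bound on the probability of the embedding event, the inclusion
    asks for measurability of its right-hand side; this is the use of the measurability of the
    regression event.\<close>
  then have "?emb \<subseteq> ?good \<union> (?amp \<union> ?markov)" by blast
  then have "measure P ?emb \<le> measure P (?good \<union> (?amp \<union> ?markov))"
    using good_sets amp_sets markov_sets by (intro finite_measure_mono) auto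
  also have "\<dots> \<le> measure P ?good + measure P (?amp \<union> ?markov)"
    using good_sets amp_sets markov_sets by (intro measure_Un_le) auto
  also have "measure P (?amp \<union> ?markov) \<le> measure P ?amp + measure P ?markov"
    using amp_sets markov_sets by (intro measure_Un_le) auto
  finally show ?thesis
    using emb approx_matrix_product_strict[OF P amp _ _ U R] sketch_norm_Markov(1)[OF P iso R \<delta>(1)] \<delta> \<epsilon>
    by (simp add: power2_eq_square)
qed

subsection \<open>Moments of random sign rows\<close>

definition sign_row :: "nat \<Rightarrow> real \<Rightarrow> (nat \<Rightarrow> real) pmf" where
  "sign_row n a = Pi_pmf {..<n} 0 (\<lambda>_. pmf_of_set {- a, a})"

text \<open>Grouping the entries by rows lets the exponential of a sum over rows factor into
  independent one-row expectations.\<close>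

definition sign_rows :: "nat \<Rightarrow> nat \<Rightarrow> real \<Rightarrow> (nat \<Rightarrow> nat \<Rightarrow> real) pmf" where
  "sign_rows m n a = Pi_pmf {..<m} (\<lambda>_. 0) (\<lambda>_. sign_row n a)"

lemma finite_set_sign_row [simp]: "finite (set_pmf (sign_row n a))"
  unfolding sign_row_def by (subst set_Pi_pmf) (simp_all add: finite_PiE_dflt)

lemma finite_set_sign_rows [simp]: "finite (set_pmf (sign_rows m n a))"
  unfolding sign_rows_def by (subst set_Pi_pmf) (simp_all add: finite_PiE_dflt)

lemma integrable_sign_row [simp]: "integrable (measure_pmf (sign_row n a)) (f :: _ \<Rightarrow> real)"
  by (rule integrable_measure_pmf_finite) simp

lemma integrable_sign_rows [simp]: "integrable (measure_pmf (sign_rows m n a)) (f :: _ \<Rightarrow> real)"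
  by (rule integrable_measure_pmf_finite) simp

section \<open>Sub-Gaussian estimates for one row\<close>

lemma cosh_le_exp_half_sq: "cosh x \<le> exp (x\<^sup>2 / 2)" for x :: real
proof -
  have *: "cosh x \<le> exp (x\<^sup>2 / 2)" if x: "x \<ge> 0" for x :: real
  proof -
    have sinh_le: "sinh y \<le> y * cosh y" if "y \<ge> 0" for y :: real
    proof -
      have "(\<lambda>y::real. sinh y - y * cosh y) y \<le> (\<lambda>y. sinh y - y * cosh y) 0"
      proof (rule DERIV_nonpos_imp_nonincreasing[OF that])
        fix z :: real assume "0 \<le> z" "z \<le> y"
        then show "\<exists>D. ((\<lambda>y. sinh y - y * cosh y) has_real_derivative D) (at z) \<and> D \<le> 0"
          by (intro exI[of _ "- z * sinh z"]) (auto intro!: derivative_eq_intros)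
      qed
      then show ?thesis by simp
    qed
    \<comment> \<open>The quotient of the two sides equals 1 at 0 and decreases from there, because
      \<open>sinh z \<le> z * cosh z\<close>.\<close>
    have "(\<lambda>y::real. exp (- (y\<^sup>2 / 2)) * cosh y) x \<le> (\<lambda>y. exp (- (y\<^sup>2 / 2)) * cosh y) 0"
    proof (rule DERIV_nonpos_imp_nonincreasing[OF x])
      fix z :: real assume z: "0 \<le> z" "z \<le> x"
      have "((\<lambda>y. exp (- (y\<^sup>2 / 2)) * cosh y) has_real_derivative exp (- (z\<^sup>2 / 2)) * (sinh z - z * cosh z)) (at z)"
        by (auto intro!: derivative_eq_intros simp: algebra_simps)
      moreover have "exp (- (z\<^sup>2 / 2)) * (sinh z - z * cosh z) \<le> 0"
        using sinh_le[OF z(1)] by (intro mult_nonneg_nonpos) auto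
      ultimately show "\<exists>D. ((\<lambda>y. exp (- (y\<^sup>2 / 2)) * cosh y) has_real_derivative D) (at z) \<and> D \<le> 0" by blast
    qed
    then show ?thesis by (simp add: exp_minus field_simps)
  qed
  show ?thesis using *[of x] *[of "- x"] by (cases "x \<ge> 0") auto
qed

lemma expectation_sign_pair:
  fixes a :: real
  assumes "a > 0"
  shows "measure_pmf.expectation (pmf_of_set {- a, a}) f = (f (- a) + f a) / (2::real)"
proof -
  have ne: "- a \<noteq> a" using assms by simp
  then have card: "card {- a, a} = 2" by (auto simp only: card_2_iff)
  have sum: "sum f {- a, a} = f (- a) + f a"
    using ne by (subst sum.insert) auto
  have "measure_pmf.expectation (pmf_of_set {- a, a}) f = sum f {- a, a} / real (card {- a, a})"
    by (rule integral_pmf_of_set) auto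
  then show ?thesis unfolding card sum by simp
qed

lemma sign_row_mgf:
  assumes a: "a > 0" and u: "(\<Sum>j<n. (u j)\<^sup>2) \<le> 1"
  shows "measure_pmf.expectation (sign_row n a) (\<lambda>g. exp (t * (\<Sum>j<n. u j * g j))) \<le> exp (t\<^sup>2 * a\<^sup>2 / 2)"
proof -
  have "measure_pmf.expectation (sign_row n a) (\<lambda>g. exp (t * (\<Sum>j<n. u j * g j)))
      = measure_pmf.expectation (sign_row n a) (\<lambda>g. \<Prod>j<n. exp (t * u j * g j))"
    by (simp add: sum_distrib_left exp_sum mult.assoc)
  also have "\<dots> = (\<Prod>j<n. measure_pmf.expectation (pmf_of_set {- a, a}) (\<lambda>v. exp (t * u j * v)))"
    unfolding sign_row_def by (rule expectation_prod_Pi_pmf) (auto intro: integrable_measure_pmf_finite)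
  also have "\<dots> = (\<Prod>j<n. cosh (t * u j * a))"
    by (simp add: expectation_sign_pair[OF a] cosh_def add.commute)
  also have "\<dots> \<le> (\<Prod>j<n. exp ((t * u j * a)\<^sup>2 / 2))"
    by (intro prod_mono conjI cosh_le_exp_half_sq cosh_real_nonneg)
  also have "\<dots> = exp (\<Sum>j<n. (t * u j * a)\<^sup>2 / 2)" by (simp add: exp_sum)
  also have "(\<Sum>j<n. (t * u j * a)\<^sup>2 / 2) = t\<^sup>2 * a\<^sup>2 / 2 * (\<Sum>j<n. (u j)\<^sup>2)"
    by (simp add: sum_distrib_left power_mult_distrib mult_ac)
  also have "\<dots> \<le> t\<^sup>2 * a\<^sup>2 / 2 * 1" using u by (intro mult_left_mono) auto
  finally show ?thesis by simp
qed

lemma power_le_fact_exp: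
  assumes "x \<ge> 0"
  shows "x ^ q \<le> fact q * exp (x :: real)"
proof -
  have s: "(\<lambda>n. x ^ n / fact n) sums exp x" using exp_converges[of x] by (simp add: divide_inverse mult.commute)
  have "(\<Sum>n\<in>{q}. x ^ n / fact n) \<le> suminf (\<lambda>n. x ^ n / fact n)"
    by (rule sum_le_suminf) (use s assms in \<open>auto simp: sums_iff\<close>)
  then have "x ^ q / fact q \<le> exp x" using s by (simp add: sums_iff)
  then show ?thesis by (simp add: field_simps)
qed

lemma even_power_le_fact_exp: "y ^ (2 * q) \<le> fact (2 * q) * (exp y + exp (- y))" for y :: real
proof -
  have "y ^ (2 * q) = \<bar>y\<bar> ^ (2 * q)" by (simp add: power_even_abs)
  also have "\<dots> \<le> fact (2 * q) * exp \<bar>y\<bar>" by (rule power_le_fact_exp) simp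
  also have "\<dots> \<le> fact (2 * q) * (exp y + exp (- y))"
    by (intro mult_left_mono) (auto simp: abs_if)
  finally show ?thesis .
qed

text \<open>\<open>y^(2 q) / (2 q)!\<close> is one term of the series of \<open>exp |y|\<close>.
  Both signs of \<open>t\<close> appear because
  \<open>exp |y| \<le> exp y + exp (- y)\<close>.\<close>

lemma moment_le_mgf:
  assumes fin: "finite (set_pmf p)" and t: "t \<noteq> 0"
    and b: "measure_pmf.expectation p (\<lambda>x. exp (t * X x)) \<le> b" "measure_pmf.expectation p (\<lambda>x. exp (- t * X x)) \<le> (b :: real)"
  shows "measure_pmf.expectation p (\<lambda>x. X x ^ (2 * q)) \<le> 2 * fact (2 * q) * b / t ^ (2 * q)"
proof -
  have int: "integrable (measure_pmf p) (f :: _ \<Rightarrow> real)" for f by (rule integrable_measure_pmf_finite[OF fin])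
  have "measure_pmf.expectation p (\<lambda>x. X x ^ (2 * q)) * t ^ (2 * q) = measure_pmf.expectation p (\<lambda>x. (t * X x) ^ (2 * q))"
    by (simp add: power_mult_distrib)
  also have "\<dots> \<le> measure_pmf.expectation p (\<lambda>x. fact (2 * q) * (exp (t * X x) + exp (- (t * X x))))"
    by (intro integral_mono int even_power_le_fact_exp)
  also have "\<dots> = fact (2 * q) * (measure_pmf.expectation p (\<lambda>x. exp (t * X x)) + measure_pmf.expectation p (\<lambda>x. exp (- t * X x)))"
    by (simp add: Bochner_Integration.integral_add int)
  also have "\<dots> \<le> fact (2 * q) * (b + b)" using b by (intro mult_left_mono) auto
  finally have "measure_pmf.expectation p (\<lambda>x. X x ^ (2 * q)) * t ^ (2 * q) \<le> 2 * fact (2 * q) * b" by simp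
  moreover have "0 < t ^ (2 * q)" using t by (simp add: power_mult)
  ultimately show ?thesis by (intro mult_imp_le_div_pos)
qed

lemma sign_row_moment:
  assumes a: "a > 0" and u: "(\<Sum>j<n. (u j)\<^sup>2) \<le> 1"
  shows "measure_pmf.expectation (sign_row n a) (\<lambda>g. (\<Sum>j<n. u j * g j) ^ (2 * q))
    \<le> 2 * fact (2 * q) * (exp 1 * a\<^sup>2 / real (2 * q)) ^ q"
proof (cases "q = 0")
  case False
  \<comment> \<open>The minimizer of \<open>exp (t^2 * a^2 / 2) / t^(2 * q)\<close>.\<close>
  define t where "t = sqrt (real (2 * q)) / a"
  have t2: "t\<^sup>2 = real (2 * q) / a\<^sup>2" using a by (simp add: t_def power_divide)
  have "exp (t\<^sup>2 * a\<^sup>2 / 2) = exp 1 ^ q" using a by (simp add: t2 flip: exp_of_nat_mult)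
  moreover have "t \<noteq> 0" using a False by (simp add: t_def)
  ultimately have "measure_pmf.expectation (sign_row n a) (\<lambda>g. (\<Sum>j<n. u j * g j) ^ (2 * q)) \<le> 2 * fact (2 * q) * exp 1 ^ q / t ^ (2 * q)"
    using sign_row_mgf[OF a u, of t] sign_row_mgf[OF a u, of "- t"] by (intro moment_le_mgf) auto
  also have "\<dots> = 2 * fact (2 * q) * (exp 1 * a\<^sup>2 / real (2 * q)) ^ q"
    unfolding power_mult t2 by (simp add: power_divide power_mult_distrib)
  finally show ?thesis .
qed simp

text \<open>\<open>(2 q)! / q!\<close> is a product of \<open>q\<close> factors, each at most
  \<open>2 q\<close>. Keeping \<open>q!\<close> apart matters: it cancels the factorial of the
  exponential series in the next lemma.\<close>

lemma fact_double_le: "fact (2 * q) \<le> (fact q * real (2 * q) ^ q :: real)"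
proof -
  have "2 * q - q = q" by simp
  then have "fact (2 * q) div fact q \<le> (2 * q) ^ q"
    using fact_div_fact_le_pow[of q "2 * q"] by simp
  moreover have "fact (2 * q) = fact q * (fact (2 * q) div fact q :: nat)"
    by (rule dvd_mult_div_cancel[symmetric], rule fact_dvd) simp
  ultimately have "(fact (2 * q) :: nat) \<le> fact q * (2 * q) ^ q"
    by (metis mult_le_mono2)
  then have "real (fact (2 * q)) \<le> real (fact q * (2 * q) ^ q)" by (rule of_nat_mono)
  then show ?thesis by simp
qed

text \<open>The exponential is expanded and its terms are bounded by moments. The denominator 12
  yields the ratio \<open>exp 1 / 12 \<le> 1 / 4\<close>, so the series is at most
  \<open>2 * (4 / 3)\<close>, which is below 3.\<close>

lemma sign_row_exp_square:
  assumes a: "a > 0" and u: "(\<Sum>j<n. (u j)\<^sup>2) \<le> 1"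
  shows "measure_pmf.expectation (sign_row n a) (\<lambda>g. exp ((\<Sum>j<n. u j * g j)\<^sup>2 / (12 * a\<^sup>2))) \<le> 3"
proof -
  let ?p = "sign_row n a"
  let ?X = "\<lambda>g. (\<Sum>j<n. u j * g j)"
  let ?E = "measure_pmf.expectation ?p"
  \<comment> \<open>On a finite support the expectation is a finite sum, so it may be exchanged with
    the exponential series.\<close>
  have E: "?E f = (\<Sum>g\<in>set_pmf ?p. pmf ?p g * f g)" for f :: "_ \<Rightarrow> real"
    by (subst integral_measure_pmf[of "set_pmf ?p"]) auto
  have "(\<lambda>q. y ^ q / fact q) sums exp y" for y :: real
    using exp_converges[of y] by (simp add: divide_inverse mult.commute)
  then have "(\<lambda>q. \<Sum>g\<in>set_pmf ?p. pmf ?p g * (((?X g)\<^sup>2 / (12 * a\<^sup>2)) ^ q / fact q)) sums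
      (\<Sum>g\<in>set_pmf ?p. pmf ?p g * exp ((?X g)\<^sup>2 / (12 * a\<^sup>2)))"
    by (intro sums_sum sums_mult) auto
  then have s: "(\<lambda>q. ?E (\<lambda>g. ((?X g)\<^sup>2 / (12 * a\<^sup>2)) ^ q / fact q)) sums ?E (\<lambda>g. exp ((?X g)\<^sup>2 / (12 * a\<^sup>2)))"
    unfolding E .
  have termwise: "?E (\<lambda>g. ((?X g)\<^sup>2 / (12 * a\<^sup>2)) ^ q / fact q) \<le> 2 * (1 / 4) ^ q" for q
  proof (cases "q = 0")
    case False
    have "?E (\<lambda>g. ((?X g)\<^sup>2 / (12 * a\<^sup>2)) ^ q / fact q) = ?E (\<lambda>g. (1 / (12 * a\<^sup>2)) ^ q / fact q * (?X g) ^ (2 * q))"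
      by (simp add: power_divide power_mult)
    also have "\<dots> = (1 / (12 * a\<^sup>2)) ^ q / fact q * ?E (\<lambda>g. (?X g) ^ (2 * q))"
      by (rule Bochner_Integration.integral_mult_right) simp
    also have "\<dots> \<le> (1 / (12 * a\<^sup>2)) ^ q / fact q * (2 * fact (2 * q) * (exp 1 * a\<^sup>2 / real (2 * q)) ^ q)"
      by (intro mult_left_mono sign_row_moment[OF a u]) simp
    also have "\<dots> \<le> (1 / (12 * a\<^sup>2)) ^ q / fact q * (2 * (fact q * real (2 * q) ^ q) * (exp 1 * a\<^sup>2 / real (2 * q)) ^ q)"
      by (intro mult_left_mono mult_right_mono fact_double_le) auto
    also have "\<dots> = 2 * ((1 / (12 * a\<^sup>2)) * real (2 * q) * (exp 1 * a\<^sup>2 / real (2 * q))) ^ q"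
      unfolding power_mult_distrib by simp
    also have "(1 / (12 * a\<^sup>2)) * real (2 * q) * (exp 1 * a\<^sup>2 / real (2 * q)) = exp 1 / 12"
      using a False by simp
    also have "(exp 1 / 12) ^ q \<le> (1 / 4 :: real) ^ q"
      using exp_le by (intro power_mono) auto
    finally show ?thesis by simp
  qed simp
  have "(\<lambda>q. 2 * (1 / 4 :: real) ^ q) sums (2 * (1 / (1 - 1 / 4)))"
    by (intro sums_mult geometric_sums) simp
  from sums_le[OF termwise s this] show ?thesis by simp
qed

lemma sign_row_covariance:
  assumes a: "a > 0"
  shows "measure_pmf.expectation (sign_row n a) (\<lambda>g. (\<Sum>j<n. u j * g j) * (\<Sum>j<n. v j * g j)) = a\<^sup>2 * (\<Sum>j<n. u j * v j)"
proof -
  let ?E = "measure_pmf.expectation (sign_row n a)"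
  have E1: "?E (\<lambda>g. f (g i)) = (f (- a) + f a) / 2" if "i < n" for i and f :: "real \<Rightarrow> real"
  proof -
    have "?E (\<lambda>g. f (g i)) = measure_pmf.expectation (map_pmf (\<lambda>g. g i) (sign_row n a)) f" by simp
    also have "map_pmf (\<lambda>g. g i) (sign_row n a) = pmf_of_set {- a, a}"
      unfolding sign_row_def using that by (subst Pi_pmf_component) auto
    finally show ?thesis by (simp add: expectation_sign_pair[OF a])
  qed
  have E2: "?E (\<lambda>g. g i * g j) = (if i = j then a\<^sup>2 else 0)" if ij: "i < n" "j < n" for i j
  proof (cases "i = j")
    case True
    then show ?thesis using E1[OF ij(1), of "\<lambda>x. x * x"] by (simp add: power2_eq_square)
  next
    case False
    \<comment> \<open>The product rule for expectations asks for nonnegative factors. The shift by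
      \<open>a\<close> provides them on the support \<open>{- a, a}\<close> and is removed
      afterwards by means of the vanishing means of the entries.\<close>
    let ?f = "\<lambda>l (x::real). if l = i \<or> l = j then x + a else 1"
    have prod: "(\<Prod>l<n. ?f l (h l)) = (h i + a) * (h j + a)" for h
    proof -
      have "(\<Prod>l<n. ?f l (h l)) = (\<Prod>l\<in>{i, j}. ?f l (h l))"
        using ij by (intro prod.mono_neutral_right) auto
      then show ?thesis using False by simp
    qed
    have "?E (\<lambda>g. (g i + a) * (g j + a)) = ?E (\<lambda>g. \<Prod>l<n. ?f l (g l))" by (simp add: prod)
    also have "\<dots> = (\<Prod>l<n. measure_pmf.expectation (pmf_of_set {- a, a}) (?f l))"
      unfolding sign_row_def
      by (rule expectation_prod_Pi_pmf) (use a in \<open>auto intro: integrable_measure_pmf_finite\<close>)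
    also have "\<dots> = (\<Prod>l<n. ?f l 0)" by (intro prod.cong) (auto simp: expectation_sign_pair[OF a])
    also have "\<dots> = a\<^sup>2" by (simp add: prod[of "\<lambda>_. 0"] power2_eq_square)
    finally have "?E (\<lambda>g. (g i + a) * (g j + a)) = a\<^sup>2" .
    moreover have "?E (\<lambda>g. (g i + a) * (g j + a)) = ?E (\<lambda>g. g i * g j + a * (g i + g j) + a\<^sup>2)"
      by (simp add: algebra_simps power2_eq_square)
    moreover have "\<dots> = ?E (\<lambda>g. g i * g j) + a * (?E (\<lambda>g. g i) + ?E (\<lambda>g. g j)) + a\<^sup>2"
      by (simp add: Bochner_Integration.integral_add)
    moreover have "?E (\<lambda>g. g i) = 0" "?E (\<lambda>g. g j) = 0" using E1[of _ "\<lambda>x. x"] ij by auto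
    ultimately show ?thesis using False by simp
  qed
  have "?E (\<lambda>g. (\<Sum>j<n. u j * g j) * (\<Sum>j<n. v j * g j)) = ?E (\<lambda>g. \<Sum>i<n. \<Sum>j<n. u i * v j * (g i * g j))"
    by (simp add: sum_product mult_ac)
  also have "\<dots> = (\<Sum>i<n. \<Sum>j<n. u i * v j * ?E (\<lambda>g. g i * g j))"
    by (simp add: Bochner_Integration.integral_sum)
  also have "\<dots> = (\<Sum>i<n. \<Sum>j<n. u i * v j * (if i = j then a\<^sup>2 else 0))"
    by (intro sum.cong refl) (simp add: E2)
  also have "\<dots> = a\<^sup>2 * (\<Sum>j<n. u j * v j)"
    by (simp add: if_distrib[of "\<lambda>x. _ * x"] sum_distrib_left mult_ac cong: if_cong)
  finally show ?thesis .
qed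

section \<open>Products of two linear forms, and independent rows\<close>

lemma exp_le_second_order: "exp y \<le> 1 + y + y\<^sup>2 * exp \<bar>y\<bar>" for y :: real
proof -
  obtain e where e: "exp y = e" by blast
  \<comment> \<open>From \<open>1 - y \<le> exp (- y)\<close> comes
    \<open>e - 1 \<le> y * e\<close>, that is \<open>e - 1 - y \<le> y * (e - 1)\<close>. It remains
    to bound the right-hand side by \<open>y^2 * exp |y|\<close>, according to the sign of
    \<open>y\<close>.\<close>
  have "(1 - y) * e \<le> exp (- y) * e" using exp_ge_add_one_self[of "- y"] e by (intro mult_right_mono) auto
  also have "exp (- y) * e = 1" by (simp flip: e exp_add)
  finally have ge: "e - 1 \<le> y * e" by (simp add: algebra_simps)
  have "y * (e - 1) \<le> y\<^sup>2 * exp \<bar>y\<bar>"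
  proof (cases "y \<ge> 0")
    case True
    then show ?thesis using mult_left_mono[OF ge True] e by (simp add: power2_eq_square mult.assoc)
  next
    case False
    have "1 + y \<le> e" using exp_ge_add_one_self[of y] unfolding e .
    then have "y * (e - 1) \<le> y * y" using False by (intro mult_left_mono_neg) auto
    also have "\<dots> = y\<^sup>2 * 1" by (simp add: power2_eq_square)
    also have "\<dots> \<le> y\<^sup>2 * exp \<bar>y\<bar>" by (intro mult_left_mono) auto
    finally show ?thesis .
  qed
  then show ?thesis using ge unfolding e by (simp add: right_diff_distrib)
qed

text \<open>The constants: \<open>6912 = 2 (3 + 3) 24\<^sup>2\<close> from the proof below, and later \<open>82944 = 4 \<cdot> 3 \<cdot> 6912\<close>, where 4 comes
  from \<open>(2q)! \<le> (2q)\<^sup>2\<^sup>q\<close> and 3 bounds the number e.\<close>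

lemma sign_row_mgf_product:
  assumes a: "a > 0" and u: "(\<Sum>j<n. (u j)\<^sup>2) \<le> 1" and v: "(\<Sum>j<n. (v j)\<^sup>2) \<le> 1" and s: "\<bar>s\<bar> \<le> 1 / (24 * a\<^sup>2)"
  shows "measure_pmf.expectation (sign_row n a)
      (\<lambda>g. exp (s * ((\<Sum>j<n. u j * g j) * (\<Sum>j<n. v j * g j) - a\<^sup>2 * (\<Sum>j<n. u j * v j)))) \<le> exp (6912 * a ^ 4 * s\<^sup>2)"
proof -
  let ?E = "measure_pmf.expectation (sign_row n a)"
  let ?X = "\<lambda>g. (\<Sum>j<n. u j * g j)" and ?Y = "\<lambda>g. (\<Sum>j<n. v j * g j)"
  define c where "c = (\<Sum>j<n. u j * v j)"
  define W where "W g = ?X g * ?Y g - a\<^sup>2 * c" for g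
  \<comment> \<open>The threshold is such that \<open>2 * \<alpha> * |W|\<close> is at most
    \<open>X^2 / (24 a^2) + Y^2 / (24 a^2) + 1/12\<close>. The arithmetic-geometric mean inequality
    then doubles the exponents to the \<open>X^2 / (12 a^2)\<close> of
    \<open>sign_row_exp_square\<close>.\<close>
  define \<alpha> where "\<alpha> = 1 / (24 * a\<^sup>2)"
  have \<alpha>: "\<alpha> > 0" using a by (simp add: \<alpha>_def)
  have am: "\<bar>x * y\<bar> \<le> (x\<^sup>2 + y\<^sup>2) / 2" for x y :: real
    using zero_le_power2[of "\<bar>x\<bar> - \<bar>y\<bar>"] by (simp add: power2_diff abs_mult)
  have c: "\<bar>c\<bar> \<le> 1"
  proof -
    have "\<bar>c\<bar> \<le> (\<Sum>j<n. \<bar>u j * v j\<bar>)" unfolding c_def by (rule sum_abs)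
    also have "\<dots> \<le> (\<Sum>j<n. ((u j)\<^sup>2 + (v j)\<^sup>2) / 2)" by (intro sum_mono am)
    also have "\<dots> = ((\<Sum>j<n. (u j)\<^sup>2) + (\<Sum>j<n. (v j)\<^sup>2)) / 2" by (simp add: sum.distrib add_divide_distrib sum_divide_distrib)
    finally show ?thesis using u v by simp
  qed
  have pointwise: "exp (s * W g) \<le> 1 + s * W g + 2 * (s / \<alpha>)\<^sup>2 *
      (exp ((?X g)\<^sup>2 / (12 * a\<^sup>2)) + exp ((?Y g)\<^sup>2 / (12 * a\<^sup>2)))" for g
  proof -
    \<comment> \<open>The factor \<open>(s / \<alpha>)^2\<close> keeps the dependence on
      \<open>s\<close>. In the rest, \<open>|s|\<close> is enlarged to \<alpha> and the square of
      \<open>\<alpha> * |W|\<close> is traded for a second exponential.\<close>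
    have "(s * W g)\<^sup>2 * exp \<bar>s * W g\<bar> = (s / \<alpha>)\<^sup>2 * ((\<alpha> * \<bar>W g\<bar>)\<^sup>2 * exp (\<bar>s\<bar> * \<bar>W g\<bar>))"
      using \<alpha> by (simp add: power_mult_distrib power_divide abs_mult)
    also have "\<dots> \<le> (s / \<alpha>)\<^sup>2 * ((fact 2 * exp (\<alpha> * \<bar>W g\<bar>)) * exp (\<alpha> * \<bar>W g\<bar>))"
    proof -
      have "(\<alpha> * \<bar>W g\<bar>)\<^sup>2 \<le> fact 2 * exp (\<alpha> * \<bar>W g\<bar>)"
        using \<alpha> by (intro power_le_fact_exp) simp
      moreover have "\<bar>s\<bar> * \<bar>W g\<bar> \<le> \<alpha> * \<bar>W g\<bar>"
        using s unfolding \<alpha>_def by (rule mult_right_mono) (rule abs_ge_zero)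
      then have "exp (\<bar>s\<bar> * \<bar>W g\<bar>) \<le> exp (\<alpha> * \<bar>W g\<bar>)" by (simp only: exp_le_cancel_iff)
      ultimately have "(\<alpha> * \<bar>W g\<bar>)\<^sup>2 * exp (\<bar>s\<bar> * \<bar>W g\<bar>) \<le> (fact 2 * exp (\<alpha> * \<bar>W g\<bar>)) * exp (\<alpha> * \<bar>W g\<bar>)"
        by (rule mult_mono) simp_all
      then show ?thesis by (rule mult_left_mono) simp
    qed
    also have "\<dots> = 2 * (s / \<alpha>)\<^sup>2 * exp (2 * \<alpha> * \<bar>W g\<bar>)"
    proof -
      have "exp (\<alpha> * \<bar>W g\<bar>) * exp (\<alpha> * \<bar>W g\<bar>) = exp (2 * \<alpha> * \<bar>W g\<bar>)" unfolding exp_add[symmetric] by simp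
      then show ?thesis by simp
    qed
    also have "\<dots> \<le> 2 * (s / \<alpha>)\<^sup>2 * (exp ((?X g)\<^sup>2 / (12 * a\<^sup>2)) + exp ((?Y g)\<^sup>2 / (12 * a\<^sup>2)))"
    proof (rule mult_left_mono)
      have "\<bar>W g\<bar> \<le> ((?X g)\<^sup>2 + (?Y g)\<^sup>2) / 2 + a\<^sup>2"
      proof -
        have "\<bar>W g\<bar> \<le> \<bar>?X g * ?Y g\<bar> + \<bar>a\<^sup>2 * c\<bar>" unfolding W_def by (rule abs_triangle_ineq4)
        moreover have "\<bar>a\<^sup>2 * c\<bar> \<le> a\<^sup>2" using c by (simp add: abs_mult mult_left_le)
        ultimately show ?thesis using am[of "?X g" "?Y g"] by linarith
      qed
      then have "2 * \<alpha> * \<bar>W g\<bar> \<le> 2 * \<alpha> * (((?X g)\<^sup>2 + (?Y g)\<^sup>2) / 2 + a\<^sup>2)" using \<alpha> by (intro mult_left_mono) auto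
      also have "\<dots> = ((?X g)\<^sup>2 / (24 * a\<^sup>2) + (?Y g)\<^sup>2 / (24 * a\<^sup>2)) + 1 / 12"
      proof -
        have "2 * \<alpha> * (y / 2 + a\<^sup>2) = y / (24 * a\<^sup>2) + 1 / 12" for y using a by (simp add: \<alpha>_def distrib_left)
        from this[of "(?X g)\<^sup>2 + (?Y g)\<^sup>2"] show ?thesis by (simp only: add_divide_distrib[of _ _ "24 * a\<^sup>2"])
      qed
      finally have "exp (2 * \<alpha> * \<bar>W g\<bar>) \<le> exp ((?X g)\<^sup>2 / (24 * a\<^sup>2)) * exp ((?Y g)\<^sup>2 / (24 * a\<^sup>2)) * exp (1 / 12)"
        unfolding exp_add[symmetric] by (simp only: exp_le_cancel_iff)
      also have "\<dots> \<le> (((exp ((?X g)\<^sup>2 / (24 * a\<^sup>2)))\<^sup>2 + (exp ((?Y g)\<^sup>2 / (24 * a\<^sup>2)))\<^sup>2) / 2) * 2"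
      proof (rule mult_mono)
        show "exp ((?X g)\<^sup>2 / (24 * a\<^sup>2)) * exp ((?Y g)\<^sup>2 / (24 * a\<^sup>2)) \<le> (((exp ((?X g)\<^sup>2 / (24 * a\<^sup>2)))\<^sup>2 + (exp ((?Y g)\<^sup>2 / (24 * a\<^sup>2)))\<^sup>2) / 2)"
          by (rule order_trans[OF abs_ge_self am])
        have "exp (1 / 12 :: real) \<le> exp (1 / 2)" by simp
        also have "\<dots> \<le> 2" using exp_half_le2 by simp
        finally show "exp (1 / 12 :: real) \<le> 2" .
      qed auto
      also have "\<dots> = exp ((?X g)\<^sup>2 / (12 * a\<^sup>2)) + exp ((?Y g)\<^sup>2 / (12 * a\<^sup>2))"
      proof -
        have "(exp (y / (24 * a\<^sup>2)))\<^sup>2 = exp (y / (12 * a\<^sup>2))" for y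
          unfolding exp_double[symmetric] by simp
        then show ?thesis by simp
      qed
      finally show "exp (2 * \<alpha> * \<bar>W g\<bar>) \<le> exp ((?X g)\<^sup>2 / (12 * a\<^sup>2)) + exp ((?Y g)\<^sup>2 / (12 * a\<^sup>2))" .
    qed simp
    finally show ?thesis using exp_le_second_order[of "s * W g"] by linarith
  qed
  \<comment> \<open>\<open>W\<close> is centred, which removes the linear term and leaves a bound
    quadratic in \<open>s\<close>.\<close>
  have EW: "?E W = 0"
    unfolding W_def c_def using sign_row_covariance[OF a, of n u v] by (simp add: Bochner_Integration.integral_diff)
  have "?E (\<lambda>g. exp (s * W g)) \<le> ?E (\<lambda>g. 1 + s * W g + 2 * (s / \<alpha>)\<^sup>2 *
      (exp ((?X g)\<^sup>2 / (12 * a\<^sup>2)) + exp ((?Y g)\<^sup>2 / (12 * a\<^sup>2))))"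
    by (intro integral_mono pointwise) auto
  also have "\<dots> = 1 + s * ?E W + 2 * (s / \<alpha>)\<^sup>2 *
      (?E (\<lambda>g. exp ((?X g)\<^sup>2 / (12 * a\<^sup>2))) + ?E (\<lambda>g. exp ((?Y g)\<^sup>2 / (12 * a\<^sup>2))))"
    by (simp add: Bochner_Integration.integral_add)
  also have "\<dots> \<le> 1 + s * 0 + 2 * (s / \<alpha>)\<^sup>2 * (3 + 3)"
    unfolding EW by (intro add_left_mono mult_left_mono add_mono sign_row_exp_square a u v) auto
  also have "\<dots> = 1 + 6912 * a ^ 4 * s\<^sup>2"
    using a by (simp add: \<alpha>_def power_divide power_mult_distrib)
  also have "\<dots> \<le> exp (6912 * a ^ 4 * s\<^sup>2)" by (rule exp_ge_add_one_self)
  finally show ?thesis by (simp add: W_def c_def)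
qed

text \<open>With \<open>a^2 = 1 / m\<close> the one-row range \<open>1 / (24 * a^2)\<close> becomes
  \<open>m / 24\<close>, and \<open>m\<close> independent rows contributing
  \<open>a^4 = 1 / m^2\<close> each leave \<open>1 / m\<close> in the exponent.\<close>

lemma sign_rows_mgf:
  assumes m: "m > 0" and u: "(\<Sum>j<n. (u j)\<^sup>2) \<le> 1" and v: "(\<Sum>j<n. (v j)\<^sup>2) \<le> 1" and l: "\<bar>l\<bar> \<le> real m / 24"
  shows "measure_pmf.expectation (sign_rows m n (1 / sqrt (real m)))
      (\<lambda>g. exp (l * ((\<Sum>i<m. (\<Sum>j<n. u j * g i j) * (\<Sum>j<n. v j * g i j)) - (\<Sum>j<n. u j * v j)))) \<le> exp (6912 * l\<^sup>2 / real m)"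
proof -
  define a where "a = 1 / sqrt (real m)"
  have a: "a > 0" "a\<^sup>2 = 1 / real m" using m by (auto simp: a_def power_divide)
  let ?W = "\<lambda>h. (\<Sum>j<n. u j * h j) * (\<Sum>j<n. v j * h j) - a\<^sup>2 * (\<Sum>j<n. u j * v j)"
  have "(\<Sum>i<m. (\<Sum>j<n. u j * g i j) * (\<Sum>j<n. v j * g i j)) - (\<Sum>j<n. u j * v j) = (\<Sum>i<m. ?W (g i))" for g
    using m by (simp add: sum_subtractf a(2))
  then have "measure_pmf.expectation (sign_rows m n a) (\<lambda>g. exp (l * ((\<Sum>i<m. (\<Sum>j<n. u j * g i j) * (\<Sum>j<n. v j * g i j)) - (\<Sum>j<n. u j * v j))))
      = measure_pmf.expectation (sign_rows m n a) (\<lambda>g. \<Prod>i<m. exp (l * ?W (g i)))"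
    by (simp add: sum_distrib_left exp_sum)
  also have "\<dots> = (\<Prod>i<m. measure_pmf.expectation (sign_row n a) (\<lambda>h. exp (l * ?W h)))"
    unfolding sign_rows_def by (rule expectation_prod_Pi_pmf) auto
  also have "\<dots> \<le> (\<Prod>i<m. exp (6912 * a ^ 4 * l\<^sup>2))"
    using l m a by (intro prod_mono conjI sign_row_mgf_product[OF a(1) u v] Bochner_Integration.integral_nonneg) auto
  also have "\<dots> = exp (real m * (6912 * a ^ 4 * l\<^sup>2))" by (simp add: exp_of_nat_mult)
  also have "a ^ 4 = (1 / real m)\<^sup>2" using a(2) by (simp flip: power_mult add: numeral_eq_Suc)
  also have "real m * (6912 * (1 / real m)\<^sup>2 * l\<^sup>2) = 6912 * l\<^sup>2 / real m"
    using m by (simp add: power2_eq_square)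
  finally show ?thesis by (simp add: a_def)
qed

lemma sign_rows_moment_unit:
  assumes m: "m > 0" and u: "(\<Sum>j<n. (u j)\<^sup>2) \<le> 1" and v: "(\<Sum>j<n. (v j)\<^sup>2) \<le> 1" and q: "1 \<le> q" "q \<le> m"
  shows "measure_pmf.expectation (sign_rows m n (1 / sqrt (real m)))
      (\<lambda>g. ((\<Sum>i<m. (\<Sum>j<n. u j * g i j) * (\<Sum>j<n. v j * g i j)) - (\<Sum>j<n. u j * v j)) ^ (2 * q))
    \<le> 2 * (82944 * real q / real m) ^ q"
proof -
  let ?E = "measure_pmf.expectation (sign_rows m n (1 / sqrt (real m)))"
  \<comment> \<open>Makes the exponent \<open>6912 * t^2 / m\<close> equal to \<open>q\<close>. As
    6912 = 12 * 576, the range \<open>t \<le> m / 24\<close> amounts to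
    \<open>q \<le> 12 * m\<close>, which \<open>q \<le> m\<close> grants.\<close>
  define t where "t = sqrt (real m * real q / 6912)"
  have t2: "t\<^sup>2 = real m * real q / 6912" by (simp add: t_def)
  have t0: "t \<ge> 0" by (simp add: t_def)
  have "t\<^sup>2 \<le> (real m / 24)\<^sup>2"
  proof -
    have "real m * real q \<le> real m * real m" using q by (intro mult_left_mono) auto
    moreover have "0 \<le> real m * real m" by simp
    moreover have "(real m / 24)\<^sup>2 = real m * real m / 576" by (simp add: power2_eq_square)
    ultimately show ?thesis unfolding t2 by linarith
  qed
  then have t: "\<bar>t\<bar> \<le> real m / 24" "\<bar>- t\<bar> \<le> real m / 24" using t0 power2_le_imp_le[of t "real m / 24"] by auto
  have ex: "exp (6912 * t\<^sup>2 / real m) = exp 1 ^ q" using m by (simp add: t2 flip: exp_of_nat_mult)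
  let ?Z = "\<lambda>g. (\<Sum>i<m. (\<Sum>j<n. u j * g i j) * (\<Sum>j<n. v j * g i j)) - (\<Sum>j<n. u j * v j)"
  have "t \<noteq> 0" using m q by (simp add: t_def)
  then have "?E (\<lambda>g. ?Z g ^ (2 * q)) \<le> 2 * fact (2 * q) * exp 1 ^ q / t ^ (2 * q)"
    using sign_rows_mgf[OF m u v t(1)] sign_rows_mgf[OF m u v t(2)] ex
    by (intro moment_le_mgf) auto
  also have "\<dots> = 2 * fact (2 * q) * exp 1 ^ q / (real m * real q / 6912) ^ q" unfolding power_mult t2 ..
  also have "\<dots> \<le> 2 * (real (2 * q) ^ (2 * q)) * 3 ^ q / (real m * real q / 6912) ^ q"
  proof (intro divide_right_mono mult_mono)
    show "fact (2 * q) \<le> real (2 * q) ^ (2 * q)"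
      by (metis fact_le_power le_refl of_nat_fact of_nat_mono of_nat_power)
    show "exp 1 ^ q \<le> (3 :: real) ^ q" using exp_le by (intro power_mono) auto
  qed auto
  also have "\<dots> = 2 * ((real (2 * q))\<^sup>2 * 3 / (real m * real q / 6912)) ^ q"
    unfolding power_divide power_mult_distrib[of _ 3] power_mult by simp
  also have "(real (2 * q))\<^sup>2 * 3 / (real m * real q / 6912) = 82944 * real q / real m"
    using m q by (simp add: power2_eq_square field_simps)
  finally show ?thesis .
qed

lemma sign_rows_moment:
  assumes m: "m > 0" and q: "1 \<le> q" "q \<le> m"
  shows "measure_pmf.expectation (sign_rows m n (1 / sqrt (real m)))
      (\<lambda>g. ((\<Sum>i<m. (\<Sum>j<n. u j * g i j) * (\<Sum>j<n. v j * g i j)) - (\<Sum>j<n. u j * v j)) ^ (2 * q))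
    \<le> 2 * (82944 * real q / real m) ^ q * ((\<Sum>j<n. (u j)\<^sup>2) * (\<Sum>j<n. (v j)\<^sup>2)) ^ q"
proof -
  let ?E = "measure_pmf.expectation (sign_rows m n (1 / sqrt (real m)))"
  let ?Z = "\<lambda>u v g. (\<Sum>i<m. (\<Sum>j<n. u j * g i j) * (\<Sum>j<n. v j * g i j)) - (\<Sum>j<n. u j * v j)"
  define a b where "a = sqrt (\<Sum>j<n. (u j)\<^sup>2)" and "b = sqrt (\<Sum>j<n. (v j)\<^sup>2)"
  have ab: "a\<^sup>2 = (\<Sum>j<n. (u j)\<^sup>2)" "b\<^sup>2 = (\<Sum>j<n. (v j)\<^sup>2)" by (auto simp: a_def b_def sum_nonneg)
  \<comment> \<open>For a zero vector the quotient is 0, since division by 0 gives 0; so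
    \<open>u j = a * u' j\<close> and the norm bound on \<open>u'\<close> persist.\<close>
  define u' v' where "u' = (\<lambda>j. u j / a)" and "v' = (\<lambda>j. v j / b)"
  have u: "u j = a * u' j" if "j < n" for j
  proof (cases "a = 0")
    case True
    then have "u j = 0" using ab(1) that by (auto simp: sum_nonneg_eq_0_iff)
    then show ?thesis using True by simp
  qed (simp add: u'_def)
  have v: "v j = b * v' j" if "j < n" for j
  proof (cases "b = 0")
    case True
    then have "v j = 0" using ab(2) that by (auto simp: sum_nonneg_eq_0_iff)
    then show ?thesis using True by simp
  qed (simp add: v'_def)
  have u1: "(\<Sum>j<n. (u' j)\<^sup>2) \<le> 1"
    unfolding u'_def power_divide by (simp flip: sum_divide_distrib ab)
  have v1: "(\<Sum>j<n. (v' j)\<^sup>2) \<le> 1"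
    unfolding v'_def power_divide by (simp flip: sum_divide_distrib ab)
  have X: "(\<Sum>j<n. u j * h j) = a * (\<Sum>j<n. u' j * h j)" for h
    unfolding sum_distrib_left by (intro sum.cong) (auto simp: u)
  have Y: "(\<Sum>j<n. v j * h j) = b * (\<Sum>j<n. v' j * h j)" for h
    unfolding sum_distrib_left by (intro sum.cong) (auto simp: v)
  have UV: "(\<Sum>j<n. u j * v j) = a * b * (\<Sum>j<n. u' j * v' j)"
    unfolding sum_distrib_left by (intro sum.cong) (auto simp: u v)
  have "(\<Sum>i<m. (\<Sum>j<n. u j * g i j) * (\<Sum>j<n. v j * g i j)) =
      a * b * (\<Sum>i<m. (\<Sum>j<n. u' j * g i j) * (\<Sum>j<n. v' j * g i j))" for g
    unfolding sum_distrib_left[of "a * b"] by (intro sum.cong) (auto simp: X Y)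
  then have "?Z u v g = a * b * ?Z u' v' g" for g
    by (simp only: UV right_diff_distrib)
  then have "?E (\<lambda>g. ?Z u v g ^ (2 * q)) = (a * b) ^ (2 * q) * ?E (\<lambda>g. ?Z u' v' g ^ (2 * q))"
    by (simp add: power_mult_distrib)
  also have "\<dots> \<le> (a * b) ^ (2 * q) * (2 * (82944 * real q / real m) ^ q)"
    by (intro mult_left_mono sign_rows_moment_unit m u1 v1 q) (simp add: power_mult)
  also have "(a * b) ^ (2 * q) = ((\<Sum>j<n. (u j)\<^sup>2) * (\<Sum>j<n. (v j)\<^sup>2)) ^ q"
    by (simp add: power_mult power_mult_distrib ab)
  finally show ?thesis by (simp add: mult_ac)
qed

subsection \<open>A net of the unit ball\<close>

text \<open>Rounding \<open>x\<close> down to the lattice of spacing \<open>1 / (16\<surd>r)\<close> moves it by at most \<open>1/16\<close>. The integer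
  coordinates then have 1-norm at most \<open>16\<surd>r |x|\<^sub>1 + r \<le> 17r\<close> if \<open>x\<close> is in the unit ball.\<close>

definition grid :: "nat \<Rightarrow> (nat \<Rightarrow> int) set" where
  "grid r = {p \<in> PiE {..<r} (\<lambda>_. {- int (17 * r)..int (17 * r)}). (\<Sum>i<r. nat \<bar>p i\<bar>) \<le> 17 * r}"

lemma finite_grid: "finite (grid r)"
  unfolding grid_def by (rule finite_subset[OF _ finite_PiE[of "{..<r}" "\<lambda>_. {- int (17 * r)..int (17 * r)}"]]) auto

text \<open>Giving the point \<open>p\<close> the weight \<open>2^(17 r - |p|)\<close>, which is at least 1 on the grid, makes the count
  a product of one-dimensional geometric sums.\<close>

lemma card_grid_le: "real (card (grid r)) \<le> (2 ^ 19) ^ r"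
proof -
  define b where "b = 17 * r"
  let ?P = "PiE {..<r} (\<lambda>_. {- int b..int b})"
  have geo: "(\<Sum>k\<le>b. (1 / 2 :: real) ^ k) \<le> 2"
  proof -
    have "(\<Sum>k\<le>b. (1 / 2 :: real) ^ k) \<le> suminf (\<lambda>k. (1 / 2) ^ k)"
      by (rule sum_le_suminf) (auto intro: summable_geometric)
    also have "\<dots> = 2" by (subst suminf_geometric) auto
    finally show ?thesis .
  qed
  \<comment> \<open>Two geometric series, one for each sign; the point 0 is counted in both.\<close>
  have one: "(\<Sum>x\<in>{- int b..int b}. (1 / 2 :: real) ^ nat \<bar>x\<bar>) \<le> 4"
  proof -
    have sub: "{- int b..int b} \<subseteq> int ` {..b} \<union> (\<lambda>k. - int k) ` {..b}"
    proof
      fix x assume x: "x \<in> {- int b..int b}"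
      show "x \<in> int ` {..b} \<union> (\<lambda>k. - int k) ` {..b}"
      proof (cases "x \<ge> 0")
        case True
        then show ?thesis using x by (intro UnI1 image_eqI[of _ _ "nat x"]) auto
      next
        case False
        then show ?thesis using x by (intro UnI2 image_eqI[of _ _ "nat (- x)"]) auto
      qed
    qed
    have "(\<Sum>x\<in>{- int b..int b}. (1 / 2 :: real) ^ nat \<bar>x\<bar>) \<le> (\<Sum>x\<in>int ` {..b} \<union> (\<lambda>k. - int k) ` {..b}. (1 / 2 :: real) ^ nat \<bar>x\<bar>)"
      by (rule sum_mono2[OF _ sub]) auto
    also have "\<dots> \<le> (\<Sum>x\<in>int ` {..b}. (1 / 2 :: real) ^ nat \<bar>x\<bar>) + (\<Sum>x\<in>(\<lambda>k. - int k) ` {..b}. (1 / 2 :: real) ^ nat \<bar>x\<bar>)"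
      by (subst sum_Un) (simp_all add: sum_nonneg)
    also have "\<dots> = (\<Sum>k\<le>b. (1 / 2 :: real) ^ k) + (\<Sum>k\<le>b. (1 / 2 :: real) ^ k)"
      by (subst (1 2) sum.reindex) (simp_all add: inj_on_def o_def)
    finally show ?thesis using geo by linarith
  qed
  have "real (card (grid r)) = (\<Sum>p\<in>grid r. 1)" by simp
  also have "\<dots> \<le> (\<Sum>p\<in>grid r. 2 ^ b * (\<Prod>i<r. (1 / 2) ^ nat \<bar>p i\<bar>))"
  proof (rule sum_mono)
    fix p assume "p \<in> grid r"
    then have le: "(\<Sum>i<r. nat \<bar>p i\<bar>) \<le> b" by (simp add: grid_def b_def)
    have "(1 :: real) = 2 ^ b * (1 / 2) ^ b" by (simp add: power_divide)
    also have "\<dots> \<le> 2 ^ b * (1 / 2) ^ (\<Sum>i<r. nat \<bar>p i\<bar>)"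
      by (intro mult_left_mono power_decreasing le) auto
    finally show "(1 :: real) \<le> 2 ^ b * (\<Prod>i<r. (1 / 2) ^ nat \<bar>p i\<bar>)" by (simp add: power_sum)
  qed
  also have "\<dots> \<le> (\<Sum>p\<in>?P. 2 ^ b * (\<Prod>i<r. (1 / 2) ^ nat \<bar>p i\<bar>))"
  proof (rule sum_mono2)
    show "finite ?P" by (intro finite_PiE) simp_all
    show "grid r \<subseteq> ?P" unfolding grid_def b_def by blast
  qed (simp add: prod_nonneg)
  also have "\<dots> = 2 ^ b * (\<Prod>i<r. \<Sum>x\<in>{- int b..int b}. (1 / 2) ^ nat \<bar>x\<bar>)"
    by (subst prod_sum_PiE) (auto simp: sum_distrib_left)
  also have "\<dots> \<le> 2 ^ b * (\<Prod>i<r. 4)"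
    by (intro mult_left_mono prod_mono conjI one sum_nonneg) auto
  also have "\<dots> = (2 ^ 17 * 4) ^ r" 
    unfolding b_def power_mult by (simp only: power_mult_distrib prod_constant card_lessThan)
  finally show ?thesis by simp
qed

lemma grid_approximation:
  assumes r: "r > 0" and x: "L2_set x {..<r} \<le> 1"
  obtains p where "p \<in> grid r" "L2_set (\<lambda>i. x i - real_of_int (p i) / (16 * sqrt (real r))) {..<r} \<le> 1 / 16"
proof -
  define H where "H = 16 * sqrt (real r)"
  have H: "H > 0" using r by (simp add: H_def)
  define p where "p = restrict (\<lambda>i. \<lfloor>x i * H\<rfloor>) {..<r}"
  have p: "0 \<le> x i * H - real_of_int (p i)" "x i * H - real_of_int (p i) \<le> 1" if "i < r" for i
    using that by (auto simp: p_def) linarith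
  have "(L2_set (\<lambda>i. x i - real_of_int (p i) / H) {..<r})\<^sup>2 = (\<Sum>i<r. (x i - real_of_int (p i) / H)\<^sup>2)"
    by (simp add: L2_set_def sum_nonneg)
  also have "\<dots> \<le> (\<Sum>i<r. (1 / H)\<^sup>2)"
  proof (rule sum_mono)
    fix i assume "i \<in> {..<r}"
    then have "i < r" by simp
    have "x i - real_of_int (p i) / H = (x i * H - real_of_int (p i)) / H" using H by (simp add: field_simps)
    then show "(x i - real_of_int (p i) / H)\<^sup>2 \<le> (1 / H)\<^sup>2"
      using p[OF \<open>i < r\<close>] H by (auto intro!: power_mono divide_right_mono)
  qed
  also have "\<dots> = (1 / 16)\<^sup>2" using r by (simp add: H_def power_divide power_mult_distrib)
  finally have close: "L2_set (\<lambda>i. x i - real_of_int (p i) / H) {..<r} \<le> 1 / 16"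
    by (rule power2_le_imp_le) simp
  \<comment> \<open>Cauchy-Schwarz against the constant vector bounds the 1-norm by
    \<open>sqrt r\<close>; times the \<open>sqrt r\<close> in \<open>H\<close> this is linear in
    \<open>r\<close>, and the rounding adds at most 1 per coordinate.\<close>
  have "(\<Sum>i<r. \<bar>x i\<bar>) = (\<Sum>i<r. \<bar>1\<bar> * \<bar>x i\<bar>)" by simp
  also have "\<dots> \<le> L2_set (\<lambda>_. 1) {..<r} * L2_set x {..<r}" by (rule L2_set_mult_ineq)
  also have "\<dots> \<le> sqrt (real r) * 1" using x by (intro mult_mono) (auto simp: L2_set_def sum_nonneg)
  finally have l1: "(\<Sum>i<r. \<bar>x i\<bar>) \<le> sqrt (real r)" by simp
  have "real (\<Sum>i<r. nat \<bar>p i\<bar>) = (\<Sum>i<r. \<bar>real_of_int (p i)\<bar>)" by simp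
  also have "\<dots> \<le> (\<Sum>i<r. \<bar>x i\<bar> * H + 1)"
  proof (rule sum_mono)
    fix i assume "i \<in> {..<r}"
    then have "\<bar>real_of_int (p i)\<bar> \<le> \<bar>x i * H\<bar> + 1" using p[of i] by auto
    then show "\<bar>real_of_int (p i)\<bar> \<le> \<bar>x i\<bar> * H + 1" using H by (simp add: abs_mult)
  qed
  also have "\<dots> = (\<Sum>i<r. \<bar>x i\<bar>) * H + real r" by (simp add: sum.distrib sum_distrib_right)
  also have "\<dots> \<le> sqrt (real r) * H + real r" using l1 H by (intro add_right_mono mult_right_mono) auto
  also have "\<dots> = real (17 * r)" by (simp add: H_def)
  finally have sum: "(\<Sum>i<r. nat \<bar>p i\<bar>) \<le> 17 * r" by (simp only: of_nat_le_iff)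
  have "p i \<in> {- int (17 * r)..int (17 * r)}" if "i < r" for i
  proof -
    have "nat \<bar>p i\<bar> \<le> (\<Sum>i<r. nat \<bar>p i\<bar>)" using that by (intro member_le_sum) auto
    then have "nat \<bar>p i\<bar> \<le> 17 * r" using sum by linarith
    then show ?thesis by auto
  qed
  then have "p \<in> grid r" using sum by (auto simp: grid_def p_def PiE_iff)
  then show thesis using that close unfolding H_def by blast
qed

text \<open>Bootstrapping for a seminorm: if \<open>L\<close> is its supremum on the unit ball,
  approximation by a grid point gives \<open>L \<le> (17/16)^2 + L/16\<close>, hence
  \<open>L \<le> 289/240 < 4/3\<close>. The crude bound by \<open>M\<close> makes \<open>L\<close>
  finite, without which this inequality could not be solved for \<open>L\<close>. From below,
  \<open>(15/16)^2 - L/16\<close> stays above 2/3.\<close>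

lemma grid_embedding:
  fixes F :: "(nat \<Rightarrow> real) \<Rightarrow> real"
  assumes tri: "\<And>x y. F (\<lambda>i. x i + y i) \<le> F x + F y"
    and hom: "\<And>s x. F (\<lambda>i. s * x i) = \<bar>s\<bar> * F x"
    and bound: "\<And>x. F x \<le> M * L2_set x {..<r}"
    and grid: "\<And>p. p \<in> grid r \<Longrightarrow>
      15 / 16 * L2_set (\<lambda>i. real_of_int (p i) / (16 * sqrt (real r))) {..<r} \<le> F (\<lambda>i. real_of_int (p i) / (16 * sqrt (real r))) \<and>
      F (\<lambda>i. real_of_int (p i) / (16 * sqrt (real r))) \<le> 17 / 16 * L2_set (\<lambda>i. real_of_int (p i) / (16 * sqrt (real r))) {..<r}"
  shows "2 / 3 * L2_set x {..<r} \<le> F x" "F x \<le> 4 / 3 * L2_set x {..<r}"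
proof -
  let ?N = "\<lambda>x. L2_set x {..<r}"
  have nonneg: "0 \<le> F x" for x
  proof -
    have "F (\<lambda>i. 0 * x i) \<le> F x + F (\<lambda>i. - 1 * x i)"
      using tri[of x "\<lambda>i. - 1 * x i"] by simp
    then show ?thesis unfolding hom by simp
  qed
  have Nhom: "?N (\<lambda>i. s * x i) = \<bar>s\<bar> * ?N x" for s x
    by (simp add: L2_set_def power_mult_distrib real_sqrt_mult flip: sum_distrib_left)
  have "2 / 3 * ?N x \<le> F x \<and> F x \<le> 4 / 3 * ?N x"
  proof (cases "?N x = 0")
    case True
    then show ?thesis using bound[of x] nonneg[of x] by simp
  next
    case False
    then have Nx: "?N x > 0" using L2_set_nonneg[of x "{..<r}"] by linarith
    then have r: "r > 0" by (cases r) auto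
    define B where "B = {x. ?N x \<le> 1}"
    define L where "L = (SUP x\<in>B. F x)"
    have "F x \<le> \<bar>M\<bar>" if "x \<in> B" for x
    proof -
      have "F x \<le> M * ?N x" by (rule bound)
      also have "\<dots> \<le> \<bar>M\<bar> * ?N x" by (intro mult_right_mono) auto
      also have "\<dots> \<le> \<bar>M\<bar> * 1" using that by (intro mult_left_mono) (auto simp: B_def)
      finally show ?thesis by simp
    qed
    then have bdd: "bdd_above (F ` B)" by (auto simp: bdd_above_def)
    have small: "F y \<le> L / 16" if "?N y \<le> 1 / 16" for y
    proof -
      have "?N (\<lambda>i. 16 * y i) \<le> 1" unfolding Nhom using that by simp
      then have "F (\<lambda>i. 16 * y i) \<le> L" unfolding L_def by (intro cSUP_upper bdd) (simp add: B_def)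
      then show ?thesis unfolding hom by simp
    qed
    have both: "F x \<le> 289 / 256 + L / 16 \<and> 15 / 16 * (?N x - 1 / 16) - L / 16 \<le> F x" if "x \<in> B" for x
    proof -
      obtain p where p: "p \<in> grid r" and d: "?N (\<lambda>i. x i - real_of_int (p i) / (16 * sqrt (real r))) \<le> 1 / 16"
        using grid_approximation[OF r] \<open>x \<in> B\<close> unfolding B_def by blast
      define z where "z = (\<lambda>i. real_of_int (p i) / (16 * sqrt (real r)))"
      have d1: "?N (\<lambda>i. x i - z i) \<le> 1 / 16" using d by (simp add: z_def)
      have d2: "?N (\<lambda>i. z i - x i) \<le> 1 / 16"
        using d1 Nhom[of "- 1" "\<lambda>i. x i - z i"] by simp
      have z: "15 / 16 * ?N z \<le> F z" "F z \<le> 17 / 16 * ?N z" using grid[OF p] by (auto simp: z_def)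
      have "?N (\<lambda>i. x i + (z i - x i)) \<le> ?N x + ?N (\<lambda>i. z i - x i)" by (rule L2_set_triangle_ineq)
      then have Nz: "?N z \<le> 1 + 1 / 16" using d2 \<open>x \<in> B\<close> by (simp add: B_def)
      have "?N (\<lambda>i. z i + (x i - z i)) \<le> ?N z + ?N (\<lambda>i. x i - z i)" by (rule L2_set_triangle_ineq)
      then have Nz': "?N x - 1 / 16 \<le> ?N z" using d1 by simp
      have up: "F x \<le> F z + F (\<lambda>i. x i - z i)" using tri[of z "\<lambda>i. x i - z i"] by simp
      have low: "F z \<le> F x + F (\<lambda>i. z i - x i)" using tri[of x "\<lambda>i. z i - x i"] by simp
      have "F x \<le> 289 / 256 + L / 16" using up z Nz small[OF d1] by linarith
      moreover have "15 / 16 * (?N x - 1 / 16) - L / 16 \<le> F x"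
      proof -
        have "15 / 16 * (?N x - 1 / 16) \<le> 15 / 16 * ?N z" using Nz' by (rule mult_left_mono) simp
        also have "\<dots> \<le> F z" by (rule z(1))
        also have "\<dots> \<le> F x + F (\<lambda>i. z i - x i)" by (rule low)
        finally show ?thesis using small[OF d2] by (simp only: diff_le_eq)
      qed
      ultimately show ?thesis ..
    qed
    have "(\<lambda>_. 0) \<in> B" by (simp add: B_def L2_set_def)
    then have "B \<noteq> {}" by blast
    then have "L \<le> 289 / 256 + L / 16" unfolding L_def using both by (intro cSUP_least) (auto simp: L_def)
    then have L: "L \<le> 289 / 240" by simp
    define y where "y = (\<lambda>i. (1 / ?N x) * x i)"
    have Ny: "?N y = 1" unfolding y_def Nhom using Nx by simp
    then have "y \<in> B" by (simp add: B_def)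
    from both[OF this] have "2 / 3 \<le> F y" "F y \<le> 4 / 3" using L Ny by auto
    moreover have "F y = F x / ?N x" unfolding y_def hom using Nx by simp
    ultimately show ?thesis using Nx by (simp add: field_simps)
  qed
  then show "2 / 3 * ?N x \<le> F x" "F x \<le> 4 / 3 * ?N x" by auto
qed

subsection \<open>Random sign matrices\<close>

text \<open>Links entrywise independence to independent rows. \<open>case_prod\<close> is injective,
  so the mass functions can be compared at \<open>curry f\<close>: both are the same product if
  \<open>f\<close> has its default value outside \<open>I \<times> J\<close>, and both vanish
  otherwise.\<close>

lemma Pi_pmf_Times:
  assumes "finite I" "finite J"
  shows "Pi_pmf (I \<times> J) d (\<lambda>_. p) = map_pmf case_prod (Pi_pmf I (\<lambda>_. d) (\<lambda>_. Pi_pmf J d (\<lambda>_. p)))"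
proof (rule pmf_eqI)
  fix f :: "'a \<times> 'b \<Rightarrow> 'c"
  have inj: "inj (case_prod :: ('a \<Rightarrow> 'b \<Rightarrow> 'c) \<Rightarrow> 'a \<times> 'b \<Rightarrow> 'c)"
    by (rule inj_on_inverseI[of _ curry]) simp
  have "pmf (map_pmf case_prod (Pi_pmf I (\<lambda>_. d) (\<lambda>_. Pi_pmf J d (\<lambda>_. p)))) f =
      pmf (map_pmf case_prod (Pi_pmf I (\<lambda>_. d) (\<lambda>_. Pi_pmf J d (\<lambda>_. p)))) (case_prod (curry f))" by simp
  also have "\<dots> = pmf (Pi_pmf I (\<lambda>_. d) (\<lambda>_. Pi_pmf J d (\<lambda>_. p))) (curry f)"
    by (rule pmf_map_inj'[OF inj])
  also have "\<dots> = pmf (Pi_pmf (I \<times> J) d (\<lambda>_. p)) f"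
  proof (cases "\<forall>x. x \<notin> I \<times> J \<longrightarrow> f x = d")
    case True
    then have o: "\<forall>i. i \<notin> I \<longrightarrow> curry f i = (\<lambda>_. d)" and inn: "\<And>i. i \<in> I \<Longrightarrow> \<forall>j. j \<notin> J \<longrightarrow> curry f i j = d"
      by (auto simp: fun_eq_iff)
    have "pmf (Pi_pmf I (\<lambda>_. d) (\<lambda>_. Pi_pmf J d (\<lambda>_. p))) (curry f) = (\<Prod>i\<in>I. pmf (Pi_pmf J d (\<lambda>_. p)) (curry f i))"
      by (rule pmf_Pi'[OF assms(1)]) (use o in auto)
    also have "\<dots> = (\<Prod>i\<in>I. \<Prod>j\<in>J. pmf p (curry f i j))"
      by (intro prod.cong refl pmf_Pi'[OF assms(2)]) (use inn in auto)
    also have "\<dots> = (\<Prod>x\<in>I \<times> J. pmf p (f x))" by (simp add: prod.cartesian_product split_def)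
    also have "\<dots> = pmf (Pi_pmf (I \<times> J) d (\<lambda>_. p)) f"
      by (rule pmf_Pi'[symmetric]) (use True assms in auto)
    finally show ?thesis .
  next
    case False
    then obtain i j where ij: "(i, j) \<notin> I \<times> J" "f (i, j) \<noteq> d" by auto
    have "pmf (Pi_pmf I (\<lambda>_. d) (\<lambda>_. Pi_pmf J d (\<lambda>_. p))) (curry f) = 0"
    proof (cases "i \<in> I")
      case True
      then have "pmf (Pi_pmf J d (\<lambda>_. p)) (curry f i) = 0" using ij assms by (intro pmf_Pi_outside) auto
      then have "(\<Prod>i\<in>I. pmf (Pi_pmf J d (\<lambda>_. p)) (curry f i)) = 0" using True assms(1) by (auto intro: bexI[of _ i])
      then show ?thesis unfolding pmf_Pi[OF assms(1)] by simp
    next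
      case False
      then have "curry f i \<noteq> (\<lambda>_. d)" using ij by (auto simp: fun_eq_iff)
      then show ?thesis using False assms by (intro pmf_Pi_outside) auto
    qed
    moreover have "pmf (Pi_pmf (I \<times> J) d (\<lambda>_. p)) f = 0"
      using ij assms by (intro pmf_Pi_outside) auto
    ultimately show ?thesis by simp
  qed
  finally show "pmf (Pi_pmf (I \<times> J) d (\<lambda>_. p)) f =
      pmf (map_pmf case_prod (Pi_pmf I (\<lambda>_. d) (\<lambda>_. Pi_pmf J d (\<lambda>_. p)))) f" by simp
qed

abbreviation mat_of_rows_fun :: "nat \<Rightarrow> nat \<Rightarrow> (nat \<Rightarrow> nat \<Rightarrow> real) \<Rightarrow> real Matrix.mat" where
  "mat_of_rows_fun m n g \<equiv> Matrix.mat m n (case_prod g)"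

lemma random_sign_matrix_eq:
  "random_sign_matrix m n = distr (sign_rows m n (1 / sqrt (real m))) (mat_borel m n) (mat_of_rows_fun m n)"
proof -
  have "Pi_pmf ({..<m} \<times> {..<n}) 0 (\<lambda>_. pmf_of_set {- 1 / sqrt (real m), 1 / sqrt (real m)})
      = map_pmf case_prod (sign_rows m n (1 / sqrt (real m)))"
    unfolding sign_rows_def sign_row_def using Pi_pmf_Times[of "{..<m}" "{..<n}" "0 :: real"] by simp
  moreover have "Matrix.mat m n \<in> measurable (count_space UNIV) (mat_borel m n)"
    by (auto simp: measurable_def)
  ultimately show ?thesis
    unfolding random_sign_matrix_def by (simp add: map_pmf_rep_eq distr_distr o_def)
qed

lemma measurable_mat_of_rows_fun: "mat_of_rows_fun m n \<in> measurable (measure_pmf p) (mat_borel m n)"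
  by (auto simp: measurable_def)

lemma measure_random_sign_matrix:
  assumes "E \<in> sets (mat_borel m n)"
  shows "measure (random_sign_matrix m n) E = measure_pmf.prob (sign_rows m n (1 / sqrt (real m))) {g. mat_of_rows_fun m n g \<in> E}"
  unfolding random_sign_matrix_eq
  by (subst measure_distr[OF measurable_mat_of_rows_fun assms]) (simp add: vimage_def)

lemma isotropic_columns_random_sign_matrix:
  assumes m: "m > 0"
  shows "isotropic_columns n (random_sign_matrix m n)"
  unfolding isotropic_columns_def
proof (intro allI impI)
  fix i j assume ij: "i < n" "j < n"
  let ?a = "1 / sqrt (real m)"
  have a: "?a > 0" using m by simp
  have eq: "scalar_prod (col S i) (col S j) = (\<Sum>r<m. S $$ (r, i) * S $$ (r, j))" if "S \<in> carrier_mat m n" for S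
    using that ij by (auto simp: scalar_prod_def lessThan_atLeast0)
  have "(\<lambda>S. \<Sum>r<m. S $$ (r, i) * S $$ (r, j)) \<in> borel_measurable (mat_borel m n)"
    using ij by (intro borel_measurable_sum borel_measurable_times measurable_entry_mat_borel) auto
  then have meas: "(\<lambda>S. scalar_prod (col S i) (col S j)) \<in> borel_measurable (mat_borel m n)"
    by (subst measurable_cong[OF eq]) auto
  have row: "measure_pmf.expectation (sign_rows m n ?a) (\<lambda>g. g r i * g r j) = ?a\<^sup>2 * (if i = j then 1 else 0)" if "r < m" for r
  proof -
    have "measure_pmf.expectation (sign_rows m n ?a) (\<lambda>g. g r i * g r j) =
        measure_pmf.expectation (map_pmf (\<lambda>g. g r) (sign_rows m n ?a)) (\<lambda>h. h i * h j)" by simp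
    also have "map_pmf (\<lambda>g. g r) (sign_rows m n ?a) = sign_row n ?a"
      unfolding sign_rows_def using that by (subst Pi_pmf_component) auto
    also have "measure_pmf.expectation (sign_row n ?a) (\<lambda>h. h i * h j) = ?a\<^sup>2 * (if i = j then 1 else 0)"
      using sign_row_covariance[OF a, of n "\<lambda>l. if l = i then 1 else 0" "\<lambda>l. if l = j then 1 else 0"] ij
      by (simp add: if_distrib[of "\<lambda>x. x * _"] cong: if_cong)
    finally show ?thesis .
  qed
  have "(\<integral>S. scalar_prod (col S i) (col S j) \<partial>random_sign_matrix m n) =
      measure_pmf.expectation (sign_rows m n ?a) (\<lambda>g. scalar_prod (col (mat_of_rows_fun m n g) i) (col (mat_of_rows_fun m n g) j))"
    unfolding random_sign_matrix_eq by (rule integral_distr[OF measurable_mat_of_rows_fun meas])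
  also have "\<dots> = measure_pmf.expectation (sign_rows m n ?a) (\<lambda>g. \<Sum>r<m. g r i * g r j)"
    using ij by (subst eq) auto
  also have "\<dots> = (\<Sum>r<m. ?a\<^sup>2 * (if i = j then 1 else 0))"
    by (simp add: Bochner_Integration.integral_sum row)
  also have "\<dots> = (if i = j then 1 else 0)" using m by (simp add: power_divide)
  finally show "(\<integral>S. scalar_prod (col S i) (col S j) \<partial>random_sign_matrix m n) = (if i = j then 1 else 0)" .
qed

text \<open>Markov's inequality for the moment of order \<open>2 q\<close> with both vectors equal
  to \<open>u\<close>. Strictness makes the event empty for \<open>u = 0\<close>, which matters
  because the grid contains the origin.\<close>

lemma sign_rows_norm_tail:
  assumes m: "m > 0" and q: "1 \<le> q" "q \<le> m" and t: "t > 0"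
  shows "measure_pmf.prob (sign_rows m n (1 / sqrt (real m)))
      {g. t * (\<Sum>j<n. (u j)\<^sup>2) < \<bar>(\<Sum>i<m. (\<Sum>j<n. u j * g i j)\<^sup>2) - (\<Sum>j<n. (u j)\<^sup>2)\<bar>}
    \<le> 2 * (82944 * real q / (real m * t\<^sup>2)) ^ q"
proof -
  let ?p = "sign_rows m n (1 / sqrt (real m))"
  let ?Z = "\<lambda>g. (\<Sum>i<m. (\<Sum>j<n. u j * g i j)\<^sup>2) - (\<Sum>j<n. (u j)\<^sup>2)"
  define s where "s = (\<Sum>j<n. (u j)\<^sup>2)"
  have mom: "measure_pmf.expectation ?p (\<lambda>g. ?Z g ^ (2 * q)) \<le> 2 * (82944 * real q / real m) ^ q * (s * s) ^ q"
    using sign_rows_moment[OF m q, of n u u] by (simp add: s_def power2_eq_square)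
  have s0: "s \<ge> 0" by (simp add: s_def sum_nonneg)
  show ?thesis
  proof (cases "s = 0")
    case True
    then have "u j = 0" if "j < n" for j using that by (simp add: s_def sum_nonneg_eq_0_iff)
    then have "{g. t * (\<Sum>j<n. (u j)\<^sup>2) < \<bar>?Z g\<bar>} = {}" by simp
    then show ?thesis by (simp only: measure_empty) simp
  next
    case False
    then have s: "s > 0" using s0 by simp
    then have pos: "(t * s) ^ (2 * q) > 0" using t by simp
    have "measure_pmf.prob ?p {g. t * s < \<bar>?Z g\<bar>} \<le> measure_pmf.prob ?p {g. (t * s) ^ (2 * q) \<le> ?Z g ^ (2 * q)}"
    proof (intro measure_pmf.finite_measure_mono subsetI CollectI)
      fix g assume "g \<in> {g. t * s < \<bar>?Z g\<bar>}"
      then have "(t * s) ^ (2 * q) \<le> \<bar>?Z g\<bar> ^ (2 * q)" using s t by (intro power_mono) auto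
      then show "(t * s) ^ (2 * q) \<le> ?Z g ^ (2 * q)" by (simp add: power_even_abs)
    qed simp
    also have "\<dots> \<le> measure_pmf.expectation ?p (\<lambda>g. ?Z g ^ (2 * q)) / (t * s) ^ (2 * q)"
      using integral_Markov_inequality_measure[of ?p "\<lambda>g. ?Z g ^ (2 * q)" "{}" "(t * s) ^ (2 * q)"] pos
      by simp
    also have "\<dots> \<le> 2 * (82944 * real q / real m) ^ q * (s * s) ^ q / (t * s) ^ (2 * q)"
      using mom pos by (intro divide_right_mono) auto
    also have "\<dots> = 2 * (82944 * real q / (real m * t\<^sup>2)) ^ q"
      using s unfolding power_mult power_mult_distrib[of t s] power_mult_distrib[of "t\<^sup>2"] power2_eq_square[of s]
      by (simp add: power_divide power_mult_distrib)
    finally show ?thesis by (simp add: s_def)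
  qed
qed

section \<open>The matrix product property of random signs\<close>

lemma convex_sum_power_le:
  fixes w y :: "'a \<Rightarrow> real"
  assumes "finite I" "\<And>i. i \<in> I \<Longrightarrow> w i \<ge> 0" "\<And>i. i \<in> I \<Longrightarrow> y i \<ge> 0" "(\<Sum>i\<in>I. w i) = 1"
  shows "(\<Sum>i\<in>I. w i * y i) ^ q \<le> (\<Sum>i\<in>I. w i * y i ^ q)"
proof -
  have "convex_on {0..} (\<lambda>x::real. x ^ q)"
    using convex_on_subset[OF convex_power_even[of q] subset_UNIV] convex_power_odd[of q] by blast
  moreover have "I \<noteq> {}" using assms(4) by auto
  ultimately show ?thesis
    using convex_on_sum[of I "{0..}" "\<lambda>x. x ^ q" w y] assms by auto
qed

text \<open>The Frobenius error is \<open>\<Sum> Z\<^sub>x\<^sup>2\<close> over pairs of columns. Normalizing each \<open>Z\<^sub>x\<close> by its scale \<open>w\<^sub>x\<close>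
  makes this a convex combination, so Jensen reduces its moments to those of single entries.\<close>

lemma weighted_moment_tail:
  fixes Z :: "'a \<Rightarrow> 'b \<Rightarrow> real"
  assumes fin: "finite (set_pmf p)" and I: "finite I" and w: "\<And>x. x \<in> I \<Longrightarrow> w x \<ge> 0" and T: "(\<Sum>x\<in>I. w x) > 0"
    and b: "b \<ge> 0" and q: "q \<ge> 1" and \<eta>: "\<eta> > 0"
    and mom: "\<And>x. x \<in> I \<Longrightarrow> measure_pmf.expectation p (\<lambda>g. Z x g ^ (2 * q)) \<le> b * w x ^ q"
  shows "measure_pmf.prob p {g. \<eta>\<^sup>2 * (\<Sum>x\<in>I. w x) \<le> (\<Sum>x\<in>I. (Z x g)\<^sup>2)} \<le> b / (\<eta>\<^sup>2) ^ q"
proof -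
  have int: "integrable (measure_pmf p) (f :: _ \<Rightarrow> real)" for f by (rule integrable_measure_pmf_finite[OF fin])
  define T where "T = (\<Sum>x\<in>I. w x)"
  have T0: "T > 0" using T by (simp add: T_def)
  \<comment> \<open>Division by a weight 0 would silently drop the term of that index. Nothing is
    lost, because its moment is then 0 and \<open>Z x\<close> vanishes on the support.\<close>
  have zero: "Z x g = 0" if "x \<in> I" "w x = 0" "g \<in> set_pmf p" for x g
  proof -
    have "measure_pmf.expectation p (\<lambda>g. Z x g ^ (2 * q)) \<le> 0" using mom[OF that(1)] that(2) q by (simp add: power_0_left)
    then have "measure_pmf.expectation p (\<lambda>g. Z x g ^ (2 * q)) = 0"
      by (intro antisym Bochner_Integration.integral_nonneg) (simp_all add: power_mult)
    then have "AE g in measure_pmf p. Z x g ^ (2 * q) = 0"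
      using int by (subst (asm) integral_nonneg_eq_0_iff_AE) (simp_all add: power_mult)
    then show ?thesis using that(3) by (auto simp: AE_measure_pmf_iff)
  qed
  define V where "V g = (\<Sum>x\<in>I. w x / T * ((Z x g)\<^sup>2 / w x) ^ q)" for g
  have V0: "V g \<ge> 0" for g using w T0 unfolding V_def by (intro sum_nonneg) auto
  have "measure_pmf.expectation p V = (\<Sum>x\<in>I. w x / T * measure_pmf.expectation p (\<lambda>g. ((Z x g)\<^sup>2 / w x) ^ q))"
    unfolding V_def by (simp add: Bochner_Integration.integral_sum int)
  also have "\<dots> \<le> (\<Sum>x\<in>I. w x / T * b)"
  proof (intro sum_mono mult_left_mono)
    fix x assume x: "x \<in> I"
    have "measure_pmf.expectation p (\<lambda>g. ((Z x g)\<^sup>2 / w x) ^ q) = measure_pmf.expectation p (\<lambda>g. Z x g ^ (2 * q)) / w x ^ q"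
      by (simp add: power_divide power_mult)
    also have "\<dots> \<le> b"
    proof (cases "w x = 0")
      case False
      then show ?thesis using mom[OF x] w[OF x] by (simp add: divide_le_eq)
    qed (use b q in \<open>simp add: power_0_left\<close>)
    finally show "measure_pmf.expectation p (\<lambda>g. ((Z x g)\<^sup>2 / w x) ^ q) \<le> b" .
  qed (use w T0 in auto)
  also have "\<dots> = b" using T0 by (simp add: T_def flip: sum_distrib_right sum_divide_distrib)
  finally have EV: "measure_pmf.expectation p V \<le> b" .
  have sub: "(\<eta>\<^sup>2) ^ q \<le> V g" if g: "g \<in> set_pmf p" and *: "\<eta>\<^sup>2 * T \<le> (\<Sum>x\<in>I. (Z x g)\<^sup>2)" for g
  proof -
    have "\<eta>\<^sup>2 \<le> (\<Sum>x\<in>I. (Z x g)\<^sup>2) / T" using * T0 by (simp add: pos_le_divide_eq)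
    also have "\<dots> = (\<Sum>x\<in>I. w x / T * ((Z x g)\<^sup>2 / w x))"
      unfolding sum_divide_distrib using zero[OF _ _ g] by (intro sum.cong refl) auto
    finally have "(\<eta>\<^sup>2) ^ q \<le> (\<Sum>x\<in>I. w x / T * ((Z x g)\<^sup>2 / w x)) ^ q" by (intro power_mono) auto
    also have "\<dots> \<le> V g"
      unfolding V_def using w T0 I by (intro convex_sum_power_le) (auto simp: T_def simp flip: sum_divide_distrib)
    finally show ?thesis .
  qed
  have "measure_pmf.prob p {g. \<eta>\<^sup>2 * T \<le> (\<Sum>x\<in>I. (Z x g)\<^sup>2)} \<le> measure_pmf.prob p {g. (\<eta>\<^sup>2) ^ q \<le> V g}"
    by (rule measure_pmf.finite_measure_mono_AE) (use sub in \<open>auto simp: AE_measure_pmf_iff\<close>)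
  also have "\<dots> \<le> measure_pmf.expectation p V / (\<eta>\<^sup>2) ^ q"
    using integral_Markov_inequality_measure[of p V "{}" "(\<eta>\<^sup>2) ^ q"] int V0 \<eta> by simp
  also have "\<dots> \<le> b / (\<eta>\<^sup>2) ^ q" using EV by (intro divide_right_mono) auto
  finally show ?thesis by (simp add: T_def)
qed

lemma approx_matrix_product_random_sign_matrix:
  assumes m: "m > 0" and q: "1 \<le> q" "q \<le> m" and \<eta>: "\<eta> > 0"
    and \<delta>: "2 * (82944 * real q / (real m * \<eta>\<^sup>2)) ^ q \<le> \<delta>"
  shows "approx_matrix_product n \<eta> \<delta> (random_sign_matrix m n)"
  unfolding approx_matrix_product_def
proof (intro allI impI)
  fix a b and C D :: "real Matrix.mat"
  assume C: "C \<in> carrier_mat n a" and D: "D \<in> carrier_mat n b" and nz: "C \<noteq> 0\<^sub>m n a" "D \<noteq> 0\<^sub>m n b"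
  let ?p = "sign_rows m n (1 / sqrt (real m))"
  let ?err = "\<lambda>S. frob_norm (transpose_mat C * transpose_mat S * S * D - transpose_mat C * D)"
  let ?I = "{..<a} \<times> {..<b}"
  define Z where "Z x g = (\<Sum>r<m. (\<Sum>l<n. C $$ (l, fst x) * g r l) * (\<Sum>l<n. D $$ (l, snd x) * g r l)) -
      (\<Sum>l<n. C $$ (l, fst x) * D $$ (l, snd x))" for x g
  \<comment> \<open>The scale of an entry is the product of the squared lengths of a column of
    \<open>C\<close> and a column of \<open>D\<close>; summed over all pairs it factors into the
    squared Frobenius norms.\<close>
  define w where "w x = (\<Sum>l<n. (C $$ (l, fst x))\<^sup>2) * (\<Sum>l<n. (D $$ (l, snd x))\<^sup>2)" for x
  have P: "matrix_distribution m n (random_sign_matrix m n)" by (rule matrix_distribution_random_sign_matrix)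
  have sum_w: "(\<Sum>x\<in>?I. w x) = (frob_norm C)\<^sup>2 * (frob_norm D)\<^sup>2"
  proof -
    define f where "f X j = (\<Sum>l<n. (X $$ (l, j))\<^sup>2)" for X :: "real Matrix.mat" and j
    have frob: "(frob_norm X)\<^sup>2 = (\<Sum>j<c. f X j)" if "X \<in> carrier_mat n c" for X c
      using that unfolding frob_norm_sq f_def by (subst sum.swap) auto
    show ?thesis
      unfolding frob[OF C] frob[OF D] sum_product sum.cartesian_product w_def f_def[symmetric]
      by (simp add: split_def)
  qed
  have err: "(?err (mat_of_rows_fun m n g))\<^sup>2 = (\<Sum>x\<in>?I. (Z x g)\<^sup>2)" for g
  proof -
    define S where "S = mat_of_rows_fun m n g"
    have S: "S \<in> carrier_mat m n" by (simp add: S_def)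
    have CT: "transpose_mat C \<in> carrier_mat a n" and ST: "transpose_mat S \<in> carrier_mat n m" using C S by auto
    have SC: "S * C \<in> carrier_mat m a" and SD: "S * D \<in> carrier_mat m b" using S C D by auto
    have eq: "transpose_mat C * transpose_mat S * S * D = transpose_mat (S * C) * (S * D)"
      unfolding assoc_mult_mat[OF mult_carrier_mat[OF CT ST] S D] unfolding transpose_mult[OF S C] ..
    have ent: "(transpose_mat (S * C) * (S * D) - transpose_mat C * D) $$ (i, j) = Z (i, j) g" if "i < a" "j < b" for i j
    proof -
      have SCe: "(S * C) $$ (r, i) = (\<Sum>l<n. C $$ (l, i) * g r l)" if "r < m" for r
        using S C that \<open>i < a\<close> by (simp add: scalar_prod_def lessThan_atLeast0 S_def mult.commute)
      have SDe: "(S * D) $$ (r, j) = (\<Sum>l<n. D $$ (l, j) * g r l)" if "r < m" for r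
        using S D that \<open>j < b\<close> by (simp add: scalar_prod_def lessThan_atLeast0 S_def mult.commute)
      have "(transpose_mat (S * C) * (S * D)) $$ (i, j) = (\<Sum>r<m. (S * C) $$ (r, i) * (S * D) $$ (r, j))"
        using carrier_matD[OF SC] carrier_matD[OF SD] that
        by (simp add: scalar_prod_def lessThan_atLeast0 del: index_mult_mat(2,3) transpose_mult)
      moreover have "(transpose_mat C * D) $$ (i, j) = (\<Sum>l<n. C $$ (l, i) * D $$ (l, j))"
        using C D that by (simp add: scalar_prod_def lessThan_atLeast0)
      ultimately show ?thesis using C D SC SD that by (simp add: Z_def SCe SDe)
    qed
    have "transpose_mat (S * C) * (S * D) - transpose_mat C * D \<in> carrier_mat a b"
      using CT D by (intro minus_carrier_mat) auto
    then show ?thesis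
      unfolding frob_norm_sq S_def[symmetric] eq by (simp add: ent sum.cartesian_product split_def del: index_minus_mat)
  qed
  have mom: "measure_pmf.expectation ?p (\<lambda>g. Z x g ^ (2 * q)) \<le> 2 * (82944 * real q / real m) ^ q * w x ^ q" for x
    unfolding Z_def w_def by (rule sign_rows_moment[OF m q])
  have "frob_norm C > 0" "frob_norm D > 0" using frob_norm_pos C D nz by auto
  then have T: "(\<Sum>x\<in>?I. w x) > 0" unfolding sum_w by simp
  have sets: "{S \<in> space (random_sign_matrix m n). \<eta> * frob_norm C * frob_norm D \<le> ?err S} \<in> sets (mat_borel m n)"
    using sets_approx_matrix_product_bad(2)[OF P C D] matrix_distributionD(2)[OF P] by simp
  have "measure (random_sign_matrix m n) {S \<in> space (random_sign_matrix m n). \<eta> * frob_norm C * frob_norm D \<le> ?err S} =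
      measure_pmf.prob ?p {g. \<eta> * frob_norm C * frob_norm D \<le> ?err (mat_of_rows_fun m n g)}"
    unfolding measure_random_sign_matrix[OF sets] using matrix_distributionD(3)[OF P] by simp
  also have "\<dots> \<le> measure_pmf.prob ?p {g. \<eta>\<^sup>2 * (\<Sum>x\<in>?I. w x) \<le> (\<Sum>x\<in>?I. (Z x g)\<^sup>2)}"
  proof (intro measure_pmf.finite_measure_mono subsetI CollectI)
    fix g assume "g \<in> {g. \<eta> * frob_norm C * frob_norm D \<le> ?err (mat_of_rows_fun m n g)}"
    then have "(\<eta> * frob_norm C * frob_norm D)\<^sup>2 \<le> (?err (mat_of_rows_fun m n g))\<^sup>2"
      using \<eta> by (intro power_mono) auto
    then show "\<eta>\<^sup>2 * (\<Sum>x\<in>?I. w x) \<le> (\<Sum>x\<in>?I. (Z x g)\<^sup>2)"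
      unfolding err sum_w by (simp add: power_mult_distrib)
  qed simp
  also have "\<dots> \<le> 2 * (82944 * real q / real m) ^ q / (\<eta>\<^sup>2) ^ q"
    by (rule weighted_moment_tail[OF finite_set_sign_rows _ _ T _ q(1) \<eta> mom])
       (auto simp: w_def intro!: mult_nonneg_nonneg sum_nonneg)
  also have "\<dots> = 2 * (82944 * real q / (real m * \<eta>\<^sup>2)) ^ q" by (simp add: power_divide power_mult_distrib)
  also note \<delta>
  finally show "measure (random_sign_matrix m n) {S \<in> space (random_sign_matrix m n). \<eta> * frob_norm C * frob_norm D \<le> ?err S} \<le> \<delta>" .
qed

section \<open>The subspace embedding property of random signs\<close>

lemma sets_subspace_embedding:
  assumes "A \<in> carrier_mat n d"
  shows "{S \<in> carrier_mat m n. subspace_embedding \<gamma> S A} \<in> sets (mat_borel m n)"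
proof (rule closed_imp_sets_mat_borel)
  have c: "continuous_on UNIV (\<lambda>f. l2_norm (Matrix.mat m n f *\<^sub>v y))" if "dim_vec y = n" for y
  proof -
    have "l2_norm (Matrix.mat m n f *\<^sub>v y) = sqrt (\<Sum>i<m. (\<Sum>j<n. f (i, j) * y $ j)\<^sup>2)" for f
      using that by (simp add: l2_norm_def scalar_prod_def lessThan_atLeast0)
    then show ?thesis by (auto intro!: continuous_intros continuous_on_product_coordinates)
  qed
  \<comment> \<open>The intersection is uncountable, which is harmless because each condition is
    closed in the entries of \<open>S\<close>.\<close>
  have "{f. subspace_embedding \<gamma> (Matrix.mat m n f) A} = (\<Inter>x\<in>carrier_vec (dim_col A).
      {f. (1 - \<gamma>) * l2_norm (A *\<^sub>v x) \<le> l2_norm (Matrix.mat m n f *\<^sub>v (A *\<^sub>v x))} \<inter>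
      {f. l2_norm (Matrix.mat m n f *\<^sub>v (A *\<^sub>v x)) \<le> (1 + \<gamma>) * l2_norm (A *\<^sub>v x)})"
    unfolding subspace_embedding_def by blast
  then show "closed {f. subspace_embedding \<gamma> (Matrix.mat m n f) A}"
    using assms by (auto intro!: closed_INT closed_Int closed_Collect_le c continuous_on_const)
qed

text \<open>In coordinates with respect to \<open>U\<close> the column space is isometric to
  \<open>r\<close>-dimensional space, so the net is exponential in \<open>r \<le> k\<close> and
  independent of \<open>n\<close> and \<open>d\<close>. The factor 256 in the hypothesis is
  \<open>1 / t^2\<close> for the tolerance \<open>t = 1/16\<close> on squared norms.\<close>

lemma subspace_embedding_random_sign_matrix:
  assumes m: "m > 0" and q: "1 \<le> q" "q \<le> m" and A: "A \<in> carrier_mat n d" and rank: "vec_space.rank n A \<le> k"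
    and \<delta>: "2 * (2 ^ 19) ^ k * (82944 * 256 * real q / real m) ^ q \<le> \<delta>"
  shows "measure (random_sign_matrix m n) {S \<in> space (random_sign_matrix m n). subspace_embedding (1 / 3) S A} \<ge> 1 - \<delta>"
proof -
  let ?p = "sign_rows m n (1 / sqrt (real m))"
  have P: "matrix_distribution m n (random_sign_matrix m n)" by (rule matrix_distribution_random_sign_matrix)
  obtain r U where r: "r \<le> vec_space.rank n A" and U: "U \<in> carrier_mat n r" and UU: "transpose_mat U * U = 1\<^sub>m r"
    and AU: "A = U * (transpose_mat U * A)"
    using orthonormal_column_space_basis[OF A] by blast
  define lift where "lift x j = (\<Sum>i<r. U $$ (j, i) * x i)" for x :: "nat \<Rightarrow> real" and j
  have dotU: "(\<Sum>l<n. U $$ (l, i) * U $$ (l, j)) = (if i = j then 1 else 0)" if "i < r" "j < r" for i j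
  proof -
    have "(transpose_mat U * U) $$ (i, j) = (\<Sum>l<n. U $$ (l, i) * U $$ (l, j))"
      using U that by (simp add: scalar_prod_def lessThan_atLeast0)
    then show ?thesis using UU that by simp
  qed
  have lift_norm: "(\<Sum>j<n. (lift x j)\<^sup>2) = (L2_set x {..<r})\<^sup>2" for x
  proof -
    have "(\<Sum>l<n. (lift x l)\<^sup>2) = (\<Sum>l<n. \<Sum>i<r. \<Sum>j<r. x i * x j * (U $$ (l, i) * U $$ (l, j)))"
      by (simp add: lift_def power2_eq_square sum_product mult_ac)
    also have "\<dots> = (\<Sum>i<r. \<Sum>l<n. \<Sum>j<r. x i * x j * (U $$ (l, i) * U $$ (l, j)))" by (rule sum.swap)
    also have "\<dots> = (\<Sum>i<r. \<Sum>j<r. \<Sum>l<n. x i * x j * (U $$ (l, i) * U $$ (l, j)))"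
      by (intro sum.cong refl sum.swap)
    also have "\<dots> = (\<Sum>i<r. \<Sum>j<r. x i * x j * (if i = j then 1 else 0))"
      by (intro sum.cong refl) (simp add: dotU flip: sum_distrib_left)
    also have "\<dots> = (L2_set x {..<r})\<^sup>2"
      by (simp add: if_distrib[of "\<lambda>x. _ * x"] L2_set_def sum_nonneg cong: if_cong) (simp add: power2_eq_square)
    finally show ?thesis .
  qed
  define pt where "pt p i = real_of_int (p i) / (16 * sqrt (real r))" for p :: "nat \<Rightarrow> int" and i
  define bad where "bad p = {g. 1 / 16 * (\<Sum>j<n. (lift (pt p) j)\<^sup>2) <
      \<bar>(\<Sum>i<m. (\<Sum>j<n. lift (pt p) j * g i j)\<^sup>2) - (\<Sum>j<n. (lift (pt p) j)\<^sup>2)\<bar>}" for p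
  have emb: "subspace_embedding (1 / 3) (mat_of_rows_fun m n g) A" if good: "g \<notin> (\<Union>p\<in>grid r. bad p)" for g
  proof -
    define F where "F x = L2_set (\<lambda>i. \<Sum>j<n. lift x j * g i j) {..<m}" for x
    have F_sq: "(F x)\<^sup>2 = (\<Sum>i<m. (\<Sum>j<n. lift x j * g i j)\<^sup>2)" for x
      by (simp add: F_def L2_set_def sum_nonneg)
    have F0: "F x \<ge> 0" for x by (simp add: F_def L2_set_nonneg)
    have tri: "F (\<lambda>i. x i + y i) \<le> F x + F y" for x y
    proof -
      have "F (\<lambda>i. x i + y i) = L2_set (\<lambda>i. (\<Sum>j<n. lift x j * g i j) + (\<Sum>j<n. lift y j * g i j)) {..<m}"
        by (simp add: F_def lift_def distrib_left distrib_right sum.distrib)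
      also have "\<dots> \<le> F x + F y" unfolding F_def by (rule L2_set_triangle_ineq)
      finally show ?thesis .
    qed
    have hom: "F (\<lambda>i. s * x i) = \<bar>s\<bar> * F x" for s x
    proof -
      have "lift (\<lambda>i. s * x i) j = s * lift x j" for j by (simp add: lift_def sum_distrib_left mult_ac)
      then have "F (\<lambda>i. s * x i) = L2_set (\<lambda>i. s * (\<Sum>j<n. lift x j * g i j)) {..<m}"
        by (simp add: F_def sum_distrib_left mult.assoc)
      also have "\<dots> = \<bar>s\<bar> * F x"
        by (simp add: F_def L2_set_def power_mult_distrib real_sqrt_mult flip: sum_distrib_left)
      finally show ?thesis .
    qed
    \<comment> \<open>The Frobenius norm of \<open>S\<close> as a crude operator bound: it secures
      the finite supremum in \<open>grid_embedding\<close>, and its size does not affect the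
      constants.\<close>
    define M where "M = L2_set (\<lambda>i. L2_set (g i) {..<n}) {..<m}"
    have bound: "F x \<le> M * L2_set x {..<r}" for x
    proof -
      have lift_L2: "L2_set (lift x) {..<n} = L2_set x {..<r}"
        using lift_norm[of x] by (simp add: L2_set_def sum_nonneg)
      have "\<bar>\<Sum>j<n. lift x j * g i j\<bar> \<le> L2_set x {..<r} * L2_set (g i) {..<n}" for i
        using sum_abs[of "\<lambda>j. lift x j * g i j" "{..<n}"] L2_set_mult_ineq[of "lift x" "g i" "{..<n}"]
        by (simp add: abs_mult lift_L2)
      then have "L2_set (\<lambda>i. \<bar>\<Sum>j<n. lift x j * g i j\<bar>) {..<m} \<le> L2_set (\<lambda>i. L2_set x {..<r} * L2_set (g i) {..<n}) {..<m}"
        by (intro L2_set_mono) auto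
      also have "\<dots> = L2_set x {..<r} * M" unfolding M_def by (rule L2_set_right_distrib[symmetric]) (rule L2_set_nonneg)
      finally show ?thesis by (simp add: F_def L2_set_def mult.commute)
    qed
    have grid: "15 / 16 * L2_set (pt p) {..<r} \<le> F (pt p) \<and> F (pt p) \<le> 17 / 16 * L2_set (pt p) {..<r}"
      if "p \<in> grid r" for p
    proof -
      let ?N = "L2_set (pt p) {..<r}"
      have "\<bar>(F (pt p))\<^sup>2 - ?N\<^sup>2\<bar> \<le> 1 / 16 * ?N\<^sup>2"
        using good that by (auto simp: bad_def F_sq lift_norm not_less)
      \<comment> \<open>Tolerance 1/16 for the squares implies tolerance 1/16 for the norms, as
        \<open>(15/16)^2 \<le> 15/16\<close> and \<open>17/16 \<le> (17/16)^2\<close>.\<close>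
      then have "225 / 256 * ?N\<^sup>2 \<le> (F (pt p))\<^sup>2 \<and> (F (pt p))\<^sup>2 \<le> 289 / 256 * ?N\<^sup>2"
        using zero_le_power2[of ?N] unfolding abs_le_iff by (auto simp: algebra_simps)
      then have "(15 / 16)\<^sup>2 * ?N\<^sup>2 \<le> (F (pt p))\<^sup>2" "(F (pt p))\<^sup>2 \<le> (17 / 16)\<^sup>2 * ?N\<^sup>2"
        by (simp_all add: power_divide)
      then have "(15 / 16 * ?N)\<^sup>2 \<le> (F (pt p))\<^sup>2" "(F (pt p))\<^sup>2 \<le> (17 / 16 * ?N)\<^sup>2"
        by (simp_all only: power_mult_distrib)
      then show ?thesis using F0 L2_set_nonneg by (auto intro!: power2_le_imp_le)
    qed
    have iso: "2 / 3 * L2_set x {..<r} \<le> F x" "F x \<le> 4 / 3 * L2_set x {..<r}" for x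
      using grid_embedding[of F M r x, OF tri hom bound] grid unfolding pt_def by auto
    show ?thesis
      unfolding subspace_embedding_def
    proof
      fix x :: "real Matrix.vec" assume "x \<in> carrier_vec (dim_col A)"
      then have x: "x \<in> carrier_vec d" using A by simp
      define y where "y = A *\<^sub>v x"
      define c where "c = (transpose_mat U * A) *\<^sub>v x"
      have c: "c \<in> carrier_vec r" using U A x by (auto simp: c_def)
      have yc: "y = U *\<^sub>v c"
      proof -
        have "y = (U * (transpose_mat U * A)) *\<^sub>v x" unfolding y_def using AU by simp
        also have "\<dots> = U *\<^sub>v c" unfolding c_def by (rule assoc_mult_mat_vec[OF U _ x]) (use U A in auto)
        finally show ?thesis .
      qed
      have y: "y \<in> carrier_vec n" using yc U c by auto
      have lift_c: "lift (\<lambda>i. c $ i) j = y $ j" if "j < n" for j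
        unfolding yc lift_def using U c that by (simp add: scalar_prod_def lessThan_atLeast0)
      have "(\<Sum>j<n. (lift (\<lambda>i. c $ i) j)\<^sup>2) = (\<Sum>j<n. (y $ j)\<^sup>2)" by (intro sum.cong) (auto simp: lift_c)
      then have "(l2_norm y)\<^sup>2 = (L2_set (\<lambda>i. c $ i) {..<r})\<^sup>2"
        using y lift_norm[of "\<lambda>i. c $ i"] by (simp add: l2_norm_sq)
      then have ny: "l2_norm y = L2_set (\<lambda>i. c $ i) {..<r}"
        by (rule power2_eq_imp_eq) (auto simp: L2_set_nonneg)
      have "(mat_of_rows_fun m n g *\<^sub>v y) $ i = (\<Sum>j<n. lift (\<lambda>i. c $ i) j * g i j)" if "i < m" for i
      proof -
        have "(mat_of_rows_fun m n g *\<^sub>v y) $ i = (\<Sum>j<n. y $ j * g i j)"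
          using that y by (simp add: scalar_prod_def lessThan_atLeast0 mult.commute)
        also have "\<dots> = (\<Sum>j<n. lift (\<lambda>i. c $ i) j * g i j)" by (intro sum.cong) (auto simp: lift_c)
        finally show ?thesis .
      qed
      then have nSy: "l2_norm (mat_of_rows_fun m n g *\<^sub>v y) = F (\<lambda>i. c $ i)"
        by (simp add: l2_norm_def F_def L2_set_def del: index_mult_mat_vec)
      show "(1 - 1 / 3) * l2_norm (A *\<^sub>v x) \<le> l2_norm (mat_of_rows_fun m n g *\<^sub>v (A *\<^sub>v x)) \<and>
          l2_norm (mat_of_rows_fun m n g *\<^sub>v (A *\<^sub>v x)) \<le> (1 + 1 / 3) * l2_norm (A *\<^sub>v x)"
        using iso[of "\<lambda>i. c $ i"] unfolding y_def[symmetric] nSy ny by simp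
    qed
  qed
  let ?\<beta> = "2 * (82944 * 256 * real q / real m) ^ q"
  have "measure_pmf.prob ?p (\<Union>p\<in>grid r. bad p) \<le> (\<Sum>p\<in>grid r. measure_pmf.prob ?p (bad p))"
    by (rule measure_pmf.finite_measure_subadditive_finite) (auto simp: finite_grid)
  also have "\<dots> \<le> (\<Sum>p\<in>grid r. ?\<beta>)"
  proof (rule sum_mono)
    fix p assume "p \<in> grid r"
    have "measure_pmf.prob ?p (bad p) \<le> 2 * (82944 * real q / (real m * (1 / 16)\<^sup>2)) ^ q"
      unfolding bad_def by (rule sign_rows_norm_tail[OF m q]) simp
    also have "82944 * real q / (real m * (1 / 16)\<^sup>2) = 82944 * 256 * real q / real m"
      by (simp add: power2_eq_square)
    finally show "measure_pmf.prob ?p (bad p) \<le> ?\<beta>" .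
  qed
  also have "\<dots> = real (card (grid r)) * ?\<beta>" by simp
  also have "\<dots> \<le> (2 ^ 19) ^ k * ?\<beta>"
  proof (rule mult_right_mono)
    have "real (card (grid r)) \<le> (2 ^ 19) ^ r" by (rule card_grid_le)
    also have "\<dots> \<le> (2 ^ 19) ^ k" using r rank by (intro power_increasing) auto
    finally show "real (card (grid r)) \<le> (2 ^ 19) ^ k" .
  qed simp
  also have "\<dots> \<le> \<delta>" using \<delta> by (simp only: mult_ac)
  finally have bad: "measure_pmf.prob ?p (\<Union>p\<in>grid r. bad p) \<le> \<delta>" .
  have "1 - \<delta> \<le> 1 - measure_pmf.prob ?p (\<Union>p\<in>grid r. bad p)" using bad by simp
  also have "\<dots> = measure_pmf.prob ?p (- (\<Union>p\<in>grid r. bad p))"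
    using measure_pmf.prob_compl[of "\<Union>p\<in>grid r. bad p" ?p] by (simp add: Compl_eq_Diff_UNIV)
  also have "\<dots> \<le> measure_pmf.prob ?p {g. mat_of_rows_fun m n g \<in> {S \<in> carrier_mat m n. subspace_embedding (1 / 3) S A}}"
    by (intro measure_pmf.finite_measure_mono) (use emb in auto)
  also have "\<dots> = measure (random_sign_matrix m n) {S \<in> space (random_sign_matrix m n). subspace_embedding (1 / 3) S A}"
    using measure_random_sign_matrix[OF sets_subspace_embedding[OF A]] matrix_distributionD(3)[OF P] by simp
  finally show ?thesis .
qed

section \<open>Choice of the moment order and of the number of rows\<close>

lemma two_sixth_power_le:
  assumes "0 < \<delta>" "ln (1 / \<delta>) \<le> real l" "1 \<le> l"
  shows "2 * (1 / 6) ^ l \<le> \<delta>"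
proof -
  \<comment> \<open>The 6 is 2 * 3: one factor 1/2 absorbs the leading 2, while
    \<open>exp 1 \<le> 3\<close> turns \<open>(1/3)^l\<close> into
    \<open>exp (- l) \<le> \<delta>\<close>.\<close>
  have "(1 / 2 :: real) ^ l \<le> (1 / 2) ^ 1" using assms by (intro power_decreasing) auto
  then have "2 * (1 / 2 :: real) ^ l * (1 / 3) ^ l \<le> 1 * (1 / 3) ^ l" by (intro mult_right_mono) auto
  moreover have "(1 / 6 :: real) ^ l = (1 / 2) ^ l * (1 / 3) ^ l" by (simp flip: power_mult_distrib)
  ultimately have "2 * (1 / 6 :: real) ^ l \<le> (1 / 3) ^ l" by simp
  also have "\<dots> \<le> exp (- 1) ^ l"
  proof (rule power_mono)
    show "1 / 3 \<le> exp (- 1 :: real)" using exp_le by (simp add: exp_minus field_simps)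
  qed simp
  also have "\<dots> = exp (- real l)" by (simp flip: exp_of_nat_mult)
  also have "\<dots> \<le> exp (- ln (1 / \<delta>))" using assms by simp
  also have "\<dots> = \<delta>" using assms by (simp add: ln_div)
  finally show ?thesis .
qed

text \<open>In the constant, 82944 * 256 is the moment constant at tolerance 1/16,
  \<open>2^19\<close> pays for the grid, and 12 = 2 * 6 combines the loss from rounding
  \<open>ln (1 / \<delta>)\<close> with the ratio 1/6 of \<open>two_sixth_power_le\<close>.\<close>

lemma sketched_regression_random_sign_matrix:
  assumes \<epsilon>: "0 < \<epsilon>" "\<epsilon> < 1" and \<delta>: "0 < \<delta>" "\<delta> < 1" and \<tau>: "0 < \<tau>" "\<tau> < 1" and k: "1 \<le> k"
    and A: "A \<in> carrier_mat n d\<^sub>1" and rank: "vec_space.rank n A \<le> k" and B: "B \<in> carrier_mat n d\<^sub>2"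
    and m: "real m \<ge> (82944 * 256 * 12 * 2 ^ 19) * real k * ln (1 / \<delta>) / \<epsilon>"
    and min: "regression_minimizer A B Xopt"
  shows "measure (random_sign_matrix m n)
    (sketched_regression_event \<tau> (1 + 11 * \<epsilon> + 7 * (\<tau> / \<delta>)) A B Xopt (random_sign_matrix m n)) \<ge> 1 - 3 * \<delta>"
proof (cases "\<delta> < 1 / 3")
  \<comment> \<open>Here the claimed lower bound is not positive. In the other case
    \<open>1 / \<delta> > 3 > exp 1\<close>, so \<open>ln (1 / \<delta>) \<ge> 1\<close>: this
    forces \<open>m > 0\<close>, and rounding up to \<open>l\<close> costs at most a factor
    2.\<close>
  case False
  then have "1 - 3 * \<delta> \<le> 0" by simp
  then show ?thesis using measure_nonneg order_trans by blast
next
  case True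
  let ?K = "82944 * 256 * 6 * 2 ^ 19 :: real"
  define l where "l = nat \<lceil>ln (1 / \<delta>)\<rceil>"
  have "ln (exp 1) \<le> ln (1 / \<delta>)"
  proof (rule ln_mono)
    have "exp 1 \<le> (3 :: real)" by (rule exp_le)
    also have "3 \<le> 1 / \<delta>" using True \<delta> by (simp add: field_simps)
    finally show "exp 1 \<le> 1 / \<delta>" .
  qed simp
  then have ln1: "1 \<le> ln (1 / \<delta>)" by simp
  then have l: "ln (1 / \<delta>) \<le> real l" "real l \<le> 2 * ln (1 / \<delta>)" "1 \<le> l" unfolding l_def by linarith+
  have kl: "?K * (real k * real l) \<le> real m * \<epsilon>"
  proof -
    have "?K * (real k * real l) \<le> ?K * (real k * (2 * ln (1 / \<delta>)))"
      using l by (intro mult_left_mono) auto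
    also have "\<dots> = ((82944 * 256 * 12 * 2 ^ 19) * real k * ln (1 / \<delta>) / \<epsilon>) * \<epsilon>" using \<epsilon> by simp
    also have "\<dots> \<le> real m * \<epsilon>" using m \<epsilon> by (intro mult_right_mono) auto
    finally show ?thesis .
  qed
  have kl0: "0 < real k * real l" using k l by simp
  have "real m * \<epsilon> \<le> real m" using \<epsilon> by (simp add: mult_left_le)
  with kl have kl': "?K * (real k * real l) \<le> real m" by linarith
  with kl0 have m0: "m > 0" by (cases m) auto
  have "real (k * l) \<le> ?K * (real k * real l)" using kl0 by simp
  with kl' have q: "k * l \<le> m" by (simp only: of_nat_le_iff[symmetric, where 'a = real]) 
  have "l \<le> k * l" using k by simp
  with q have ql: "l \<le> m" by linarith
  have kl1: "1 \<le> k * l" using k l by simp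
  \<comment> \<open>Moments of order \<open>l\<close> suffice here, since a single pair of matrices
    involves no union bound; the \<open>k / \<epsilon>\<close> in \<open>m\<close> pays for the
    accuracy.\<close>
  have amp: "approx_matrix_product n (sqrt (\<epsilon> / real k)) \<delta> (random_sign_matrix m n)"
  proof (rule approx_matrix_product_random_sign_matrix[OF m0 l(3) ql])
    show "sqrt (\<epsilon> / real k) > 0" using \<epsilon> k by simp
    have sq: "(sqrt (\<epsilon> / real k))\<^sup>2 = \<epsilon> / real k" using \<epsilon> by simp
    have "82944 * real l / (real m * (\<epsilon> / real k)) \<le> 1 / 6"
      using kl \<epsilon> k m0 kl0 by (simp add: field_simps)
    then have "(82944 * real l / (real m * (sqrt (\<epsilon> / real k))\<^sup>2)) ^ l \<le> (1 / 6) ^ l"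
      unfolding sq using \<epsilon> by (intro power_mono) auto
    then show "2 * (82944 * real l / (real m * (sqrt (\<epsilon> / real k))\<^sup>2)) ^ l \<le> \<delta>"
      using two_sixth_power_le[OF \<delta>(1) l(1,3)] by linarith
  qed
  have emb: "measure (random_sign_matrix m n) {S \<in> space (random_sign_matrix m n). subspace_embedding (1 / 3) S A} \<ge> 1 - \<delta>"
  proof (rule subspace_embedding_random_sign_matrix[OF m0 kl1 q A rank])
    have "82944 * 256 * real (k * l) / real m \<le> 1 / (6 * 2 ^ 19)"
      using kl' m0 by (simp add: field_simps)
    then have "(82944 * 256 * real (k * l) / real m) ^ (k * l) \<le> (1 / (6 * 2 ^ 19)) ^ (k * l)"
      by (intro power_mono) auto
    also have "\<dots> = (1 / 6) ^ (k * l) * (1 / 2 ^ 19) ^ (k * l)" by (simp only: times_divide_times_eq mult_1 flip: power_mult_distrib)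
    \<comment> \<open>The exponent \<open>k * l\<close> is at least \<open>l\<close>, which is
      enough for the factor 1/6, and at least \<open>k\<close>, so that the powers of
      \<open>1 / 2^19\<close> cancel the size of the grid.\<close>
    also have "\<dots> \<le> (1 / 6) ^ l * (1 / 2 ^ 19) ^ k"
      using k l by (intro mult_mono power_decreasing) auto
    finally have "2 * (2 ^ 19) ^ k * (82944 * 256 * real (k * l) / real m) ^ (k * l) \<le> 2 * (2 ^ 19) ^ k * ((1 / 6) ^ l * (1 / 2 ^ 19) ^ k)"
      by (intro mult_left_mono) auto
    also have "\<dots> = 2 * (1 / 6) ^ l" by (simp add: power_divide)
    also have "\<dots> \<le> \<delta>" by (rule two_sixth_power_le[OF \<delta>(1) l(1,3)])
    finally show "2 * (2 ^ 19) ^ k * (82944 * 256 * real (k * l) / real m) ^ (k * l) \<le> \<delta>" .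
  qed
  show ?thesis
    by (rule sketched_regression_probability[OF \<epsilon>(1) \<delta> \<tau> k A rank B matrix_distribution_random_sign_matrix emb amp
        isotropic_columns_random_sign_matrix[OF m0] min])
qed

theorem mainTheorem12:
  shows "\<exists>c\<^sub>1 c\<^sub>2 c\<^sub>3 :: real. c\<^sub>1 > 0 \<and> c\<^sub>2 > 0 \<and> c\<^sub>3 > 0 \<and>
    (\<forall>(n::nat) (d\<^sub>1::nat) (d\<^sub>2::nat) (m::nat) (k::nat) (\<epsilon>::real) (\<delta>::real) (\<tau>::real) A B P Xopt.
       0 < \<epsilon> \<and> \<epsilon> < 1 \<and> 0 < \<delta> \<and> \<delta> < 1 \<and> 0 < \<tau> \<and> \<tau> < 1 \<and> 1 \<le> k \<and>
       A \<in> carrier_mat n d\<^sub>1 \<and> vec_space.rank n A \<le> k \<and> B \<in> carrier_mat n d\<^sub>2 \<and>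
       matrix_distribution m n P \<and>
       measure P {S \<in> space P. subspace_embedding (1 / 3) S A} \<ge> 1 - \<delta> \<and>
       approx_matrix_product n (sqrt (\<epsilon> / real k)) \<delta> P \<and>
       isotropic_columns n P \<and>
       regression_minimizer A B Xopt \<longrightarrow>
       measure P (sketched_regression_event \<tau> (1 + c\<^sub>2 * \<epsilon> + c\<^sub>3 * (\<tau> / \<delta>)) A B Xopt P)
         \<ge> 1 - c\<^sub>1 * \<delta>) \<and>
    (\<exists>c\<^sub>4>0. \<forall>(n::nat) (d\<^sub>1::nat) (d\<^sub>2::nat) (m::nat) (k::nat) (\<epsilon>::real) (\<delta>::real) (\<tau>::real) A B Xopt.
       0 < \<epsilon> \<and> \<epsilon> < 1 \<and> 0 < \<delta> \<and> \<delta> < 1 \<and> 0 < \<tau> \<and> \<tau> < 1 \<and> 1 \<le> k \<and>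
       A \<in> carrier_mat n d\<^sub>1 \<and> vec_space.rank n A \<le> k \<and> B \<in> carrier_mat n d\<^sub>2 \<and>
       real m \<ge> c\<^sub>4 * real k * ln (1 / \<delta>) / \<epsilon> \<and>
       regression_minimizer A B Xopt \<longrightarrow>
       measure (random_sign_matrix m n)
           (sketched_regression_event \<tau> (1 + c\<^sub>2 * \<epsilon> + c\<^sub>3 * (\<tau> / \<delta>)) A B Xopt (random_sign_matrix m n))
         \<ge> 1 - c\<^sub>1 * \<delta>)"
\<comment> \<open>The 3 counts the failure events, and 11 and 7 come from
  \<open>sketched_regression_bound\<close>. The random sign matrix inherits all three and adds only
  its own constant for \<open>m\<close>.\<close>
proof (rule exI[of _ 3], rule exI[of _ 11], rule exI[of _ 7], intro conjI)
  show "\<exists>c\<^sub>4>0. \<forall>(n::nat) (d\<^sub>1::nat) (d\<^sub>2::nat) (m::nat) (k::nat) (\<epsilon>::real) (\<delta>::real) (\<tau>::real) A B Xopt.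
       0 < \<epsilon> \<and> \<epsilon> < 1 \<and> 0 < \<delta> \<and> \<delta> < 1 \<and> 0 < \<tau> \<and> \<tau> < 1 \<and> 1 \<le> k \<and>
       A \<in> carrier_mat n d\<^sub>1 \<and> vec_space.rank n A \<le> k \<and> B \<in> carrier_mat n d\<^sub>2 \<and>
       real m \<ge> c\<^sub>4 * real k * ln (1 / \<delta>) / \<epsilon> \<and>
       regression_minimizer A B Xopt \<longrightarrow>
       measure (random_sign_matrix m n)
           (sketched_regression_event \<tau> (1 + 11 * \<epsilon> + 7 * (\<tau> / \<delta>)) A B Xopt (random_sign_matrix m n))
         \<ge> 1 - 3 * \<delta>"
    by (rule exI[of _ "82944 * 256 * 12 * 2 ^ 19"], intro conjI allI impI, simp, elim conjE,
        rule sketched_regression_random_sign_matrix)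
qed ((intro allI impI, elim conjE, rule sketched_regression_probability; assumption) | simp)+

end
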